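(* Let $f\colon\mathbb T\to\mathbb R$ and $h\colon\mathbb T^2\to\mathbb R$ be Lipschitz, let $p$ be a probability density on $[0,1]$, extended $1$-periodically to $\mathbb R$, and let $c>0$ be such that $p(x)>c$ for all $x\in[0,1]$. Assume $$\kappa:=(1-c)\left(\operatorname{Lip}(f)+\operatorname{Lip}_1(h)+\operatorname{Lip}_2(h)\right)<\frac{\sqrt3}{2}.$$ Let $$\mathcal P_N(\mu)(dx)=\int_{\mathbb T^N}\prod_{j=1}^N p\Big(x_j-f(u_j)-\frac1N\sum_{k=1}^N h(u_j,u_k)\Big)dx_j\,d\mu(u),\qquad \mu\in\mathcal M_1(\mathbb T^N),$$ and $$\mathcal P(\nu)(dx)=\int_{\mathbb T}p\Big(x-f(u)-\int_{\mathbb T} h(u,v)\,d\nu(v)\Big)dx\,d\nu(u),\qquad\nu\in\mathcal M_1(\mathbb T).$$ Let $\{\mu_N\}_{N\ge2}$ be a family of exchangeable measures, $\mu_N\in\mathcal M_1(\mathbb T^N)$, such that for every fixed $k\in\mathbb N$, $$W^1_k\left(\pi_{\{1,\dots,k\}}\mu_N,(\pi_1\mu_N)^{\otimes k}\right)\longrightarrow0\qquad\text{as }N\to\infty.$$ Then $$\sup_{n\ge0}W^1_N\left(\mathcal P_N^n(\mu_N),(\mathcal P^n(\pi_1\mu_N))^{\otimes N}\right)\longrightarrow0\qquad\text{as }N\to\infty.$$ If in addition $p$ is a function of bounded variation, then for every fixed $k\in\mathbb N$, $$\sup_{n\ge1}\left\|\pi_{\{1,\dots,k\}}\mathcal P_N^n(\mu_N)-(\mathcal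 P^n(\pi_1\mu_N))^{\otimes k}\right\|_{TV}\longrightarrow0\qquad\text{as }N\to\infty.$$
   Context: $\mathbb T=\mathbb R/\mathbb Z$ with the arc-length distance $d$ (so $d(x,y)=\min_{m\in\mathbb Z}|x-y-m|$), and $\mathcal M_1(X)$ is the set of Borel probability measures on $X$. $\operatorname{Lip}(f)$ is the Lipschitz constant of $f$ with respect to $d$. $\operatorname{Lip}_1(h)=\sup_{u_1\ne u_1',\,u_2}\frac{|h(u_1,u_2)-h(u_1',u_2)|}{d(u_1,u_1')}$, and $\operatorname{Lip}_2(h)$ is defined analogously in the second variable. $\mathcal P_N$ is the transfer operator of the Markov chain $x_i^{n+1}=f(x_i^n)+\frac1N\sum_{j=1}^N h(x_i^n,x_j^n)+\omega_i^n \bmod 1$, $i=1,\dots,N$, where the $\omega_i^n$ are i.i.d. with density $p$; $\mathcal P$ is the associated self-consistent transfer operator. Superscript $n$ denotes $n$-fold iteration. For any dimension $N\ge 1$, $g\colon\mathbb T^N\to\mathbb R$ and $1\le i\le N$, $$\operatorname{Lip}_i(g)=\sup_{x_{-i}\in\mathbb T^{N-1}}\sup_{x_i\ne x_i'}\frac{|g(x_i,x_{-i})-g(x_i',x_{-i})|}{d(x_i,x_i')},$$ where $x_{-i}$ is the vector of the coordinates other than the $i$-th; and $\operatorname{Lip}^N(g)=\sum_{i=1}^N\operatorname{Lip}_i(g)$. The $N$-dimensional Dobrushin-Wasserstein distance on $\mathcal M_1(\mathbb T^N)$ is $$W^1_N(\mu_1,\mu_2)=\sup_{g\colon\mathbb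 T^N\to\mathbb R,\ \operatorname{Lip}^N(g)\le1}\int g\,d(\mu_1-\mu_2).$$ A measure $\mu\in\mathcal M_1(\mathbb T^N)$ is exchangeable if it is invariant under all permutations of the coordinates: $\int g(x_1,\dots,x_N)\,d\mu=\int g(x_{\sigma(1)},\dots,x_{\sigma(N)})\,d\mu$ for every permutation $\sigma$ of $\{1,\dots,N\}$ and every bounded measurable $g$. For $N\ge k$, $\pi_{\{1,\dots,k\}}\mu\in\mathcal M_1(\mathbb T^k)$ denotes the marginal of $\mu\in\mathcal M_1(\mathbb T^N)$ on the first $k$ coordinates, and $\pi_1\mu\in\mathcal M_1(\mathbb T)$ the marginal on the first coordinate. $\|\cdot\|_{TV}$ is the total variation norm. *)

theory Defs
  imports "HOL-Probability.Probability"
begin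

text \<open>
  The circle \<open>\<real> / \<int>\<close> with the arc-length metric.  The topology is the one induced by the
  metric, so that \<^term>\<open>borel\<close> on the circle is the Borel sigma-algebra for that metric.
\<close>

quotient_type circle = real / "\<lambda>x y::real. x - y \<in> \<int>"
proof (rule equivpI)
  show "reflp (\<lambda>x y::real. x - y \<in> \<int>)"
    by (simp add: reflp_def)
  show "symp (\<lambda>x y::real. x - y \<in> \<int>)"
    by (metis (mono_tags, lifting) Ints_minus minus_diff_eq sympI)
  show "transp (\<lambda>x y::real. x - y \<in> \<int>)"
  proof (rule transpI)
    fix x y z :: real
    assume "x - y \<in> \<int>" "y - z \<in> \<int>"
    then have "(x - y) + (y - z) \<in> \<int>" by (rule Ints_add)
    then show "x - z \<in> \<int>" by simp
  qed
qed

lift_definition to_circle :: "real \<Rightarrow> circle" is "\<lambda>x. x" .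

lift_definition circle_rep :: "circle \<Rightarrow> real" is "frac :: real \<Rightarrow> real"
proof -
  fix x y :: real
  assume "x - y \<in> \<int>"
  then obtain k where "x = y + of_int k" by (metis Ints_cases add.commute diff_add_cancel)
  then show "frac x = frac y" by (simp add: frac_def)
qed

lemma to_circle_rep [simp]: "to_circle (circle_rep x) = x"
  by transfer (simp add: frac_def)

lemma circle_rep_to_circle: "circle_rep (to_circle x) = frac x"
  by transfer simp

lemma to_circle_eq_iff: "to_circle x = to_circle y \<longleftrightarrow> x - y \<in> \<int>"
  by transfer simp

lemma Inf_int_dist_eq_infdist: "(INF m::int. \<bar>a - of_int m\<bar>) = infdist (a::real) \<int>"
  by (simp add: infdist_def Ints_def image_image dist_real_def)

lemma infdist_Ints_attained:
  obtains m :: int where "infdist (a::real) \<int> = \<bar>a - of_int m\<bar>"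
proof -
  obtain x where "x \<in> \<int>" "infdist a \<int> = dist a x"
    using infdist_attains_inf[of "\<int>::real set" a] closed_Ints by (metis Ints_0 empty_iff)
  then show ?thesis using that by (metis Ints_cases dist_real_def)
qed

lemma infdist_Ints_le: "infdist (a::real) \<int> \<le> \<bar>a - of_int m\<bar>"
  using infdist_le[of "of_int m :: real" \<int> a] by (simp add: dist_real_def)

lemma infdist_Ints_diff: "infdist (a - b::real) \<int> \<le> infdist a \<int> + infdist b \<int>"
proof -
  obtain m n :: int where "infdist a \<int> = \<bar>a - of_int m\<bar>" "infdist b \<int> = \<bar>b - of_int n\<bar>"
    by (metis infdist_Ints_attained)
  then show ?thesis
    using infdist_Ints_le[of "a - b" "m - n"] by simp
qed

lemma infdist_Ints_eq_0_iff: "infdist (a::real) \<int> = 0 \<longleftrightarrow> a \<in> \<int>"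
  using in_closed_iff_infdist_zero[of "\<int>::real set" a] closed_Ints by (metis Ints_0 empty_iff)

lemma infdist_Ints_cong:
  assumes "a - b \<in> \<int>"
  shows "infdist (a::real) \<int> = infdist b \<int>"
proof -
  have "infdist (a - b) \<int> = 0" "infdist (b - a) \<int> = 0"
    using assms by (simp_all add: infdist_Ints_eq_0_iff) (metis Ints_minus minus_diff_eq)
  then show ?thesis
    using infdist_Ints_diff[of a "a - b"] infdist_Ints_diff[of b "b - a"] by simp
qed

instantiation circle :: metric_space
begin

lift_definition dist_circle :: "circle \<Rightarrow> circle \<Rightarrow> real"
  is "\<lambda>x y. INF m::int. \<bar>x - y - of_int m\<bar>"
proof -
  fix x x' y y' :: real
  assume "x - x' \<in> \<int>" "y - y' \<in> \<int>"
  then have "(x - x') - (y - y') \<in> \<int>" by (rule Ints_diff)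
  then have "(x - y) - (x' - y') \<in> \<int>" by (simp add: algebra_simps)
  then show "(INF m::int. \<bar>x - y - of_int m\<bar>) = (INF m::int. \<bar>x' - y' - of_int m\<bar>)"
    unfolding Inf_int_dist_eq_infdist by (rule infdist_Ints_cong)
qed

definition uniformity_circle :: "(circle \<times> circle) filter"
  where "uniformity_circle = (INF e\<in>{0<..}. principal {(x, y). dist x y < e})"

definition open_circle :: "circle set \<Rightarrow> bool"
  where "open_circle U \<longleftrightarrow> (\<forall>x\<in>U. \<forall>\<^sub>F (x', y) in uniformity. x' = x \<longrightarrow> y \<in> U)"

instance
proof
  fix x y z :: circle
  show "dist x y = 0 \<longleftrightarrow> x = y"
    by transfer (simp add: Inf_int_dist_eq_infdist infdist_Ints_eq_0_iff)
  show "dist x y \<le> dist x z + dist y z"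
  proof transfer
    fix x y z :: real
    show "(INF m::int. \<bar>x - y - of_int m\<bar>)
        \<le> (INF m::int. \<bar>x - z - of_int m\<bar>) + (INF m::int. \<bar>y - z - of_int m\<bar>)"
      unfolding Inf_int_dist_eq_infdist
      using infdist_Ints_diff[of "x - z" "y - z"] by simp
  qed
qed (rule uniformity_circle_def open_circle_def)+

end

lemma dist_to_circle_le: "dist (to_circle x) (to_circle y) \<le> dist x y"
proof -
  have "dist (to_circle x) (to_circle y) = infdist (x - y) \<int>"
    by transfer (simp add: Inf_int_dist_eq_infdist)
  then show ?thesis
    using infdist_Ints_le[of "x - y" 0] by (simp add: dist_real_def)
qed

lemma continuous_on_to_circle: "continuous_on A to_circle"
  unfolding continuous_on_iff by (metis dist_to_circle_le le_less_trans)

lemma to_circle_measurable [measurable]: "to_circle \<in> borel_measurable borel"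
  by (intro borel_measurable_continuous_onI continuous_on_to_circle)

lemma open_to_circle_image:
  assumes "open U"
  shows "open (to_circle ` U)"
  unfolding open_dist
proof safe
  fix x assume "x \<in> U"
  then obtain e where e: "e > 0" "\<And>y. dist y x < e \<Longrightarrow> y \<in> U"
    using assms by (metis open_dist)
  have "z \<in> to_circle ` U" if z: "dist z (to_circle x) < e" for z
  proof -
    obtain y where y: "z = to_circle y" by (metis to_circle_rep)
    have "dist z (to_circle x) = infdist (y - x) \<int>"
      unfolding y by transfer (simp add: Inf_int_dist_eq_infdist)
    moreover obtain m :: int where "infdist (y - x) \<int> = \<bar>y - x - of_int m\<bar>"
      by (rule infdist_Ints_attained)
    ultimately have "dist (y - of_int m) x < e"
      using z by (simp add: dist_real_def algebra_simps)
    then have "y - of_int m \<in> U" by (rule e)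
    moreover have "z = to_circle (y - of_int m)"
      unfolding y to_circle_eq_iff by simp
    ultimately show ?thesis by blast
  qed
  then show "\<exists>e>0. \<forall>y. dist y (to_circle x) < e \<longrightarrow> y \<in> to_circle ` U"
    using e(1) by blast
qed

text \<open>
  Second countability is what makes the product sigma-algebra below coincide with the
  Borel sigma-algebra of the finite product of circles.
\<close>

instance circle :: second_countable_topology
proof
  obtain B :: "real set set" where B: "countable B" "topological_basis B"
    using ex_countable_basis by blast
  have "topological_basis ((`) to_circle ` B)"
  proof (rule topological_basisI)
    fix C assume "C \<in> (`) to_circle ` B"
    then show "open C"
      using B(2) open_to_circle_image topological_basis_open by blast
  next
    fix U :: "circle set" and x assume U: "open U" "x \<in> U"
    have "open (to_circle -` U)"
      using continuous_on_to_circle[of UNIV] U(1) by (metis continuous_on_open_vimage open_UNIV inf_top_right)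
    moreover have "circle_rep x \<in> to_circle -` U" using U(2) by simp
    ultimately obtain b where "b \<in> B" "circle_rep x \<in> b" "b \<subseteq> to_circle -` U"
      using B(2) by (meson topological_basisE)
    then show "\<exists>C\<in>(`) to_circle ` B. x \<in> C \<and> C \<subseteq> U"
      by (intro bexI[of _ "to_circle ` b"]) (auto intro: image_eqI[of _ _ "circle_rep x"])
  qed
  then show "\<exists>B::circle set set. countable B \<and> open = generate_topology B"
    using B(1) topological_basis_imp_subbasis by (metis countable_image)
qed

definition circle_lebesgue :: "circle measure"
  where "circle_lebesgue = distr (restrict_space lborel {0..<1}) borel to_circle"

text \<open>
  The \<open>N\<close>-fold product of the circle, with coordinates indexed by \<open>{1..N}\<close>; points are
  extensional functions.
\<close>

abbreviation torus :: "nat \<Rightarrow> (nat \<Rightarrow> circle) measure"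
  where "torus N \<equiv> PiM {1..N} (\<lambda>_. borel)"

definition prob_measures :: "'a measure \<Rightarrow> 'a measure set"
  where "prob_measures M = {\<mu>. prob_space \<mu> \<and> sets \<mu> = sets M}"

definition marginal :: "nat \<Rightarrow> (nat \<Rightarrow> circle) measure \<Rightarrow> (nat \<Rightarrow> circle) measure"
  where "marginal k \<mu> = distr \<mu> (torus k) (\<lambda>x. restrict x {1..k})"

definition marginal1 :: "(nat \<Rightarrow> circle) measure \<Rightarrow> circle measure"
  where "marginal1 \<mu> = distr \<mu> borel (\<lambda>x. x 1)"

definition measure_power :: "circle measure \<Rightarrow> nat \<Rightarrow> (nat \<Rightarrow> circle) measure"
  where "measure_power \<nu> N = PiM {1..N} (\<lambda>_. \<nu>)"

definition exchangeable :: "nat \<Rightarrow> (nat \<Rightarrow> circle) measure \<Rightarrow> bool"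
  where "exchangeable N \<mu> \<longleftrightarrow>
    (\<forall>\<sigma>. \<sigma> permutes {1..N} \<longrightarrow>
      (\<forall>g :: (nat \<Rightarrow> circle) \<Rightarrow> real.
        g \<in> borel_measurable (torus N) \<and> bounded (g ` space (torus N)) \<longrightarrow>
        (\<integral>x. g x \<partial>\<mu>) = (\<integral>x. g (\<lambda>i\<in>{1..N}. x (\<sigma> i)) \<partial>\<mu>)))"

text \<open>
  Lipschitz constants are extended reals, infinite when the function is not Lipschitz.
\<close>

definition Lip :: "(circle \<Rightarrow> real) \<Rightarrow> ereal"
  where "Lip f = (SUP (u, u') \<in> {(u, u'). u \<noteq> u'}. ereal (\<bar>f u - f u'\<bar> / dist u u'))"

definition Lip_fst :: "(circle \<times> circle \<Rightarrow> real) \<Rightarrow> ereal"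
  where "Lip_fst h = (SUP (u, u', v) \<in> {(u, u', v). u \<noteq> u'}.
    ereal (\<bar>h (u, v) - h (u', v)\<bar> / dist u u'))"

definition Lip_snd :: "(circle \<times> circle \<Rightarrow> real) \<Rightarrow> ereal"
  where "Lip_snd h = (SUP (u, v, v') \<in> {(u, v, v'). v \<noteq> v'}.
    ereal (\<bar>h (u, v) - h (u, v')\<bar> / dist v v'))"

definition Lip_coord :: "nat \<Rightarrow> nat \<Rightarrow> ((nat \<Rightarrow> circle) \<Rightarrow> real) \<Rightarrow> ereal"
  where "Lip_coord N i g = (SUP x \<in> space (torus N). SUP s \<in> {s. s \<noteq> x i}.
    ereal (\<bar>g x - g (x(i := s))\<bar> / dist (x i) s))"

definition Lip_total :: "nat \<Rightarrow> ((nat \<Rightarrow> circle) \<Rightarrow> real) \<Rightarrow> ereal"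
  where "Lip_total N g = (\<Sum>i\<in>{1..N}. Lip_coord N i g)"

text \<open>
  The test functions below are not required to be measurable: a finite \<^const>\<open>Lip_total\<close>
  already makes them continuous on the space of \<^term>\<open>torus N\<close>.
\<close>

definition dobrushin_wasserstein ::
    "nat \<Rightarrow> (nat \<Rightarrow> circle) measure \<Rightarrow> (nat \<Rightarrow> circle) measure \<Rightarrow> ereal"
  where "dobrushin_wasserstein N \<mu> \<nu> =
    (SUP g \<in> {g. Lip_total N g \<le> 1}. ereal ((\<integral>x. g x \<partial>\<mu>) - (\<integral>x. g x \<partial>\<nu>)))"

text \<open>
  The total mass of the total variation measure of \<open>\<mu> - \<nu>\<close>; for probability measures
  this is twice the supremum of \<open>\<bar>\<mu> A - \<nu> A\<bar>\<close>.
\<close>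

definition tv_norm_diff :: "'a measure \<Rightarrow> 'a measure \<Rightarrow> ereal"
  where "tv_norm_diff \<mu> \<nu> =
    (SUP P \<in> {P. finite P \<and> P \<subseteq> sets \<mu> \<and> disjoint P \<and> \<Union>P = space \<mu>}.
      ereal (\<Sum>A\<in>P. \<bar>measure \<mu> A - measure \<nu> A\<bar>))"

text \<open>
  A 1-periodic density on the real line is evaluated at a difference between a point of the circle
  and a real number; which representative of the point is used does not matter.
\<close>

definition particle_transfer ::
    "(real \<Rightarrow> real) \<Rightarrow> (circle \<Rightarrow> real) \<Rightarrow> (circle \<times> circle \<Rightarrow> real) \<Rightarrow> nat \<Rightarrow>
      (nat \<Rightarrow> circle) measure \<Rightarrow> (nat \<Rightarrow> circle) measure"
  where "particle_transfer p f h N \<mu> =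
    density (PiM {1..N} (\<lambda>_. circle_lebesgue))
      (\<lambda>x. \<integral>\<^sup>+u. ennreal (\<Prod>j\<in>{1..N}.
        p (circle_rep (x j) - f (u j) - (1 / real N) * (\<Sum>k\<in>{1..N}. h (u j, u k)))) \<partial>\<mu>)"

definition self_consistent_transfer ::
    "(real \<Rightarrow> real) \<Rightarrow> (circle \<Rightarrow> real) \<Rightarrow> (circle \<times> circle \<Rightarrow> real) \<Rightarrow>
      circle measure \<Rightarrow> circle measure"
  where "self_consistent_transfer p f h \<nu> =
    density circle_lebesgue
      (\<lambda>x. \<integral>\<^sup>+u. ennreal (p (circle_rep x - f u - (\<integral>v. h (u, v) \<partial>\<nu>))) \<partial>\<nu>)"

definition bounded_variation_on :: "real \<Rightarrow> real \<Rightarrow> (real \<Rightarrow> real) \<Rightarrow> bool"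
  where "bounded_variation_on a b p \<longleftrightarrow>
    (\<exists>V. \<forall>n. \<forall>t :: nat \<Rightarrow> real.
      t ` {..n} \<subseteq> {a..b} \<and> mono_on {..n} t \<longrightarrow> (\<Sum>i<n. \<bar>p (t (Suc i)) - p (t i)\<bar>) \<le> V)"

end

theory Submission
  imports Defs
begin

text \<open>
  Moving the centre of the noise by \<open>a\<close> changes the mean of a test function by at most
  \<open>(1 - c) Lip a\<close>, because the uniform part \<open>c\<close> of the density does not see rotations.  Hence the
  particle operator contracts the Dobrushin--Wasserstein distance by \<open>\<kappa> < 1\<close>.  Applied to a product
  measure it differs from the self-consistent operator only by the fluctuation of an empirical
  mean, which is \<open>O(N\<^sup>-\<^sup>1\<^sup>/\<^sup>2)\<close>, so an initial distance \<open>\<epsilon>\<close> stays below \<open>\<epsilon> + O(N\<^sup>-\<^sup>1\<^sup>/\<^sup>2)\<close> forever.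

  The initial distance on all \<open>N\<close> coordinates tends to zero by chaoticity of pairs: a test function
  may be symmetrized, then has Lipschitz constants \<open>1 / N\<close>, and after rounding to a finite net it
  depends, in a Lipschitz way, only on the empirical frequencies of the net points, whose variances
  are determined by the marginals on two coordinates.

  If \<open>p\<close> has bounded variation, moving the centre of the noise by \<open>a\<close> costs \<open>O(a)\<close> in total
  variation, so one application of the operator turns closeness in Wasserstein distance into
  closeness in total variation of the first \<open>k\<close> marginals.
\<close>

text \<open>All estimates are independent of \<open>N\<close> because the distance sums the
  Lipschitz constants over the coordinates: coordinate \<open>i\<close> acts on its own drift
  through \<open>f\<close> and the first slot of \<open>h\<close>, and on every drift through the
  second slot with weight \<open>1 / N\<close>, so one drift has total sensitivity at most
  \<open>Lip f + Lip_fst h + Lip_snd h\<close>. The obstacle lies at time 0, where chaoticity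
  concerns a fixed number of coordinates and the conclusion tests all \<open>N\<close> at once.
  Symmetrizing is free since both measures are exchangeable. Deterministic rounding would be
  discontinuous, out of reach for marginals that are close only in a Wasserstein sense; so points
  are rounded at random, by a Lipschitz partition of unity, and the covariance of two rounded
  coordinates is the integral of a Lipschitz function of a pair. Both conclusions share one
  estimate, which only asks how the mean of a test function reacts when the noise at coordinate
  \<open>j\<close> is shifted: by \<open>(1 - c) * L j\<close> for Lipschitz functions, by a
  constant for \<open>j \<le> k\<close> and 0 beyond for bounded functions of \<open>k\<close>
  coordinates.\<close>

declare One_nat_def [simp del]

section \<open>Rotations of the circle\<close>

lemma circle_rep_bounds: "0 \<le> circle_rep x" "circle_rep x < 1"
  by (transfer, simp add: frac_lt_1)+

lemma circle_rep_measurable [measurable]: "circle_rep \<in> borel_measurable borel"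
proof (rule borel_measurableI_less)
  fix t :: real
  have "{x. circle_rep x < t} = (if t \<le> 0 then {} else to_circle ` {0<..<min t 1} \<union> {to_circle 0})"
  proof (cases "t \<le> 0")
    case True
    then show ?thesis using circle_rep_bounds(1) by (auto simp: not_less intro: order_trans)
  next
    case False
    have "x \<in> to_circle ` {0<..<min t 1} \<union> {to_circle 0}" if "circle_rep x < t" for x
    proof (cases "circle_rep x = 0")
      case True
      then show ?thesis by (metis UnI2 singletonI to_circle_rep)
    next
      case False
      then have "circle_rep x \<in> {0<..<min t 1}"
        using that circle_rep_bounds[of x] by auto
      then show ?thesis by (metis UnI1 imageI to_circle_rep)
    qed
    moreover have "circle_rep x < t" if "x \<in> to_circle ` {0<..<min t 1} \<union> {to_circle 0}" for x
      using that False by (auto simp: circle_rep_to_circle frac_eq)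
    ultimately show ?thesis using False by auto
  qed
  moreover have "to_circle ` {0<..<min t 1} \<in> sets borel"
    by (intro borel_open open_to_circle_image) simp
  ultimately show "{x \<in> space borel. circle_rep x < t} \<in> sets borel"
    by auto
qed

lemma dist_circle_le_1: "dist (x :: circle) y \<le> 1"
proof -
  have "dist x y = dist (to_circle (circle_rep x)) (to_circle (circle_rep y))" by simp
  also have "\<dots> \<le> dist (circle_rep x) (circle_rep y)" by (rule dist_to_circle_le)
  also have "\<dots> \<le> 1"
    using circle_rep_bounds[of x] circle_rep_bounds[of y] by (auto simp: dist_real_def)
  finally show ?thesis .
qed

text \<open>The circle is a continuous image of \<open>{0..1}\<close>, hence compact and totally
  bounded.\<close>

lemma finite_circle_net:
  assumes "0 < e"
  obtains C :: "circle set" where "finite C" "\<And>x. \<exists>c\<in>C. dist x c < e"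
proof -
  have "compact (to_circle ` {0..1})"
    by (intro compact_continuous_image continuous_on_to_circle) auto
  moreover have "to_circle ` {0..1} = UNIV"
    using circle_rep_bounds by (metis (no_types, lifting) UNIV_eq_I atLeastAtMost_iff image_eqI less_imp_le to_circle_rep)
  ultimately obtain C :: "circle set" where C: "finite C" "UNIV \<subseteq> (\<Union>x\<in>C. ball x e)"
    using assms seq_compact_imp_totally_bounded compact_eq_seq_compact_metric by metis
  show ?thesis
  proof (rule that[OF C(1)])
    fix x
    obtain c where "c \<in> C" "x \<in> ball c e" using C(2) by blast
    then show "\<exists>c\<in>C. dist x c < e" by (auto simp: dist_commute)
  qed
qed

lemma sets_circle_lebesgue [measurable_cong, simp]: "sets circle_lebesgue = sets borel"
  by (simp add: circle_lebesgue_def)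

lemma space_circle_lebesgue [simp]: "space circle_lebesgue = UNIV"
  by (simp add: circle_lebesgue_def)

lemma to_circle_measurable_unit:
  "to_circle \<in> measurable (restrict_space lborel {0..<1}) borel"
  by (rule measurable_restrict_space1) simp

lemma prob_space_circle_lebesgue: "prob_space circle_lebesgue"
  unfolding circle_lebesgue_def
proof (rule prob_space.prob_space_distr[OF prob_space_restrict_space to_circle_measurable_unit])
qed simp_all

lemma nn_integral_circle_lebesgue:
  assumes [measurable]: "q \<in> borel_measurable borel"
  shows "(\<integral>\<^sup>+x. q x \<partial>circle_lebesgue) = (\<integral>\<^sup>+x\<in>{0..<1}. q (to_circle x) \<partial>lborel)"
  unfolding circle_lebesgue_def
  by (subst nn_integral_distr[OF to_circle_measurable_unit])
    (simp_all add: nn_integral_restrict_space)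

definition circle_shift :: "real \<Rightarrow> circle \<Rightarrow> circle"
  where "circle_shift a x = to_circle (circle_rep x + a)"

lemma circle_shift_measurable [measurable]: "circle_shift a \<in> borel_measurable borel"
  unfolding circle_shift_def by measurable

lemma circle_shift_to_circle: "circle_shift a (to_circle x) = to_circle (x + a)"
  unfolding circle_shift_def circle_rep_to_circle to_circle_eq_iff
  by (simp add: frac_def)

lemma dist_circle_shift: "dist (circle_shift a x) (circle_shift b x) \<le> \<bar>a - b\<bar>"
  using dist_to_circle_le[of "circle_rep x + a" "circle_rep x + b"]
  by (simp add: circle_shift_def dist_real_def)

text \<open>With \<open>b = frac a\<close> the rotated unit interval is \<open>{b..<1+b}\<close>;
  the piece beyond 1 is moved back by one period and closes the gap \<open>{0..<b}\<close>.\<close>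

lemma nn_integral_circle_shift:
  assumes [measurable]: "q \<in> borel_measurable borel"
  shows "(\<integral>\<^sup>+x. q (circle_shift a x) \<partial>circle_lebesgue) = (\<integral>\<^sup>+x. q x \<partial>circle_lebesgue)"
proof -
  define Q where "Q x = q (to_circle x)" for x
  define b where "b = frac a"
  have b: "0 \<le> b" "b < 1" by (auto simp: b_def frac_lt_1)
  have [measurable]: "Q \<in> borel_measurable borel" unfolding Q_def by measurable
  have per: "Q (x + of_int k) = Q x" for x k
    unfolding Q_def by (rule arg_cong[of _ _ q]) (simp add: to_circle_eq_iff)
  have "(\<integral>\<^sup>+x. q (circle_shift a x) \<partial>circle_lebesgue) = (\<integral>\<^sup>+x\<in>{0..<1}. Q (x + a) \<partial>lborel)"
    by (subst nn_integral_circle_lebesgue) (simp_all add: Q_def circle_shift_to_circle)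
  also have "\<dots> = (\<integral>\<^sup>+x\<in>{0..<1}. Q (b + x) \<partial>lborel)"
    using per[of "_ + b" "\<lfloor>a\<rfloor>"] by (simp add: b_def frac_def algebra_simps)
  also have "\<dots> = (\<integral>\<^sup>+x. (Q (b + x) * indicator {b..<1+b} (b + x)) \<partial>lborel)"
    by (intro nn_integral_cong) (auto split: split_indicator)
  also have "\<dots> = (\<integral>\<^sup>+x. (Q x * indicator {b..<1+b} x) \<partial>lborel)"
    using nn_integral_real_affine[of "\<lambda>x. Q x * indicator {b..<1+b} x" 1 b] by simp
  also have "\<dots> = (\<integral>\<^sup>+x. (Q x * indicator {b..<1} x + Q x * indicator {1..<1+b} x) \<partial>lborel)"
    using b by (intro nn_integral_cong) (auto split: split_indicator)
  also have "\<dots> = (\<integral>\<^sup>+x. (Q x * indicator {b..<1} x) \<partial>lborel) + (\<integral>\<^sup>+x. (Q x * indicator {1..<1+b} x) \<partial>lborel)"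
    by (rule nn_integral_add) auto
  also have "(\<integral>\<^sup>+x. (Q x * indicator {1..<1+b} x) \<partial>lborel) = (\<integral>\<^sup>+x. (Q (1 + x) * indicator {1..<1+b} (1 + x)) \<partial>lborel)"
    using nn_integral_real_affine[of "\<lambda>x. Q x * indicator {1..<1+b} x" 1 1] by simp
  also have "\<dots> = (\<integral>\<^sup>+x. (Q x * indicator {0..<b} x) \<partial>lborel)"
    using per[of _ 1] by (intro nn_integral_cong) (auto split: split_indicator simp: add.commute)
  also have "(\<integral>\<^sup>+x. (Q x * indicator {b..<1} x) \<partial>lborel) + (\<integral>\<^sup>+x. (Q x * indicator {0..<b} x) \<partial>lborel)
      = (\<integral>\<^sup>+x. (Q x * indicator {b..<1} x + Q x * indicator {0..<b} x) \<partial>lborel)"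
    by (rule nn_integral_add[symmetric]) auto
  also have "\<dots> = (\<integral>\<^sup>+x\<in>{0..<1}. Q x \<partial>lborel)"
    using b by (intro nn_integral_cong) (auto split: split_indicator)
  finally show ?thesis
    by (simp add: nn_integral_circle_lebesgue Q_def)
qed

lemma distr_circle_shift: "distr circle_lebesgue borel (circle_shift a) = circle_lebesgue"
proof (rule measure_eqI)
  fix A assume "A \<in> sets (distr circle_lebesgue borel (circle_shift a))"
  then have [measurable]: "A \<in> sets borel" by simp
  have "emeasure (distr circle_lebesgue borel (circle_shift a)) A
      = (\<integral>\<^sup>+x. indicator A x \<partial>distr circle_lebesgue borel (circle_shift a))"
    by simp
  also have "\<dots> = (\<integral>\<^sup>+x. indicator A (circle_shift a x) \<partial>circle_lebesgue)"
    by (rule nn_integral_distr) simp_all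
  also have "\<dots> = (\<integral>\<^sup>+x. indicator A x \<partial>circle_lebesgue)"
    by (rule nn_integral_circle_shift) simp
  finally show "emeasure (distr circle_lebesgue borel (circle_shift a)) A = emeasure circle_lebesgue A"
    by simp
qed simp

lemma integral_circle_shift:
  fixes q :: "circle \<Rightarrow> real"
  assumes [measurable]: "q \<in> borel_measurable borel"
  shows "(\<integral>x. q (circle_shift a x) \<partial>circle_lebesgue) = (\<integral>x. q x \<partial>circle_lebesgue)"
  using integral_distr[of "circle_shift a" circle_lebesgue borel q] by (simp add: distr_circle_shift)

lemma integrable_circle_shift:
  fixes q :: "circle \<Rightarrow> real"
  assumes "integrable circle_lebesgue q"
  shows "integrable circle_lebesgue (\<lambda>x. q (circle_shift a x))"
  using assms integrable_distr[of "circle_shift a" circle_lebesgue borel q] by (simp add: distr_circle_shift)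

lemma circle_two_points: "\<exists>u u' :: circle. u \<noteq> u'"
proof -
  have "circle_rep (to_circle 0) \<noteq> circle_rep (to_circle (1/2))"
    by (simp add: circle_rep_to_circle frac_eq)
  then show ?thesis by metis
qed

section \<open>The noise\<close>

locale circle_noise =
  fixes p :: "real \<Rightarrow> real"
  assumes p_measurable [measurable]: "p \<in> borel_measurable borel"
    and p_nonneg: "0 \<le> p x"
    and p_periodic: "p (x + 1) = p x"
    and p_density: "(\<integral>\<^sup>+x\<in>{0..1}. ennreal (p x) \<partial>lborel) = 1"
begin

text \<open>The law of \<open>a + \<omega>\<close> modulo 1 when \<open>\<omega>\<close> has density
  \<open>p\<close>.\<close>

definition noise :: "real \<Rightarrow> circle measure"
  where "noise a = density circle_lebesgue (\<lambda>x. ennreal (p (circle_rep x - a)))"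

lemma sets_noise [measurable_cong, simp]: "sets (noise a) = sets borel"
  by (simp add: noise_def)

lemma space_noise [simp]: "space (noise a) = UNIV"
  by (simp add: noise_def)

lemma p_periodic_nat: "p (x + real n) = p x"
proof (induction n)
  case (Suc n)
  then show ?case using p_periodic[of "x + real n"] by (simp add: algebra_simps)
qed simp

lemma p_periodic_int: "p (x + of_int k) = p x"
proof (cases "k \<ge> 0")
  case True
  then show ?thesis using p_periodic_nat[of x "nat k"] by simp
next
  case False
  then show ?thesis using p_periodic_nat[of "x + of_int k" "nat (- k)"] by simp
qed

lemma p_circle_shift: "p (circle_rep (circle_shift a x) - b) = p (circle_rep x + a - b)"
proof -
  have "circle_rep (circle_shift a x) - b = circle_rep x + a - b + of_int (- \<lfloor>circle_rep x + a\<rfloor>)"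
    by (simp add: circle_shift_def circle_rep_to_circle frac_def)
  then show ?thesis by (simp only: p_periodic_int)
qed

text \<open>Rotating back by \<open>a\<close> reduces to \<open>a = 0\<close>. The normalization is
  given on the closed interval while \<open>circle_lebesgue\<close> lives on the half-open one; they
  differ by a null point.\<close>

lemma nn_integral_p: "(\<integral>\<^sup>+x. ennreal (p (circle_rep x - a)) \<partial>circle_lebesgue) = 1"
proof -
  have "(\<integral>\<^sup>+x. ennreal (p (circle_rep x - a)) \<partial>circle_lebesgue)
      = (\<integral>\<^sup>+x. ennreal (p (circle_rep (circle_shift (- a) x))) \<partial>circle_lebesgue)"
    using p_circle_shift[of "- a" _ 0] by simp
  also have "\<dots> = (\<integral>\<^sup>+x. ennreal (p (circle_rep x)) \<partial>circle_lebesgue)"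
    by (rule nn_integral_circle_shift) measurable
  also have "\<dots> = (\<integral>\<^sup>+x\<in>{0..<1}. ennreal (p (circle_rep (to_circle x))) \<partial>lborel)"
    by (rule nn_integral_circle_lebesgue) measurable
  also have "\<dots> = (\<integral>\<^sup>+x\<in>{0..1}. ennreal (p x) \<partial>lborel)"
    using AE_lborel_singleton[of "1::real"]
    by (intro nn_integral_cong_AE)
      (auto elim!: eventually_mono split: split_indicator simp: circle_rep_to_circle frac_eq)
  finally show ?thesis using p_density by simp
qed

lemma prob_space_noise: "prob_space (noise a)"
  by (rule prob_spaceI) (simp add: noise_def emeasure_density nn_integral_p)

lemma integrable_p: "integrable circle_lebesgue (\<lambda>x. p (circle_rep x - a))"
  by (rule integrableI_nonneg) (auto simp: p_nonneg nn_integral_p)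

lemma integral_p: "(\<integral>x. p (circle_rep x - a) \<partial>circle_lebesgue) = 1"
  by (subst integral_eq_nn_integral) (auto simp: p_nonneg nn_integral_p)

lemma integral_noise_density:
  assumes [measurable]: "\<phi> \<in> borel_measurable borel"
  shows "(\<integral>x. \<phi> x \<partial>noise a) = (\<integral>x. p (circle_rep x - a) * \<phi> x \<partial>circle_lebesgue)"
  unfolding noise_def by (subst integral_density) (auto simp: p_nonneg)

text \<open>Moves the dependence on \<open>a\<close> from the density, which has no regularity, to
  the test function.\<close>

lemma integral_noise:
  assumes [measurable]: "\<phi> \<in> borel_measurable borel"
  shows "(\<integral>x. \<phi> x \<partial>noise a) = (\<integral>x. p (circle_rep x) * \<phi> (circle_shift a x) \<partial>circle_lebesgue)"
  using integral_circle_shift[of "\<lambda>x. p (circle_rep x - a) * \<phi> x" a]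
  by (simp add: integral_noise_density p_circle_shift)

text \<open>Once \<open>a\<close> and \<open>b\<close> sit in the test function,
  \<open>p - c\<close> is a nonnegative density of mass \<open>1 - c\<close> that sees a change of
  at most \<open>L * \<bar>a - b\<bar>\<close>. The constant part \<open>c\<close> contributes the
  same integral twice, which cancels.\<close>

lemma noise_contraction:
  fixes \<phi> :: "circle \<Rightarrow> real"
  assumes L: "\<And>x y. \<bar>\<phi> x - \<phi> y\<bar> \<le> L * dist x y"
    and c: "0 \<le> c" "\<And>x. x \<in> {0..1} \<Longrightarrow> c < p x"
  shows "\<bar>(\<integral>x. \<phi> x \<partial>noise a) - (\<integral>x. \<phi> x \<partial>noise b)\<bar> \<le> (1 - c) * L * \<bar>a - b\<bar>"
proof -
  interpret cl: prob_space circle_lebesgue by (rule prob_space_circle_lebesgue)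
  \<comment> \<open>\<open>L\<close> is not assumed nonnegative; two distinct points force
    it.\<close>
  obtain u u' :: circle where "u \<noteq> u'" using circle_two_points by blast
  then have L0: "0 \<le> L"
    using L[of u u'] by (metis abs_ge_zero dual_order.trans zero_le_dist zero_le_mult_iff dist_eq_0_iff order_antisym)
  have "continuous_on UNIV \<phi>"
  proof (rule lipschitz_on_continuous_on)
    show "L-lipschitz_on UNIV \<phi>" using L L0 by (auto simp: lipschitz_on_def dist_real_def)
  qed
  then have [measurable]: "\<phi> \<in> borel_measurable borel"
    by (rule borel_measurable_continuous_onI)
  define B where "B = \<bar>\<phi> u\<bar> + L"
  have B: "\<bar>\<phi> x\<bar> \<le> B" for x
    using L[of x u] mult_left_mono[OF dist_circle_le_1[of x u] L0] by (simp add: B_def)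
  have int1: "integrable circle_lebesgue (\<lambda>x. \<phi> (circle_shift a x))" for a
    by (rule cl.integrable_const_bound[of _ B]) (auto simp: B)
  have int2: "integrable circle_lebesgue (\<lambda>x. p (circle_rep x) * \<phi> (circle_shift a x))" for a
    by (rule Bochner_Integration.integrable_bound[OF integrable_mult_right[OF integrable_p[of 0], of B]])
      (use B B_def L0 in \<open>auto simp: abs_mult p_nonneg mult.commute intro!: mult_mono\<close>)
  have "(\<integral>x. \<phi> x \<partial>noise a) - (\<integral>x. \<phi> x \<partial>noise b)
     = (\<integral>x. p (circle_rep x) * \<phi> (circle_shift a x) - p (circle_rep x) * \<phi> (circle_shift b x) \<partial>circle_lebesgue)"
    using int2 by (simp add: integral_noise)
  also have "\<dots> = (\<integral>x. (p (circle_rep x) - c) * (\<phi> (circle_shift a x) - \<phi> (circle_shift b x))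
      + c * (\<phi> (circle_shift a x) - \<phi> (circle_shift b x)) \<partial>circle_lebesgue)"
    by (simp add: algebra_simps)
  also have "\<dots> = (\<integral>x. (p (circle_rep x) - c) * (\<phi> (circle_shift a x) - \<phi> (circle_shift b x)) \<partial>circle_lebesgue)
      + (\<integral>x. c * (\<phi> (circle_shift a x) - \<phi> (circle_shift b x)) \<partial>circle_lebesgue)"
    using int1 int2 by (intro Bochner_Integration.integral_add) (auto simp: algebra_simps)
  also have "(\<integral>x. c * (\<phi> (circle_shift a x) - \<phi> (circle_shift b x)) \<partial>circle_lebesgue) = 0"
    using int1 by (simp add: integral_circle_shift)
  finally have "\<bar>(\<integral>x. \<phi> x \<partial>noise a) - (\<integral>x. \<phi> x \<partial>noise b)\<bar>
      = \<bar>\<integral>x. (p (circle_rep x) - c) * (\<phi> (circle_shift a x) - \<phi> (circle_shift b x)) \<partial>circle_lebesgue\<bar>"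
    by simp
  also have "\<dots> \<le> (\<integral>x. \<bar>(p (circle_rep x) - c) * (\<phi> (circle_shift a x) - \<phi> (circle_shift b x))\<bar> \<partial>circle_lebesgue)"
    by (rule integral_abs_bound)
  also have "\<dots> \<le> (\<integral>x. (p (circle_rep x) - c) * (L * \<bar>a - b\<bar>) \<partial>circle_lebesgue)"
  proof (rule integral_mono_AE)
    show "integrable circle_lebesgue (\<lambda>x. \<bar>(p (circle_rep x) - c) * (\<phi> (circle_shift a x) - \<phi> (circle_shift b x))\<bar>)"
      using int1 int2 by (intro integrable_abs) (auto simp: algebra_simps)
    show "integrable circle_lebesgue (\<lambda>x. (p (circle_rep x) - c) * (L * \<bar>a - b\<bar>))"
      using integrable_p[of 0] by simp
    have "\<bar>(p (circle_rep x) - c) * (\<phi> (circle_shift a x) - \<phi> (circle_shift b x))\<bar>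
        \<le> (p (circle_rep x) - c) * (L * \<bar>a - b\<bar>)" for x
    proof -
      have "c < p (circle_rep x)" using c(2) circle_rep_bounds[of x] by simp
      moreover have "\<bar>\<phi> (circle_shift a x) - \<phi> (circle_shift b x)\<bar> \<le> L * \<bar>a - b\<bar>"
        using L[of "circle_shift a x" "circle_shift b x"] mult_left_mono[OF dist_circle_shift[of a x b] L0]
        by simp
      ultimately show ?thesis by (simp add: abs_mult mult_left_mono)
    qed
    then show "AE x in circle_lebesgue. \<bar>(p (circle_rep x) - c) * (\<phi> (circle_shift a x) - \<phi> (circle_shift b x))\<bar>
        \<le> (p (circle_rep x) - c) * (L * \<bar>a - b\<bar>)" by simp
  qed
  also have "\<dots> = (1 - c) * L * \<bar>a - b\<bar>"
    using integrable_p[of 0] integral_p[of 0] cl.prob_space by simp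
  finally show ?thesis .
qed

section \<open>Densities of bounded variation\<close>

definition variation :: "real \<Rightarrow> real"
  where "variation x = (SUP (n, t) \<in> {(n, t). t ` {..n::nat} \<subseteq> {0..max 0 (min 1 x)} \<and> mono_on {..n} t}.
    \<Sum>i<n. \<bar>p (t (Suc i)) - p (t i)\<bar>)"

text \<open>Appending \<open>x\<close> and then \<open>y\<close> to a partition of
  \<open>{0..x}\<close> gives a partition of \<open>{0..y}\<close> whose sum exceeds the old one by
  at least \<open>\<bar>p y - p x\<bar>\<close>. Bounded variation keeps the suprema finite.\<close>

lemma variation_bound:
  assumes bv: "bounded_variation_on 0 1 p" and xy: "0 \<le> x" "x \<le> y" "y \<le> 1"
  shows "variation x + \<bar>p y - p x\<bar> \<le> variation y"
proof -
  obtain V where V: "\<And>n t. t ` {..n::nat} \<subseteq> {0..1} \<Longrightarrow> mono_on {..n} t \<Longrightarrow>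
      (\<Sum>i<n. \<bar>p (t (Suc i)) - p (t i)\<bar>) \<le> V"
    using bv unfolding bounded_variation_on_def by blast
  let ?S = "\<lambda>(n, t). \<Sum>i<n. \<bar>p (t (Suc i)) - p (t i)\<bar>"
  let ?P = "\<lambda>x. {(n, t). t ` {..n::nat} \<subseteq> {0..x} \<and> mono_on {..n} t}"
  have T: "variation x = (SUP r\<in>?P x. ?S r)" "variation y = (SUP r\<in>?P y. ?S r)"
    using xy by (simp_all add: variation_def)
  have bdd: "bdd_above (?S ` ?P y)"
  proof (rule bdd_aboveI2)
    fix r assume "r \<in> ?P y"
    then obtain n t where r: "r = (n, t)" "t ` {..n} \<subseteq> {0..y}" "mono_on {..n} t" by blast
    have "t ` {..n} \<subseteq> {0..1}" using r(2) xy(3) by fastforce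
    then show "?S r \<le> V" using V[of t n] r by simp
  qed
  have "variation x \<le> variation y - \<bar>p y - p x\<bar>"
    unfolding T(1)
  proof (rule cSUP_least)
    show "?P x \<noteq> {}"
      using xy by (auto intro!: exI[of _ "0::nat"] exI[of _ "\<lambda>_. 0"] simp: mono_on_def)
  next
    fix r assume "r \<in> ?P x"
    then obtain n t where r: "r = (n, t)" "t ` {..n} \<subseteq> {0..x}" "mono_on {..n} t" by blast
    define t' where "t' i = (if i \<le> n then t i else if i = Suc n then x else y)" for i
    have "t' ` {..Suc (Suc n)} \<subseteq> {0..y}"
      using r(2) xy by (auto simp: t'_def image_subset_iff intro: order_trans)
    moreover have "mono_on {..Suc (Suc n)} t'"
    proof (rule mono_onI)
      fix i j assume "i \<in> {..Suc (Suc n)}" "j \<in> {..Suc (Suc n)}" "i \<le> j"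
      then show "t' i \<le> t' j"
        using r(2) xy mono_onD[OF r(3), of i j]
        by (auto simp: t'_def image_subset_iff intro: order_trans)
    qed
    ultimately have "?S (Suc (Suc n), t') \<le> variation y"
      unfolding T(2) by (intro cSUP_upper bdd) auto
    moreover have "(\<Sum>i<n. \<bar>p (t' (Suc i)) - p (t' i)\<bar>) = ?S r"
      unfolding r(1) prod.case by (intro sum.cong) (auto simp: t'_def)
    ultimately show "?S r \<le> variation y - \<bar>p y - p x\<bar>"
      by (simp add: t'_def)
  qed
  then show ?thesis by simp
qed

text \<open>Monotone on the whole line because \<open>variation\<close> clamps its argument to
  \<open>{0..1}\<close>; Borel measurability of \<open>variation\<close> is later read off from
  this.\<close>

lemma mono_variation:
  assumes "bounded_variation_on 0 1 p"
  shows "mono variation"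
proof (rule monoI)
  fix x y :: real assume "x \<le> y"
  then have "variation (max 0 (min 1 x)) + \<bar>p (max 0 (min 1 y)) - p (max 0 (min 1 x))\<bar>
      \<le> variation (max 0 (min 1 y))"
    by (intro variation_bound[OF assms]) auto
  moreover have "variation (max 0 (min 1 z)) = variation z" for z
    by (auto simp: variation_def max_def min_def)
  ultimately show "variation x \<le> variation y" by simp
qed

text \<open>
  The increment of \<open>p\<close> along a rotation by \<open>a\<close> is dominated by the increment of its variation
  function, which integrates to zero by rotation invariance, plus the total variation on the
  points that cross \<open>0\<close>.
\<close>

lemma integral_translate_bound_small:
  assumes bv: "bounded_variation_on 0 1 p" and a: "0 \<le> a" "a \<le> 1"
  shows "(\<integral>x. \<bar>p (circle_rep x + a) - p (circle_rep x)\<bar> \<partial>circle_lebesgue)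
    \<le> (variation 1 - variation 0) * a"
proof -
  interpret cl: prob_space circle_lebesgue by (rule prob_space_circle_lebesgue)
  define \<tau> where "\<tau> x = variation (circle_rep x)" for x
  have [measurable]: "variation \<in> borel_measurable borel"
    using mono_variation[OF bv] by (rule borel_measurable_mono)
  have [measurable]: "\<tau> \<in> borel_measurable borel" unfolding \<tau>_def by measurable
  have \<tau>: "variation 0 \<le> \<tau> x" "\<tau> x \<le> variation 1" for x
    using circle_rep_bounds[of x] monoD[OF mono_variation[OF bv]] by (auto simp: \<tau>_def)
  have \<tau>_int: "integrable circle_lebesgue \<tau>"
    by (rule cl.integrable_const_bound[of _ "\<bar>variation 0\<bar> + \<bar>variation 1\<bar>"])
      (auto intro!: AE_I2 intro: \<tau> simp: abs_le_iff, (smt (verit) \<tau>)+)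
  \<comment> \<open>The arc of points that reach or cross 0 under the rotation, of measure
    \<open>a\<close>.\<close>
  let ?A = "{x. 1 - a \<le> circle_rep x}"
  have "emeasure circle_lebesgue ?A = (\<integral>\<^sup>+x. indicator ?A x \<partial>circle_lebesgue)"
    by (subst nn_integral_indicator) auto
  also have "\<dots> = (\<integral>\<^sup>+x\<in>{0..<1}. indicator ?A (to_circle x) \<partial>lborel)"
    by (rule nn_integral_circle_lebesgue) measurable
  also have "\<dots> = (\<integral>\<^sup>+x. indicator {1-a..<1} x \<partial>lborel)"
    using a by (intro nn_integral_cong) (auto simp: circle_rep_to_circle frac_eq split: split_indicator)
  also have "\<dots> = ennreal a" using a by simp
  finally have emeas: "emeasure circle_lebesgue ?A = ennreal a" .
  then have meas: "measure circle_lebesgue ?A = a" using a by (simp add: measure_def)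
  have "(\<integral>x. \<bar>p (circle_rep x + a) - p (circle_rep x)\<bar> \<partial>circle_lebesgue)
      \<le> (\<integral>x. \<tau> (circle_shift a x) - \<tau> x + (variation 1 - variation 0) * indicator ?A x \<partial>circle_lebesgue)"
  proof (rule integral_mono_AE)
    show "integrable circle_lebesgue (\<lambda>x. \<bar>p (circle_rep x + a) - p (circle_rep x)\<bar>)"
      using integrable_p[of "-a"] integrable_p[of 0] by simp
    show "integrable circle_lebesgue (\<lambda>x. \<tau> (circle_shift a x) - \<tau> x + (variation 1 - variation 0) * indicator ?A x)"
      using integrable_circle_shift[OF \<tau>_int, of a] \<tau>_int
      by (intro Bochner_Integration.integrable_add Bochner_Integration.integrable_diff integrable_mult_right
          integrable_real_indicator) (auto simp: emeas)
    have "\<bar>p (circle_rep x + a) - p (circle_rep x)\<bar>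
        \<le> \<tau> (circle_shift a x) - \<tau> x + (variation 1 - variation 0) * indicator ?A x" for x
    proof (cases "circle_rep x + a < 1")
      case True
      then have "circle_rep (circle_shift a x) = circle_rep x + a"
        using a circle_rep_bounds[of x] by (simp add: circle_shift_def circle_rep_to_circle frac_eq)
      then show ?thesis
        using True variation_bound[OF bv, of "circle_rep x" "circle_rep x + a"] a circle_rep_bounds[of x]
        by (simp add: \<tau>_def)
    next
      case False
      \<comment> \<open>The path from \<open>x\<close> to its image passes through 0, where
        \<open>p 1 = p 0\<close>, so the increment is split there: one piece is charged to
        \<open>variation ?y - variation 0\<close>, the other to
        \<open>variation 1 - variation (circle_rep x)\<close>, and the two add up to the claimed
        bound.\<close>
      let ?y = "circle_rep x + a - 1"
      have "?y = frac ?y" using False a circle_rep_bounds[of x] by (subst frac_eq[THEN iffD2]) auto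
      also have "\<dots> = frac (circle_rep x + a)" by (simp add: frac_def)
      finally have y: "circle_rep (circle_shift a x) = ?y"
        by (simp add: circle_shift_def circle_rep_to_circle)
      have "p ?y = p (circle_rep x + a)" using p_periodic[of ?y] by simp
      moreover have "p 1 = p 0" using p_periodic[of 0] by simp
      ultimately have "\<bar>p (circle_rep x + a) - p (circle_rep x)\<bar> \<le> \<bar>p ?y - p 0\<bar> + \<bar>p 1 - p (circle_rep x)\<bar>"
        by simp
      moreover have "variation 0 + \<bar>p ?y - p 0\<bar> \<le> variation ?y"
        using False a circle_rep_bounds[of x] by (intro variation_bound[OF bv]) auto
      moreover have "variation (circle_rep x) + \<bar>p 1 - p (circle_rep x)\<bar> \<le> variation 1"
        using circle_rep_bounds[of x] by (intro variation_bound[OF bv]) auto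
      ultimately show ?thesis using False y by (simp add: \<tau>_def)
    qed
    then show "AE x in circle_lebesgue. \<bar>p (circle_rep x + a) - p (circle_rep x)\<bar>
        \<le> \<tau> (circle_shift a x) - \<tau> x + (variation 1 - variation 0) * indicator ?A x" by simp
  qed
  also have "\<dots> = (variation 1 - variation 0) * a"
    using integrable_circle_shift[OF \<tau>_int, of a] \<tau>_int
    by (subst Bochner_Integration.integral_add)
      (auto simp: integral_circle_shift meas emeas intro!: integrable_real_indicator integrable_mult_right)
  finally show ?thesis .
qed

lemma noise_tv_bound:
  assumes bv: "bounded_variation_on 0 1 p"
  obtains V where "0 \<le> V"
    "\<And>\<phi> a b. \<phi> \<in> borel_measurable borel \<Longrightarrow> (\<And>x. \<bar>\<phi> x\<bar> \<le> 1) \<Longrightarrow>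
      \<bar>(\<integral>x. \<phi> x \<partial>noise a) - (\<integral>x. \<phi> x \<partial>noise b)\<bar> \<le> V * \<bar>a - b\<bar>"
proof
  \<comment> \<open>The summand 2 serves translations longer than 1, where the trivial bound 2
    replaces the variation estimate.\<close>
  define V where "V = variation 1 - variation 0 + 2"
  have var: "0 \<le> variation 1 - variation 0"
    using monoD[OF mono_variation[OF bv], of 0 1] by simp
  then show "0 \<le> V" by (simp add: V_def)
  have tr: "(\<integral>x. \<bar>p (circle_rep x + a) - p (circle_rep x)\<bar> \<partial>circle_lebesgue) \<le> V * a" if "0 \<le> a" for a
  proof (cases "a \<le> 1")
    case True
    then have "(variation 1 - variation 0) * a \<le> V * a"
      using that by (intro mult_right_mono) (auto simp: V_def)
    then show ?thesis using integral_translate_bound_small[OF bv that True] by simp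
  next
    case False
    have "(\<integral>x. \<bar>p (circle_rep x + a) - p (circle_rep x)\<bar> \<partial>circle_lebesgue)
        \<le> (\<integral>x. p (circle_rep x + a) + p (circle_rep x) \<partial>circle_lebesgue)"
    proof (rule integral_mono)
      show "\<bar>p (circle_rep x + a) - p (circle_rep x)\<bar> \<le> p (circle_rep x + a) + p (circle_rep x)" for x
        using p_nonneg[of "circle_rep x + a"] p_nonneg[of "circle_rep x"] by simp
    qed (use integrable_p[of "-a"] integrable_p[of 0] in auto)
    also have "\<dots> = 2"
      using integrable_p[of "-a"] integrable_p[of 0] integral_p[of "-a"] integral_p[of 0] by simp
    also have "\<dots> \<le> V * 1" using var by (simp add: V_def)
    also have "\<dots> \<le> V * a" using False \<open>0 \<le> V\<close> by (intro mult_left_mono) auto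
    finally show ?thesis .
  qed
  fix \<phi> :: "circle \<Rightarrow> real" and a b
  assume [measurable]: "\<phi> \<in> borel_measurable borel" and \<phi>: "\<And>x. \<bar>\<phi> x\<bar> \<le> 1"
  have int: "integrable circle_lebesgue (\<lambda>x. p (circle_rep x - a) * \<phi> x)" for a
    by (rule Bochner_Integration.integrable_bound[OF integrable_p[of a]])
      (auto simp: abs_mult p_nonneg \<phi> intro!: mult_left_le)
  have gen: "\<bar>(\<integral>x. \<phi> x \<partial>noise a) - (\<integral>x. \<phi> x \<partial>noise b)\<bar> \<le> V * (a - b)" if "b \<le> a" for a b
  proof -
    have "\<bar>(\<integral>x. \<phi> x \<partial>noise a) - (\<integral>x. \<phi> x \<partial>noise b)\<bar>
        = \<bar>\<integral>x. p (circle_rep x - a) * \<phi> x - p (circle_rep x - b) * \<phi> x \<partial>circle_lebesgue\<bar>"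
      using int by (simp add: integral_noise_density)
    also have "\<dots> \<le> (\<integral>x. \<bar>p (circle_rep x - a) * \<phi> x - p (circle_rep x - b) * \<phi> x\<bar> \<partial>circle_lebesgue)"
      by (rule integral_abs_bound)
    also have "\<dots> \<le> (\<integral>x. \<bar>p (circle_rep x - a) - p (circle_rep x - b)\<bar> \<partial>circle_lebesgue)"
    proof (rule integral_mono)
      fix x
      show "\<bar>p (circle_rep x - a) * \<phi> x - p (circle_rep x - b) * \<phi> x\<bar> \<le> \<bar>p (circle_rep x - a) - p (circle_rep x - b)\<bar>"
        unfolding left_diff_distrib[symmetric] abs_mult using \<phi>[of x] by (intro mult_left_le) auto
    qed (use int integrable_p in \<open>auto intro!: integrable_abs Bochner_Integration.integrable_diff\<close>)
    also have "\<dots> = (\<integral>x. \<bar>p (circle_rep (circle_shift a x) - a) - p (circle_rep (circle_shift a x) - b)\<bar> \<partial>circle_lebesgue)"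
      by (rule integral_circle_shift[symmetric]) measurable
    also have "\<dots> = (\<integral>x. \<bar>p (circle_rep x + (a - b)) - p (circle_rep x)\<bar> \<partial>circle_lebesgue)"
      by (simp add: p_circle_shift abs_minus_commute algebra_simps)
    also have "\<dots> \<le> V * (a - b)" using that by (intro tr) simp
    finally show ?thesis .
  qed
  show "\<bar>(\<integral>x. \<phi> x \<partial>noise a) - (\<integral>x. \<phi> x \<partial>noise b)\<bar> \<le> V * \<bar>a - b\<bar>"
    using gen[of a b] gen[of b a] by (cases "b \<le> a") (auto simp: abs_minus_commute)
qed

end

section \<open>Transfer operators\<close>

text \<open>Compared on boxes, where density and indicator both factorize over the
  coordinates.\<close>

lemma PiM_density:
  fixes M :: "'i \<Rightarrow> 'a measure" and f :: "'i \<Rightarrow> 'a \<Rightarrow> ennreal"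
  assumes I: "finite I"
    and M: "\<And>i. sigma_finite_measure (M i)" "\<And>i. sigma_finite_measure (density (M i) (f i))"
    and f [measurable]: "\<And>i. f i \<in> borel_measurable (M i)"
  shows "PiM I (\<lambda>i. density (M i) (f i)) = density (PiM I M) (\<lambda>x. \<Prod>i\<in>I. f i (x i))"
proof -
  interpret D: product_sigma_finite "\<lambda>i. density (M i) (f i)"
    using M(2) by (simp add: product_sigma_finite_def)
  interpret M: product_sigma_finite M
    using M(1) by (simp add: product_sigma_finite_def)
  have "density (PiM I M) (\<lambda>x. \<Prod>i\<in>I. f i (x i)) = PiM I (\<lambda>i. density (M i) (f i))"
  proof (rule D.PiM_eqI[OF I])
    show "sets (density (PiM I M) (\<lambda>x. \<Prod>i\<in>I. f i (x i))) = sets (PiM I (\<lambda>i. density (M i) (f i)))"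
      by (simp cong: sets_PiM_cong)
  next
    fix A assume "\<And>i. i \<in> I \<Longrightarrow> A i \<in> sets (density (M i) (f i))"
    then have A [measurable]: "\<And>i. i \<in> I \<Longrightarrow> A i \<in> sets (M i)" by simp
    have "emeasure (density (PiM I M) (\<lambda>x. \<Prod>i\<in>I. f i (x i))) (Pi\<^sub>E I A)
        = (\<integral>\<^sup>+x. (\<Prod>i\<in>I. f i (x i)) * indicator (Pi\<^sub>E I A) x \<partial>PiM I M)"
      using I by (intro emeasure_density sets_PiM_I_finite) auto
    also have "\<dots> = (\<integral>\<^sup>+x. (\<Prod>i\<in>I. f i (x i) * indicator (A i) (x i)) \<partial>PiM I M)"
    proof (rule nn_integral_cong)
      fix x assume "x \<in> space (PiM I M)"
      then have "indicator (Pi\<^sub>E I A) x = (\<Prod>i\<in>I. indicator (A i) (x i) :: ennreal)"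
        using I by (auto simp: space_PiM PiE_def Pi_def indicator_def prod_zero_iff split: if_splits)
      then show "(\<Prod>i\<in>I. f i (x i)) * indicator (Pi\<^sub>E I A) x = (\<Prod>i\<in>I. f i (x i) * indicator (A i) (x i))"
        by (simp add: prod.distrib)
    qed
    also have "\<dots> = (\<Prod>i\<in>I. \<integral>\<^sup>+x. f i x * indicator (A i) x \<partial>M i)"
      using I by (intro M.product_nn_integral_prod) auto
    also have "\<dots> = (\<Prod>i\<in>I. emeasure (density (M i) (f i)) (A i))"
      by (intro prod.cong refl) (simp add: emeasure_density)
    finally show "emeasure (density (PiM I M) (\<lambda>x. \<Prod>i\<in>I. f i (x i))) (Pi\<^sub>E I A)
        = (\<Prod>i\<in>I. emeasure (density (M i) (f i)) (A i))" .
  qed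
  then show ?thesis ..
qed

text \<open>Fubini with coordinate \<open>i\<close> innermost. The two integrability statements
  allow such integrals to be subtracted for two choices of the \<open>i\<close>-th factor.\<close>

lemma (in product_prob_space) integral_PiM_insert:
  fixes G :: "_ \<Rightarrow> real"
  assumes I: "finite I" "i \<in> I" and G: "G \<in> borel_measurable (PiM I M)"
    and B: "\<And>x. x \<in> space (PiM I M) \<Longrightarrow> \<bar>G x\<bar> \<le> B"
  shows "(\<integral>x. G x \<partial>PiM I M) = (\<integral>x. (\<integral>s. G (x(i := s)) \<partial>M i) \<partial>PiM (I - {i}) M)"
    and "x \<in> space (PiM (I - {i}) M) \<Longrightarrow> integrable (M i) (\<lambda>s. G (x(i := s)))"
    and "integrable (PiM (I - {i}) M) (\<lambda>x. \<integral>s. G (x(i := s)) \<partial>M i)"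
proof -
  have ins: "insert i (I - {i}) = I" using I by auto
  interpret P: prob_space "PiM I M" by (rule prob_space_PiM) (rule prob_space)
  interpret P': prob_space "PiM (I - {i}) M" by (rule prob_space_PiM) (rule prob_space)
  have upd: "(\<lambda>(x, s). x(i := s)) \<in> measurable (PiM (I - {i}) M \<Otimes>\<^sub>M M i) (PiM I M)"
    using measurable_add_dim[of i "I - {i}" M] unfolding ins by simp
  have [measurable]: "(\<lambda>(x, s). G (x(i := s))) \<in> borel_measurable (PiM (I - {i}) M \<Otimes>\<^sub>M M i)"
    using measurable_compose[OF upd G] by (simp add: split_beta')
  have sp: "x(i := s) \<in> space (PiM I M)" if "x \<in> space (PiM (I - {i}) M)" "s \<in> space (M i)" for x s
    using measurable_space[OF upd, of "(x, s)"] that by (simp add: space_pair_measure)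
  have "integrable (PiM I M) G"
    using G B by (intro P.integrable_const_bound[of _ B]) auto
  then show "(\<integral>x. G x \<partial>PiM I M) = (\<integral>x. (\<integral>s. G (x(i := s)) \<partial>M i) \<partial>PiM (I - {i}) M)"
    using product_integral_insert[of "I - {i}" i G] I ins by simp
  show int: "integrable (M i) (\<lambda>s. G (x(i := s)))" if x: "x \<in> space (PiM (I - {i}) M)" for x
  proof (rule M.integrable_const_bound[where B = B])
    show "(\<lambda>s. G (x(i := s))) \<in> borel_measurable (M i)"
      using measurable_compose[OF measurable_Pair1' [OF x] \<open>(\<lambda>(x, s). G (x(i := s))) \<in> _\<close>] by simp
  qed (use B sp x in auto)
  show "integrable (PiM (I - {i}) M) (\<lambda>x. \<integral>s. G (x(i := s)) \<partial>M i)"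
  proof (rule P'.integrable_const_bound[of _ B])
    have "norm (\<integral>s. G (x(i := s)) \<partial>M i) \<le> B" if x: "x \<in> space (PiM (I - {i}) M)" for x
    proof -
      have "norm (\<integral>s. G (x(i := s)) \<partial>M i) \<le> (\<integral>s. norm (G (x(i := s))) \<partial>M i)"
        by (rule integral_norm_bound)
      also have "\<dots> \<le> (\<integral>s. B \<partial>M i)"
        using int[OF x] B sp x by (intro integral_mono) auto
      finally show ?thesis by (simp add: M.prob_space)
    qed
    then show "AE x in PiM (I - {i}) M. norm (\<integral>s. G (x(i := s)) \<partial>M i) \<le> B" by auto
  qed measurable
qed

section \<open>Product noise and transfer operators with a general drift\<close>

context circle_noise
begin

definition noise_prod :: "nat \<Rightarrow> (nat \<Rightarrow> real) \<Rightarrow> (nat \<Rightarrow> circle) measure"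
  where "noise_prod N a = PiM {1..N} (\<lambda>j. noise (a j))"

lemma sets_noise_prod [measurable_cong, simp]: "sets (noise_prod N a) = sets (torus N)"
  unfolding noise_prod_def by (rule sets_PiM_cong) simp_all

lemma space_noise_prod [simp]: "space (noise_prod N a) = space (torus N)"
  by (rule sets_eq_imp_space_eq) simp

lemma prob_space_noise_prod: "prob_space (noise_prod N a)"
  unfolding noise_prod_def by (rule prob_space_PiM) (rule prob_space_noise)

abbreviation torus_lebesgue :: "nat \<Rightarrow> (nat \<Rightarrow> circle) measure"
  where "torus_lebesgue N \<equiv> PiM {1..N} (\<lambda>_. circle_lebesgue)"

lemma sets_torus_lebesgue [simp]: "sets (torus_lebesgue N) = sets (torus N)"
  by (rule sets_PiM_cong) simp_all

lemma noise_prod_density: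
  "noise_prod N a = density (torus_lebesgue N)
    (\<lambda>x. ennreal (\<Prod>j\<in>{1..N}. p (circle_rep (x j) - a j)))"
  unfolding noise_prod_def noise_def
  by (subst PiM_density)
    (auto simp: prod_ennreal p_nonneg noise_def[symmetric]
      intro!: prob_space_imp_sigma_finite prob_space_circle_lebesgue prob_space_noise)

text \<open>\<open>C j\<close> measures how strongly the mean of \<open>G\<close> reacts to moving
  the centre of the noise in coordinate \<open>j\<close>. Estimates stated for this property cover
  Lipschitz functions and, when \<open>p\<close> has bounded variation, merely bounded ones.\<close>

definition shift_bound :: "nat \<Rightarrow> ((nat \<Rightarrow> circle) \<Rightarrow> real) \<Rightarrow> (nat \<Rightarrow> real) \<Rightarrow> bool"
  where "shift_bound N G C \<longleftrightarrow> G \<in> borel_measurable (torus N) \<and>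
    (\<exists>B. \<forall>x\<in>space (torus N). \<bar>G x\<bar> \<le> B) \<and>
    (\<forall>j\<in>{1..N}. 0 \<le> C j) \<and>
    (\<forall>j\<in>{1..N}. \<forall>x\<in>space (torus N). \<forall>a b.
      \<bar>(\<integral>s. G (x(j := s)) \<partial>noise a) - (\<integral>s. G (x(j := s)) \<partial>noise b)\<bar> \<le> C j * \<bar>a - b\<bar>)"

lemma noise_prod_update:
  assumes G: "shift_bound N G C" and j: "j \<in> {1..N}"
  shows "\<bar>(\<integral>x. G x \<partial>noise_prod N a) - (\<integral>x. G x \<partial>noise_prod N (a(j := t)))\<bar> \<le> C j * \<bar>a j - t\<bar>"
proof -
  obtain B where B: "\<And>x. x \<in> space (torus N) \<Longrightarrow> \<bar>G x\<bar> \<le> B"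
    and G_meas: "G \<in> borel_measurable (torus N)" using G unfolding shift_bound_def by blast
  have pr: "product_prob_space (\<lambda>j. noise (a j))" for a :: "nat \<Rightarrow> real"
    by (intro product_prob_spaceI prob_space_noise)
  have G_meas': "G \<in> borel_measurable (PiM {1..N} (\<lambda>j. noise (a j)))" for a :: "nat \<Rightarrow> real"
    using G_meas by (simp cong: measurable_cong_sets add: noise_prod_def[symmetric])
  have B': "\<bar>G x\<bar> \<le> B" if "x \<in> space (PiM {1..N} (\<lambda>j. noise (a j)))" for a :: "nat \<Rightarrow> real" and x
    using B that by (simp add: noise_prod_def[symmetric])
  \<comment> \<open>The two products have the same factors away from \<open>j\<close>, so the
    comparison takes place under one common law \<open>R\<close> of the other coordinates.\<close>
  define R where "R = PiM ({1..N} - {j}) (\<lambda>i. noise (a i))"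
  interpret R: prob_space R unfolding R_def by (rule prob_space_PiM) (rule prob_space_noise)
  have R': "PiM ({1..N} - {j}) (\<lambda>i. noise ((a(j := t)) i)) = R"
    unfolding R_def by (rule PiM_cong) auto
  note int1 = product_prob_space.integral_PiM_insert[OF pr _ j G_meas' B', of a, folded R_def]
  note int2 = product_prob_space.integral_PiM_insert[OF pr _ j G_meas' B', of "a(j := t)", unfolded R']
  have "\<bar>(\<integral>x. G x \<partial>noise_prod N a) - (\<integral>x. G x \<partial>noise_prod N (a(j := t)))\<bar>
      = \<bar>\<integral>x. (\<integral>s. G (x(j := s)) \<partial>noise (a j)) - (\<integral>s. G (x(j := s)) \<partial>noise t) \<partial>R\<bar>"
    using int1(1,3) int2(1,3) by (simp add: noise_prod_def)
  also have "\<dots> \<le> (\<integral>x. \<bar>(\<integral>s. G (x(j := s)) \<partial>noise (a j)) - (\<integral>s. G (x(j := s)) \<partial>noise t)\<bar> \<partial>R)"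
    by (rule integral_abs_bound)
  also have "\<dots> \<le> (\<integral>x. C j * \<bar>a j - t\<bar> \<partial>R)"
  proof (rule integral_mono)
    show "integrable R (\<lambda>x. \<bar>(\<integral>s. G (x(j := s)) \<partial>noise (a j)) - (\<integral>s. G (x(j := s)) \<partial>noise t)\<bar>)"
      using int1(3) int2(3) by simp
    fix x assume "x \<in> space R"
    \<comment> \<open>\<open>shift_bound\<close> speaks of points of the full torus; how the missing
      coordinate is filled does not matter, as it is overwritten at once.\<close>
    then have "x(j := undefined) \<in> space (torus N)"
      using j by (auto simp: R_def space_PiM PiE_def extensional_def)
    then have "\<bar>(\<integral>s. G ((x(j := undefined))(j := s)) \<partial>noise (a j)) - (\<integral>s. G ((x(j := undefined))(j := s)) \<partial>noise t)\<bar>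
        \<le> C j * \<bar>a j - t\<bar>"
      using G j unfolding shift_bound_def by blast
    then show "\<bar>(\<integral>s. G (x(j := s)) \<partial>noise (a j)) - (\<integral>s. G (x(j := s)) \<partial>noise t)\<bar> \<le> C j * \<bar>a j - t\<bar>"
      by simp
  qed simp
  finally show ?thesis by (simp add: R.prob_space)
qed

text \<open>The centres are replaced one at a time, and each replacement costs its own term of the
  sum.\<close>

lemma noise_prod_lipschitz:
  assumes G: "shift_bound N G C"
  shows "\<bar>(\<integral>x. G x \<partial>noise_prod N a) - (\<integral>x. G x \<partial>noise_prod N b)\<bar> \<le> (\<Sum>j\<in>{1..N}. C j * \<bar>a j - b j\<bar>)"
proof -
  have "\<bar>(\<integral>x. G x \<partial>noise_prod N a) - (\<integral>x. G x \<partial>noise_prod N (\<lambda>j. if j \<in> J then b j else a j))\<bar>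
      \<le> (\<Sum>j\<in>J. C j * \<bar>a j - b j\<bar>)" if "finite J" "J \<subseteq> {1..N}" for J
    using that
  proof (induction J rule: finite_induct)
    case (insert j J)
    let ?a = "\<lambda>j. if j \<in> J then b j else a j"
    have "(\<lambda>i. if i \<in> insert j J then b i else a i) = ?a(j := b j)" by auto
    moreover have "\<bar>(\<integral>x. G x \<partial>noise_prod N ?a) - (\<integral>x. G x \<partial>noise_prod N (?a(j := b j)))\<bar> \<le> C j * \<bar>?a j - b j\<bar>"
      using insert.prems by (intro noise_prod_update[OF G]) auto
    ultimately show ?case using insert by simp
  qed simp
  from this[of "{1..N}"] have
    "\<bar>(\<integral>x. G x \<partial>noise_prod N a) - (\<integral>x. G x \<partial>noise_prod N (\<lambda>j. if j \<in> {1..N} then b j else a j))\<bar>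
      \<le> (\<Sum>j\<in>{1..N}. C j * \<bar>a j - b j\<bar>)" by blast
  moreover have "noise_prod N (\<lambda>j. if j \<in> {1..N} then b j else a j) = noise_prod N b"
    unfolding noise_prod_def by (rule PiM_cong) auto
  ultimately show ?thesis by simp
qed

text \<open>The drift \<open>F\<close> is left free, because the particle operator and the power of
  the self-consistent operator are the same construction with two different drifts.\<close>

definition transfer :: "nat \<Rightarrow> (nat \<Rightarrow> (nat \<Rightarrow> circle) \<Rightarrow> real) \<Rightarrow> (nat \<Rightarrow> circle) measure \<Rightarrow> (nat \<Rightarrow> circle) measure"
  where "transfer N F \<mu> = density (torus_lebesgue N)
    (\<lambda>x. \<integral>\<^sup>+u. ennreal (\<Prod>j\<in>{1..N}. p (circle_rep (x j) - F j u)) \<partial>\<mu>)"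

lemma sets_transfer [measurable_cong, simp]: "sets (transfer N F \<mu>) = sets (torus N)"
  by (simp add: transfer_def)

lemma space_transfer [simp]: "space (transfer N F \<mu>) = space (torus N)"
  by (rule sets_eq_imp_space_eq) simp

lemma noise_kernel_measurable:
  assumes [measurable_cong]: "sets \<mu> = sets (torus N)"
    and F [measurable]: "\<And>j. j \<in> {1..N} \<Longrightarrow> F j \<in> borel_measurable (torus N)"
  shows "(\<lambda>(x, u). \<Prod>j\<in>{1..N}. p (circle_rep (x j) - F j u)) \<in> borel_measurable (torus_lebesgue N \<Otimes>\<^sub>M \<mu>)"
proof -
  have "(\<lambda>xu. F j (snd xu)) \<in> borel_measurable (torus_lebesgue N \<Otimes>\<^sub>M \<mu>)" if "j \<in> {1..N}" for j
    using that by measurable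
  moreover have "(\<lambda>xu. fst xu j) \<in> measurable (torus_lebesgue N \<Otimes>\<^sub>M \<mu>) borel" if "j \<in> {1..N}" for j
    using that by measurable
  ultimately show ?thesis
    unfolding split_beta' by (intro borel_measurable_prod) measurable
qed

text \<open>Tonelli: one step draws \<open>u\<close> from \<open>\<mu>\<close> and then the new
  point from the product noise centred at the drifts \<open>F j u\<close>.\<close>

lemma nn_integral_transfer:
  assumes \<mu>: "prob_space \<mu>" and sets_\<mu> [measurable_cong]: "sets \<mu> = sets (torus N)"
    and F: "\<And>j. j \<in> {1..N} \<Longrightarrow> F j \<in> borel_measurable (torus N)"
    and G: "G \<in> borel_measurable (torus N)"
  shows "(\<integral>\<^sup>+x. G x \<partial>transfer N F \<mu>) = (\<integral>\<^sup>+u. (\<integral>\<^sup>+x. G x \<partial>noise_prod N (\<lambda>j. F j u)) \<partial>\<mu>)"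
    and "(\<lambda>u. \<integral>\<^sup>+x. G x \<partial>noise_prod N (\<lambda>j. F j u)) \<in> borel_measurable \<mu>"
proof -
  let ?L = "torus_lebesgue N"
  interpret \<mu>: prob_space \<mu> by fact
  interpret L: prob_space ?L by (rule prob_space_PiM) (rule prob_space_circle_lebesgue)
  interpret pair_sigma_finite ?L \<mu> ..
  define k where "k x u = (\<Prod>j\<in>{1..N}. p (circle_rep (x j) - F j u))" for x u
  have k [measurable]: "(\<lambda>(x, u). k x u) \<in> borel_measurable (?L \<Otimes>\<^sub>M \<mu>)"
    unfolding k_def by (rule noise_kernel_measurable[OF sets_\<mu> F])
  have [measurable]: "G \<in> borel_measurable ?L"
    using G by (simp cong: measurable_cong_sets)
  have *: "(\<integral>\<^sup>+x. G x \<partial>noise_prod N (\<lambda>j. F j u)) = (\<integral>\<^sup>+x. ennreal (k x u) * G x \<partial>?L)" if "u \<in> space \<mu>" for u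
  proof -
    have "(\<lambda>x. k x u) \<in> borel_measurable ?L" using that by measurable
    then show ?thesis
      unfolding noise_prod_density k_def[symmetric] by (subst nn_integral_density) auto
  qed
  have "(\<integral>\<^sup>+x. G x \<partial>transfer N F \<mu>) = (\<integral>\<^sup>+x. (\<integral>\<^sup>+u. ennreal (k x u) \<partial>\<mu>) * G x \<partial>?L)"
    unfolding transfer_def k_def[symmetric] by (subst nn_integral_density) auto
  also have "\<dots> = (\<integral>\<^sup>+x. (\<integral>\<^sup>+u. ennreal (k x u) * G x \<partial>\<mu>) \<partial>?L)"
  proof (rule nn_integral_cong)
    fix x assume "x \<in> space ?L"
    then show "(\<integral>\<^sup>+u. ennreal (k x u) \<partial>\<mu>) * G x = (\<integral>\<^sup>+u. ennreal (k x u) * G x \<partial>\<mu>)"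
      by (subst nn_integral_multc) auto
  qed
  also have "\<dots> = (\<integral>\<^sup>+u. (\<integral>\<^sup>+x. ennreal (k x u) * G x \<partial>?L) \<partial>\<mu>)"
    by (subst Fubini') auto
  also have "\<dots> = (\<integral>\<^sup>+u. (\<integral>\<^sup>+x. G x \<partial>noise_prod N (\<lambda>j. F j u)) \<partial>\<mu>)"
    by (intro nn_integral_cong) (simp add: *)
  finally show "(\<integral>\<^sup>+x. G x \<partial>transfer N F \<mu>) = (\<integral>\<^sup>+u. (\<integral>\<^sup>+x. G x \<partial>noise_prod N (\<lambda>j. F j u)) \<partial>\<mu>)" .
  have "(\<lambda>u. \<integral>\<^sup>+x. ennreal (k x u) * G x \<partial>?L) \<in> borel_measurable \<mu>" by measurable
  then show "(\<lambda>u. \<integral>\<^sup>+x. G x \<partial>noise_prod N (\<lambda>j. F j u)) \<in> borel_measurable \<mu>"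
    by (simp cong: measurable_cong add: *)
qed

lemma prob_space_transfer:
  assumes "prob_space \<mu>" "sets \<mu> = sets (torus N)"
    and "\<And>j. j \<in> {1..N} \<Longrightarrow> F j \<in> borel_measurable (torus N)"
  shows "prob_space (transfer N F \<mu>)"
proof (rule prob_spaceI)
  have "emeasure (transfer N F \<mu>) (space (transfer N F \<mu>)) = (\<integral>\<^sup>+x. 1 \<partial>transfer N F \<mu>)"
    by simp
  also have "\<dots> = (\<integral>\<^sup>+u. (\<integral>\<^sup>+x. 1 \<partial>noise_prod N (\<lambda>j. F j u)) \<partial>\<mu>)"
    by (rule nn_integral_transfer[OF assms]) simp_all
  also have "\<dots> = 1"
    using prob_space.emeasure_space_1[OF prob_space_noise_prod] prob_space.emeasure_space_1[OF assms(1)]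
    by (simp del: space_noise_prod)
  finally show "emeasure (transfer N F \<mu>) (space (transfer N F \<mu>)) = 1" .
qed

text \<open>\<open>G + B\<close> is nonnegative, so the Tonelli version applies to it; the constant
  \<open>B\<close> then drops out on both sides because all measures involved are
  probabilities.\<close>

lemma integral_transfer:
  fixes G :: "(nat \<Rightarrow> circle) \<Rightarrow> real"
  assumes \<mu>: "prob_space \<mu>" and sets_\<mu>: "sets \<mu> = sets (torus N)"
    and F: "\<And>j. j \<in> {1..N} \<Longrightarrow> F j \<in> borel_measurable (torus N)"
    and G [measurable]: "G \<in> borel_measurable (torus N)"
    and B: "\<And>x. x \<in> space (torus N) \<Longrightarrow> \<bar>G x\<bar> \<le> B"
  shows "(\<integral>x. G x \<partial>transfer N F \<mu>) = (\<integral>u. (\<integral>x. G x \<partial>noise_prod N (\<lambda>j. F j u)) \<partial>\<mu>)"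
    and "(\<lambda>u. \<integral>x. G x \<partial>noise_prod N (\<lambda>j. F j u)) \<in> borel_measurable \<mu>"
proof -
  interpret \<mu>: prob_space \<mu> by fact
  interpret T: prob_space "transfer N F \<mu>" by (rule prob_space_transfer[OF \<mu> sets_\<mu> F])
  have B0: "0 \<le> G x + B" if "x \<in> space (torus N)" for x using B[OF that] by simp
  have B1: "\<bar>G x + B\<bar> \<le> 2 * B" if "x \<in> space (torus N)" for x using B[OF that] by simp
  note nn = nn_integral_transfer[where F = F and G = "\<lambda>x. ennreal (G x + B)", OF \<mu> sets_\<mu> F]
  have int: "integrable P G" if "prob_space P" "sets P = sets (torus N)" for P
  proof -
    interpret P: prob_space P by fact
    have "space P = space (torus N)" using that(2) by (rule sets_eq_imp_space_eq)
    then show ?thesis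
      using that(2) B by (intro P.integrable_const_bound[of _ B]) (auto cong: measurable_cong_sets)
  qed
  have const: "integrable P (\<lambda>x. B)" if "prob_space P" for P :: "(nat \<Rightarrow> circle) measure"
    using that by (intro finite_measure.integrable_const prob_space.finite_measure)
  have add: "(\<integral>x. G x + B \<partial>P) = (\<integral>x. G x \<partial>P) + B" if "prob_space P" "sets P = sets (torus N)" for P
    using int[OF that] const[OF that(1)] prob_space.prob_space[OF that(1)] by simp
  have nn_eq: "(\<integral>\<^sup>+x. ennreal (G x + B) \<partial>P) = ennreal ((\<integral>x. G x \<partial>P) + B)"
    if "prob_space P" "sets P = sets (torus N)" for P
  proof -
    have "space P = space (torus N)" using that(2) by (rule sets_eq_imp_space_eq)
    then have "(\<integral>\<^sup>+x. ennreal (G x + B) \<partial>P) = ennreal (\<integral>x. G x + B \<partial>P)"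
      using int[OF that] const[OF that(1)] B0
      by (intro nn_integral_eq_integral) auto
    then show ?thesis by (simp only: add[OF that])
  qed
  define \<Psi> where "\<Psi> u = (\<integral>x. G x \<partial>noise_prod N (\<lambda>j. F j u))" for u
  have nn\<Psi>: "(\<integral>\<^sup>+x. ennreal (G x + B) \<partial>noise_prod N (\<lambda>j. F j u)) = ennreal (\<Psi> u + B)" for u
    unfolding \<Psi>_def by (rule nn_eq) (simp_all add: prob_space_noise_prod)
  have \<Psi>_bd: "\<bar>\<Psi> u\<bar> \<le> B" for u
  proof -
    interpret Q: prob_space "noise_prod N (\<lambda>j. F j u)" by (rule prob_space_noise_prod)
    have "\<bar>\<Psi> u\<bar> \<le> (\<integral>x. \<bar>G x\<bar> \<partial>noise_prod N (\<lambda>j. F j u))"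
      unfolding \<Psi>_def by (rule integral_abs_bound)
    also have "\<dots> \<le> (\<integral>x. B \<partial>noise_prod N (\<lambda>j. F j u))"
      using int[OF prob_space_noise_prod sets_noise_prod] B by (intro integral_mono) auto
    finally show ?thesis using Q.prob_space by simp
  qed
  \<comment> \<open>The Tonelli version gives measurability in the extended nonnegative reals; since
    \<open>\<Psi> u + B\<close> is nonnegative, nothing is lost in passing back.\<close>
  have "(\<lambda>u. enn2real (ennreal (\<Psi> u + B)) - B) \<in> borel_measurable \<mu>"
    using nn(2) unfolding nn\<Psi> by simp
  moreover have "enn2real (ennreal (\<Psi> u + B)) - B = \<Psi> u" for u
    using \<Psi>_bd[of u] by simp
  ultimately show meas: "(\<lambda>u. \<integral>x. G x \<partial>noise_prod N (\<lambda>j. F j u)) \<in> borel_measurable \<mu>"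
    by (simp add: \<Psi>_def)
  then have "\<Psi> \<in> borel_measurable \<mu>" by (simp add: \<Psi>_def[abs_def])
  then have \<Psi>_int: "integrable \<mu> \<Psi>"
    using \<Psi>_bd by (intro \<mu>.integrable_const_bound[of _ B]) auto
  have pos: "0 \<le> \<Psi> u + B" for u using \<Psi>_bd[of u] by simp
  have "ennreal ((\<integral>x. G x \<partial>transfer N F \<mu>) + B) = (\<integral>\<^sup>+x. ennreal (G x + B) \<partial>transfer N F \<mu>)"
    by (rule nn_eq[symmetric]) (simp_all add: T.prob_space_axioms)
  also have "\<dots> = (\<integral>\<^sup>+u. ennreal (\<Psi> u + B) \<partial>\<mu>)"
    using nn(1) by (simp add: nn\<Psi>)
  also have "\<dots> = ennreal (\<integral>u. \<Psi> u + B \<partial>\<mu>)"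
    using \<Psi>_int pos by (intro nn_integral_eq_integral) auto
  also have "(\<integral>u. \<Psi> u + B \<partial>\<mu>) = (\<integral>u. \<Psi> u \<partial>\<mu>) + B"
    using \<Psi>_int by (simp add: \<mu>.prob_space)
  finally have "ennreal ((\<integral>x. G x \<partial>transfer N F \<mu>) + B) = ennreal ((\<integral>u. \<Psi> u \<partial>\<mu>) + B)" .
  moreover have "0 \<le> (\<integral>u. \<Psi> u \<partial>\<mu>) + B"
  proof -
    have "0 \<le> (\<integral>u. \<Psi> u + B \<partial>\<mu>)" using pos by (intro integral_nonneg_AE) auto
    then show ?thesis using \<Psi>_int by (simp add: \<mu>.prob_space)
  qed
  moreover have "0 \<le> (\<integral>x. G x \<partial>transfer N F \<mu>) + B"
  proof -
    have "0 \<le> (\<integral>x. G x + B \<partial>transfer N F \<mu>)" using B0 by (intro integral_nonneg_AE) auto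
    then show ?thesis by (simp add: add T.prob_space_axioms)
  qed
  ultimately show "(\<integral>x. G x \<partial>transfer N F \<mu>) = (\<integral>u. (\<integral>x. G x \<partial>noise_prod N (\<lambda>j. F j u)) \<partial>\<mu>)"
    by (simp add: \<Psi>_def[symmetric])
qed

end

section \<open>Lipschitz functions on the torus\<close>

text \<open>\<open>L i\<close> is any real majorant of the \<open>i\<close>-th Lipschitz constant,
  so that constants are estimated rather than computed.\<close>

definition coord_lipschitz :: "nat \<Rightarrow> ((nat \<Rightarrow> circle) \<Rightarrow> real) \<Rightarrow> (nat \<Rightarrow> real) \<Rightarrow> bool"
  where "coord_lipschitz N g L \<longleftrightarrow> (\<forall>i\<in>{1..N}. 0 \<le> L i \<and>
    (\<forall>x\<in>space (torus N). \<forall>s. \<bar>g x - g (x(i := s))\<bar> \<le> L i * dist (x i) s))"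

lemma coord_lipschitzD:
  assumes "coord_lipschitz N g L" "i \<in> {1..N}"
  shows "0 \<le> L i" "x \<in> space (torus N) \<Longrightarrow> \<bar>g x - g (x(i := s))\<bar> \<le> L i * dist (x i) s"
  using assms by (auto simp: coord_lipschitz_def)

text \<open>Telescoping: \<open>x\<close> is turned into \<open>y\<close> one coordinate at a time,
  through points that stay in the torus.\<close>

lemma coord_lipschitz_dist:
  assumes g: "coord_lipschitz N g L" and x: "x \<in> space (torus N)" and y: "y \<in> space (torus N)"
  shows "\<bar>g x - g y\<bar> \<le> (\<Sum>i\<in>{1..N}. L i * dist (x i) (y i))"
proof -
  have "\<bar>g x - g (\<lambda>i. if i \<in> J then y i else x i)\<bar> \<le> (\<Sum>i\<in>J. L i * dist (x i) (y i))"
    if "finite J" "J \<subseteq> {1..N}" for J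
    using that
  proof (induction J rule: finite_induct)
    case (insert j J)
    let ?x = "\<lambda>i. if i \<in> J then y i else x i"
    have "(\<lambda>i. if i \<in> insert j J then y i else x i) = ?x(j := y j)" by auto
    moreover have "?x \<in> space (torus N)"
      using x y by (auto simp: space_PiM PiE_def extensional_def)
    then have "\<bar>g ?x - g (?x(j := y j))\<bar> \<le> L j * dist (?x j) (y j)"
      using insert.prems by (intro coord_lipschitzD[OF g]) auto
    ultimately show ?case using insert by simp
  qed simp
  from this[of "{1..N}"] have
    "\<bar>g x - g (\<lambda>i. if i \<in> {1..N} then y i else x i)\<bar> \<le> (\<Sum>i\<in>{1..N}. L i * dist (x i) (y i))" by blast
  moreover have "(\<lambda>i. if i \<in> {1..N} then y i else x i) = y"
    using x y by (auto simp: space_PiM PiE_def extensional_def fun_eq_iff)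
  ultimately show ?thesis by simp
qed

lemma coord_lipschitz_bounded:
  assumes g: "coord_lipschitz N g L"
  obtains B where "\<And>x. x \<in> space (torus N) \<Longrightarrow> \<bar>g x\<bar> \<le> B"
proof
  fix x assume x: "x \<in> space (torus N)"
  define o' :: "nat \<Rightarrow> circle" where "o' = (\<lambda>i\<in>{1..N}. undefined)"
  have "\<bar>g x - g o'\<bar> \<le> (\<Sum>i\<in>{1..N}. L i * dist (x i) (o' i))"
    by (rule coord_lipschitz_dist[OF g x]) (simp add: o'_def space_PiM)
  also have "\<dots> \<le> (\<Sum>i\<in>{1..N}. L i * 1)"
    using coord_lipschitzD(1)[OF g] by (intro sum_mono mult_left_mono dist_circle_le_1)
  finally show "\<bar>g x\<bar> \<le> \<bar>g (\<lambda>i\<in>{1..N}. undefined)\<bar> + (\<Sum>i\<in>{1..N}. L i)"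
    by (simp add: o'_def)
qed

section \<open>Lipschitz partitions of unity and rounding to a finite net\<close>

locale circle_partition =
  fixes C :: "circle set" and \<phi> :: "circle \<Rightarrow> circle \<Rightarrow> real" and M e :: real
  assumes finite_C: "finite C"
    and \<phi>_nonneg: "0 \<le> \<phi> c x"
    and \<phi>_sum: "(\<Sum>c\<in>C. \<phi> c x) = 1"
    and \<phi>_supp: "\<phi> c x \<noteq> 0 \<Longrightarrow> dist x c \<le> e"
    and \<phi>_lipschitz: "c \<in> C \<Longrightarrow> \<bar>\<phi> c x - \<phi> c y\<bar> \<le> M * dist x y"
    and M_nonneg: "0 \<le> M" and e_nonneg: "0 \<le> e"

text \<open>Tent functions of radius \<open>e\<close> around a net of mesh \<open>e / 2\<close>,
  divided by their sum. The finer mesh keeps that sum at least \<open>e / 2\<close>, so the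
  quotients remain Lipschitz.\<close>

lemma circle_partition_exists:
  assumes "0 < e"
  shows "\<exists>C \<phi> M. circle_partition C \<phi> M e"
proof -
  obtain C :: "circle set" where C: "finite C" "\<And>x. \<exists>c\<in>C. dist x c < e / 2"
    using finite_circle_net[of "e / 2"] assms by auto
  define \<psi> where "\<psi> c x = max 0 (e - dist x c)" for c x :: circle
  define S where "S x = (\<Sum>c\<in>C. \<psi> c x)" for x
  define \<phi> where "\<phi> c x = \<psi> c x / S x" for c x
  have \<psi>0: "0 \<le> \<psi> c x" for c x by (simp add: \<psi>_def)
  have \<psi>_lip: "\<bar>\<psi> c x - \<psi> c y\<bar> \<le> dist x y" for c x y
    using dist_triangle[of x c y] dist_triangle[of y c x] by (simp add: \<psi>_def dist_commute)
  have S: "e / 2 \<le> S x" for x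
  proof -
    obtain c where c: "c \<in> C" "dist x c < e / 2" using C(2) by blast
    have "e / 2 \<le> e - dist x c" using c(2) by simp
    also have "\<dots> \<le> \<psi> c x" by (simp add: \<psi>_def)
    also have "\<dots> \<le> S x" unfolding S_def using c(1) C(1) \<psi>0 by (intro member_le_sum) auto
    finally show ?thesis .
  qed
  then have S0: "0 < S x" for x using assms by (smt (verit) half_gt_zero)
  have S_lip: "\<bar>S x - S y\<bar> \<le> card C * dist x y" for x y
  proof -
    have "\<bar>S x - S y\<bar> \<le> (\<Sum>c\<in>C. \<bar>\<psi> c x - \<psi> c y\<bar>)"
      unfolding S_def sum_subtractf[symmetric] by (rule sum_abs)
    also have "\<dots> \<le> (\<Sum>c\<in>C. dist x y)" by (intro sum_mono \<psi>_lip)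
    finally show ?thesis by simp
  qed
  have \<phi>_le: "\<phi> c x \<le> 1" if "c \<in> C" for c x
    using that C(1) \<psi>0 S0[of x] by (auto simp: \<phi>_def S_def intro!: member_le_sum)
  have "circle_partition C \<phi> ((1 + card C) / (e / 2)) e"
  proof
    show "finite C" by fact
    show "0 \<le> \<phi> c x" for c x using \<psi>0 S0[of x] by (simp add: \<phi>_def)
    show "(\<Sum>c\<in>C. \<phi> c x) = 1" for x
      unfolding \<phi>_def sum_divide_distrib[symmetric] using S0[of x] by (simp add: S_def)
    show "dist x c \<le> e" if "\<phi> c x \<noteq> 0" for c x
      using that by (auto simp: \<phi>_def \<psi>_def max_def split: if_splits)
    show "0 \<le> (1 + card C) / (e / 2)" "0 \<le> e" using assms by simp_all
    fix c x y assume c: "c \<in> C"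
    \<comment> \<open>A quotient rule that separates the change of the tent from the change of the
      normalizing sum. As \<open>\<phi> c y\<close> is at most 1, it leads to the constant
      \<open>(1 + card C) / (e / 2)\<close>.\<close>
    have "\<phi> c x - \<phi> c y = (\<psi> c x - \<psi> c y) / S x + \<phi> c y * ((S y - S x) / S x)"
      using S0[of x] S0[of y] by (simp add: \<phi>_def field_simps)
    then have "\<bar>\<phi> c x - \<phi> c y\<bar> \<le> \<bar>(\<psi> c x - \<psi> c y) / S x\<bar> + \<bar>\<phi> c y * ((S y - S x) / S x)\<bar>"
      by (metis abs_triangle_ineq)
    also have "\<dots> = \<bar>\<psi> c x - \<psi> c y\<bar> / S x + \<phi> c y * (\<bar>S x - S y\<bar> / S x)"
      using S0[of x] S0[of y] \<psi>0[of c y] by (simp add: abs_mult \<phi>_def abs_minus_commute)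
    also have "\<dots> \<le> dist x y / (e / 2) + 1 * ((card C * dist x y) / (e / 2))"
      using S0[of x] S0[of y] \<psi>0[of c y] \<phi>_le[OF c, of y] S[of x] \<psi>_lip S_lip assms
      by (intro add_mono mult_mono frac_le) (auto simp: \<phi>_def)
    also have "\<dots> = (1 + card C) / (e / 2) * dist x y" using assms by (simp add: field_simps)
    finally show "\<bar>\<phi> c x - \<phi> c y\<bar> \<le> (1 + card C) / (e / 2) * dist x y" .
  qed
  then show ?thesis by blast
qed

context circle_partition
begin

lemma \<phi>_le_1: "c \<in> C \<Longrightarrow> \<phi> c x \<le> 1"
  using member_le_sum[of c C "\<lambda>c. \<phi> c x"] \<phi>_nonneg \<phi>_sum[of x] finite_C by simp

lemma \<phi>_measurable [measurable]: "c \<in> C \<Longrightarrow> \<phi> c \<in> borel_measurable borel"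
proof (rule borel_measurable_continuous_onI, rule lipschitz_on_continuous_on)
  assume "c \<in> C"
  then show "M-lipschitz_on UNIV (\<phi> c)"
    using \<phi>_lipschitz M_nonneg by (auto simp: lipschitz_on_def dist_real_def)
qed

text \<open>
  Each coordinate jumps independently to a nearby net point, which gives a Bernstein-type
  operator that rounds the torus to a finite net without losing continuity.
\<close>

definition net :: "nat \<Rightarrow> (nat \<Rightarrow> circle) set"
  where "net N = PiE {1..N} (\<lambda>_. C)"

definition weight :: "nat \<Rightarrow> (nat \<Rightarrow> circle) \<Rightarrow> (nat \<Rightarrow> circle) \<Rightarrow> real"
  where "weight N y x = (\<Prod>i\<in>{1..N}. \<phi> (y i) (x i))"

lemma finite_net: "finite (net N)"
  unfolding net_def using finite_C by (intro finite_PiE) auto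

lemma net_space: "y \<in> net N \<Longrightarrow> y \<in> space (torus N)"
  by (auto simp: net_def space_PiM)

lemma net_mem: "y \<in> net N \<Longrightarrow> i \<in> {1..N} \<Longrightarrow> y i \<in> C"
  by (auto simp: net_def)

lemma weight_nonneg: "0 \<le> weight N y x"
  unfolding weight_def by (intro prod_nonneg) (simp add: \<phi>_nonneg)

lemma sum_net_prod:
  fixes F :: "nat \<Rightarrow> circle \<Rightarrow> real"
  shows "(\<Sum>y\<in>net N. \<Prod>i\<in>{1..N}. F i (y i)) = (\<Prod>i\<in>{1..N}. \<Sum>c\<in>C. F i c)"
  unfolding net_def using finite_C by (subst prod_sum_PiE) auto

lemma weight_sum: "(\<Sum>y\<in>net N. weight N y x) = 1"
  unfolding weight_def using sum_net_prod[where N = N and F = "\<lambda>i c. \<phi> c (x i)"] by (simp add: \<phi>_sum)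

lemma weight_measurable [measurable]:
  assumes "y \<in> net N"
  shows "weight N y \<in> borel_measurable (torus N)"
proof -
  have "(\<lambda>x. \<phi> (y i) (x i)) \<in> borel_measurable (torus N)" if "i \<in> {1..N}" for i
  proof -
    have [measurable]: "\<phi> (y i) \<in> borel_measurable borel"
      using net_mem[OF assms that] by (rule \<phi>_measurable)
    show ?thesis using that by measurable
  qed
  then show ?thesis unfolding weight_def[abs_def] by (intro borel_measurable_prod)
qed

text \<open>A net point of nonzero weight lies within \<open>e\<close> of \<open>x\<close> in every
  coordinate, and the weights sum to 1.\<close>

lemma net_approx:
  assumes g: "coord_lipschitz N g L" and x: "x \<in> space (torus N)"
  shows "\<bar>(\<Sum>y\<in>net N. weight N y x * g y) - g x\<bar> \<le> e * (\<Sum>i\<in>{1..N}. L i)"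
proof -
  have "(\<Sum>y\<in>net N. weight N y x * g y) - g x = (\<Sum>y\<in>net N. weight N y x * (g y - g x))"
    by (simp add: right_diff_distrib sum_subtractf weight_sum flip: sum_distrib_right)
  also have "\<bar>\<dots>\<bar> \<le> (\<Sum>y\<in>net N. \<bar>weight N y x * (g y - g x)\<bar>)" by (rule sum_abs)
  also have "\<dots> \<le> (\<Sum>y\<in>net N. weight N y x * (e * (\<Sum>i\<in>{1..N}. L i)))"
  proof (rule sum_mono)
    fix y assume y: "y \<in> net N"
    show "\<bar>weight N y x * (g y - g x)\<bar> \<le> weight N y x * (e * (\<Sum>i\<in>{1..N}. L i))"
    proof (cases "weight N y x = 0")
      case False
      then have near: "dist (x i) (y i) \<le> e" if "i \<in> {1..N}" for i
        using that by (intro \<phi>_supp) (auto simp: weight_def)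
      have "\<bar>g x - g y\<bar> \<le> (\<Sum>i\<in>{1..N}. L i * dist (x i) (y i))"
        by (rule coord_lipschitz_dist[OF g x net_space[OF y]])
      also have "\<dots> \<le> (\<Sum>i\<in>{1..N}. L i * e)"
        using near coord_lipschitzD(1)[OF g] by (intro sum_mono mult_left_mono) auto
      finally have "\<bar>g y - g x\<bar> \<le> e * (\<Sum>i\<in>{1..N}. L i)"
        by (simp add: sum_distrib_left abs_minus_commute mult.commute)
      then show ?thesis by (simp add: abs_mult weight_nonneg mult_left_mono)
    qed simp
  qed
  also have "\<dots> = e * (\<Sum>i\<in>{1..N}. L i)"
    by (simp add: weight_sum flip: sum_distrib_right)
  finally show ?thesis .
qed

text \<open>
  Under the jump distribution the indicators of \<open>y k = c\<close> are independent, so only the diagonal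
  terms of the second moment of the count of \<open>c\<close> exceed their values at \<open>x\<close>.
\<close>

lemma weight_pair:
  assumes "k \<in> {1..N}" "l \<in> {1..N}" "k \<noteq> l" "c \<in> C"
  shows "(\<Sum>y\<in>net N. weight N y x * ((of_bool (y k = c) - q) * (of_bool (y l = c) - q)))
    = (\<phi> c (x k) - q) * (\<phi> c (x l) - q)"
proof -
  \<comment> \<open>The two centred indicators are attached to the factors at \<open>k\<close> and
    \<open>l\<close>, so that the sum over the net becomes a product of one-coordinate sums; all the
    others equal 1.\<close>
  define F where "F i d = \<phi> d (x i) * ((if i = k then of_bool (d = c) - q else 1)
    * (if i = l then of_bool (d = c) - q else 1))" for i d
  have one: "(\<Sum>d\<in>C. \<phi> d (x i) * (of_bool (d = c) - q)) = \<phi> c (x i) - q" for i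
  proof -
    have "(\<Sum>d\<in>C. \<phi> d (x i) * (of_bool (d = c) - q))
        = (\<Sum>d\<in>C. if d = c then \<phi> c (x i) else 0) - (\<Sum>d\<in>C. \<phi> d (x i)) * q"
      unfolding sum_distrib_right sum_subtractf[symmetric]
      by (intro sum.cong) (auto simp: algebra_simps)
    then show ?thesis using finite_C assms(4) by (simp add: \<phi>_sum)
  qed
  have F: "(\<Sum>d\<in>C. F i d) = (if i = k then \<phi> c (x k) - q else 1) * (if i = l then \<phi> c (x l) - q else 1)" for i
    using assms(3) one by (auto simp: F_def \<phi>_sum)
  have "(\<Sum>y\<in>net N. weight N y x * ((of_bool (y k = c) - q) * (of_bool (y l = c) - q)))
      = (\<Sum>y\<in>net N. \<Prod>i\<in>{1..N}. F i (y i))"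
    using assms by (simp add: F_def prod.distrib weight_def)
  also have "\<dots> = (\<Prod>i\<in>{1..N}. \<Sum>d\<in>C. F i d)" by (rule sum_net_prod)
  also have "\<dots> = (\<phi> c (x k) - q) * (\<phi> c (x l) - q)"
    using assms by (simp add: F prod.distrib)
  finally show ?thesis .
qed

lemma weight_second_moment:
  assumes c: "c \<in> C" and q: "0 \<le> q" "q \<le> 1"
  shows "(\<Sum>y\<in>net N. weight N y x * (\<Sum>i\<in>{1..N}. of_bool (y i = c) - q)\<^sup>2)
    \<le> N + (\<Sum>k\<in>{1..N}. \<Sum>l\<in>{1..N} - {k}. (\<phi> c (x k) - q) * (\<phi> c (x l) - q))"
proof -
  define \<xi> where "\<xi> y i = of_bool (y i = c) - q" for y :: "nat \<Rightarrow> circle" and i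
  have sq: "(\<Sum>i\<in>{1..N}. \<xi> y i)\<^sup>2 = (\<Sum>k\<in>{1..N}. \<xi> y k * \<xi> y k + (\<Sum>l\<in>{1..N} - {k}. \<xi> y k * \<xi> y l))" for y
    unfolding power2_eq_square sum_product by (intro sum.cong refl sum.remove) auto
  have "(\<Sum>y\<in>net N. weight N y x * (\<Sum>i\<in>{1..N}. \<xi> y i)\<^sup>2)
      = (\<Sum>k\<in>{1..N}. \<Sum>y\<in>net N. weight N y x * (\<xi> y k * \<xi> y k))
      + (\<Sum>k\<in>{1..N}. \<Sum>l\<in>{1..N} - {k}. \<Sum>y\<in>net N. weight N y x * (\<xi> y k * \<xi> y l))"
    unfolding sq sum_distrib_left distrib_left sum.distrib
    by (intro arg_cong2[of _ _ _ _ "(+)"])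
      (subst sum.swap, simp, subst sum.swap, intro sum.cong refl, subst sum.swap, simp)
  also have "(\<Sum>k\<in>{1..N}. \<Sum>l\<in>{1..N} - {k}. \<Sum>y\<in>net N. weight N y x * (\<xi> y k * \<xi> y l))
      = (\<Sum>k\<in>{1..N}. \<Sum>l\<in>{1..N} - {k}. (\<phi> c (x k) - q) * (\<phi> c (x l) - q))"
    unfolding \<xi>_def using c by (intro sum.cong refl weight_pair) auto
  \<comment> \<open>A diagonal term is the square of a number in \<open>[-1, 1]\<close>, hence the
    contribution \<open>N\<close>.\<close>
  also have "(\<Sum>k\<in>{1..N}. \<Sum>y\<in>net N. weight N y x * (\<xi> y k * \<xi> y k)) \<le> (\<Sum>k\<in>{1..N}. \<Sum>y\<in>net N. weight N y x * 1)"
  proof (intro sum_mono mult_left_mono weight_nonneg)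
    fix k y
    have "\<bar>\<xi> y k\<bar> \<le> 1" using q by (auto simp: \<xi>_def)
    then show "\<xi> y k * \<xi> y k \<le> 1" by (metis abs_mult_self_eq abs_ge_zero mult_le_one)
  qed
  finally show ?thesis by (simp add: weight_sum \<xi>_def)
qed

end

text \<open>The function is the pointwise limit of its roundings to nets of mesh
  \<open>1 / (m + 1)\<close>, and these are finite combinations of product-measurable weights. No
  topology on the space of configurations is involved.\<close>

lemma coord_lipschitz_measurable:
  assumes g: "coord_lipschitz N g L"
  shows "g \<in> borel_measurable (torus N)"
proof -
  have "\<exists>C \<phi> M. circle_partition C \<phi> M (inverse (Suc m))" for m
    by (rule circle_partition_exists) simp
  then obtain C \<phi> M where P: "\<And>m. circle_partition (C m) (\<phi> m) (M m) (inverse (Suc m))"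
    by metis
  define G where "G m x = (\<Sum>y\<in>circle_partition.net (C m) N. circle_partition.weight (\<phi> m) N y x * g y)" for m x
  show ?thesis
  proof (rule borel_measurable_LIMSEQ_real)
    show "G m \<in> borel_measurable (torus N)" for m
      unfolding G_def[abs_def]
      using circle_partition.weight_measurable[OF P] by (intro borel_measurable_sum borel_measurable_times) auto
    fix x assume x: "x \<in> space (torus N)"
    have "(\<lambda>m. inverse (Suc m) * (\<Sum>i\<in>{1..N}. L i)) \<longlonglongrightarrow> 0 * (\<Sum>i\<in>{1..N}. L i)"
      by (intro tendsto_mult tendsto_const LIMSEQ_inverse_real_of_nat)
    then have lim: "(\<lambda>m. inverse (Suc m) * (\<Sum>i\<in>{1..N}. L i)) \<longlonglongrightarrow> 0" by simp
    have bound: "norm (G m x - g x) \<le> inverse (Suc m) * (\<Sum>i\<in>{1..N}. L i)" for m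
      using circle_partition.net_approx[OF P g x, of m] by (simp only: G_def real_norm_def)
    have "(\<lambda>m. G m x - g x) \<longlonglongrightarrow> 0"
      by (rule Lim_null_comparison[OF always_eventually lim]) (simp only: bound simp_thms)
    then show "(\<lambda>m. G m x) \<longlonglongrightarrow> g x" by (rule LIM_zero_cancel)
  qed
qed

lemma coord_lipschitz_integrable:
  assumes g: "coord_lipschitz N g L" and \<mu>: "prob_space \<mu>" "sets \<mu> = sets (torus N)"
  shows "integrable \<mu> g"
proof -
  obtain B where "\<And>x. x \<in> space (torus N) \<Longrightarrow> \<bar>g x\<bar> \<le> B" using coord_lipschitz_bounded[OF g] by metis
  moreover have "space \<mu> = space (torus N)" using \<mu>(2) by (rule sets_eq_imp_space_eq)
  ultimately show ?thesis
    using coord_lipschitz_measurable[OF g] \<mu>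
    by (intro finite_measure.integrable_const_bound[where B = B] prob_space.finite_measure)
      (auto cong: measurable_cong_sets)
qed

text \<open>Induction on the distance between the two count vectors. Equal counts mean that
  \<open>y\<close> and \<open>z\<close> differ by a permutation; otherwise moving one coordinate
  from an over-represented value \<open>a\<close> to an under-represented value \<open>b\<close>
  costs \<open>r\<close> and brings the counts closer.\<close>

lemma symmetric_function_counts:
  fixes g :: "('i \<Rightarrow> 'a) \<Rightarrow> real"
  assumes I: "finite I" and C: "finite C" and r: "0 \<le> r"
    and sym: "\<And>y \<sigma>. y \<in> PiE I (\<lambda>_. C) \<Longrightarrow> \<sigma> permutes I \<Longrightarrow> g (\<lambda>i\<in>I. y (\<sigma> i)) = g y"
    and step: "\<And>y i c. y \<in> PiE I (\<lambda>_. C) \<Longrightarrow> i \<in> I \<Longrightarrow> c \<in> C \<Longrightarrow> \<bar>g y - g (y(i := c))\<bar> \<le> r"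
    and y: "y \<in> PiE I (\<lambda>_. C)" and z: "z \<in> PiE I (\<lambda>_. C)"
  shows "\<bar>g y - g z\<bar> \<le> r * (\<Sum>c\<in>C. \<bar>real (card {i\<in>I. y i = c}) - real (card {i\<in>I. z i = c})\<bar>)"
proof -
  define n where "n y c = card {i\<in>I. y i = c}" for y :: "'i \<Rightarrow> 'a" and c
  define D where "D y = (\<Sum>c\<in>C. \<bar>real (n y c) - real (n z c)\<bar>)" for y
  have total: "(\<Sum>c\<in>C. n y c) = card I" if "y \<in> PiE I (\<lambda>_. C)" for y
  proof -
    have "card I = card (\<Union>c\<in>C. {i\<in>I. y i = c})"
      using that by (intro arg_cong[of _ _ card]) auto
    also have "\<dots> = (\<Sum>c\<in>C. n y c)"
      unfolding n_def using I C by (intro card_UN_disjoint) auto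
    finally show ?thesis ..
  qed
  \<comment> \<open>The natural-number form of \<open>D\<close>, on which the induction
    runs.\<close>
  define K where "K y = (\<Sum>c\<in>C. nat \<bar>int (n y c) - int (n z c)\<bar>)" for y
  have K: "real (K y) = D y" for y
    unfolding K_def D_def of_nat_sum by (intro sum.cong refl) simp
  have "\<bar>g y - g z\<bar> \<le> r * real (K y)"
    using y
  proof (induction "K y" arbitrary: y rule: less_induct)
    case less
    note y = \<open>y \<in> PiE I (\<lambda>_. C)\<close>
    show ?case
    proof (cases "\<exists>a\<in>C. n z a < n y a")
      case False
      \<comment> \<open>No value is over-represented; as both count vectors have the same total,
        they coincide.\<close>
      then have le: "\<And>c. c \<in> C \<Longrightarrow> n y c \<le> n z c" by (auto simp: not_less)
      have eq: "n y c = n z c" if "c \<in> C" for c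
      proof (rule ccontr)
        assume "n y c \<noteq> n z c"
        then have "n y c < n z c" using le[OF that] by simp
        then have "(\<Sum>c\<in>C. n y c) < (\<Sum>c\<in>C. n z c)"
          using le that C by (intro sum_strict_mono_ex1) auto
        then show False using total[OF y] total[OF z] by simp
      qed
      have "image_mset z (mset_set I) = image_mset y (mset_set I)"
      proof (rule multiset_eqI)
        fix c
        have "count (image_mset u (mset_set I)) c = n u c" for u
          using I by (simp add: count_image_mset_eq_card_vimage n_def vimage_def Int_def conj_commute)
        moreover have "n y c = n z c"
        proof (cases "c \<in> C")
          case False
          then have "{i\<in>I. y i = c} = {}" "{i\<in>I. z i = c} = {}" using y z by auto
          then show ?thesis by (simp only: n_def)
        qed (rule eq)
        ultimately show "count (image_mset z (mset_set I)) c = count (image_mset y (mset_set I)) c"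
          by simp
      qed
      from image_mset_eq_implies_permutes[OF I this]
      obtain \<sigma> where \<sigma>: "\<sigma> permutes I" "\<And>x. x \<in> I \<Longrightarrow> z x = y (\<sigma> x)" by metis
      then have "z = (\<lambda>i\<in>I. y (\<sigma> i))" using z by (auto simp: fun_eq_iff PiE_def extensional_def)
      then have "g y = g z" using sym[OF y \<sigma>(1)] by simp
      then show ?thesis using r by simp
    next
      case True
      then obtain a where a: "a \<in> C" "n z a < n y a" by blast
      have "\<exists>b\<in>C. n y b < n z b"
      proof (rule ccontr)
        assume "\<not> ?thesis"
        then have "\<And>c. c \<in> C \<Longrightarrow> n z c \<le> n y c" by (auto simp: not_less)
        then have "(\<Sum>c\<in>C. n z c) < (\<Sum>c\<in>C. n y c)"
          using a C by (intro sum_strict_mono_ex1) auto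
        then show False using total[OF y] total[OF z] by simp
      qed
      then obtain b where b: "b \<in> C" "n y b < n z b" by blast
      have ab: "a \<noteq> b" using a b by auto
      have "0 < card {i\<in>I. y i = a}" using a(2) unfolding n_def by linarith
      then have "{i\<in>I. y i = a} \<noteq> {}" by (metis card.empty less_irrefl)
      then obtain i where i: "i \<in> I" "y i = a" by blast
      define y' where "y' = y(i := b)"
      have y': "y' \<in> PiE I (\<lambda>_. C)"
        using y i b by (auto simp: y'_def PiE_def extensional_def)
      have "{j\<in>I. y' j = a} = {j\<in>I. y j = a} - {i}" using ab by (auto simp: y'_def)
      then have na: "n y' a = n y a - 1" using i I by (simp add: n_def)
      have "{j\<in>I. y' j = b} = insert i {j\<in>I. y j = b}" using i by (auto simp: y'_def)
      then have nb: "n y' b = n y b + 1" using i ab I by (simp add: n_def)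
      have nc: "n y' c = n y c" if "c \<noteq> a" "c \<noteq> b" for c
      proof -
        have "{j\<in>I. y' j = c} = {j\<in>I. y j = c}" using that i by (auto simp: y'_def)
        then show ?thesis by (simp add: n_def)
      qed
      have "K y' < K y"
        unfolding K_def
      proof (rule sum_strict_mono_ex1)
        show "\<forall>c\<in>C. nat \<bar>int (n y' c) - int (n z c)\<bar> \<le> nat \<bar>int (n y c) - int (n z c)\<bar>"
        proof
          fix c
          show "nat \<bar>int (n y' c) - int (n z c)\<bar> \<le> nat \<bar>int (n y c) - int (n z c)\<bar>"
            using na nb nc[of c] a b by (cases "c = a"; cases "c = b") auto
        qed
        show "\<exists>c\<in>C. nat \<bar>int (n y' c) - int (n z c)\<bar> < nat \<bar>int (n y c) - int (n z c)\<bar>"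
          using nb b by (intro bexI[of _ b]) auto
      qed fact
      then have "\<bar>g y' - g z\<bar> \<le> r * real (K y')" using less y' by blast
      moreover have "\<bar>g y - g y'\<bar> \<le> r" unfolding y'_def using step[OF y i(1) b(1)] .
      ultimately have "\<bar>g y - g z\<bar> \<le> r * (real (K y') + 1)" by (simp add: distrib_left)
      also have "\<dots> \<le> r * real (K y)"
        using \<open>K y' < K y\<close> r by (intro mult_left_mono) auto
      finally show ?thesis .
    qed
  qed
  then show ?thesis by (simp add: K D_def n_def)
qed

section \<open>Exchangeable measures\<close>

text \<open>The arithmetic-geometric mean inequality, in the form that turns a second moment of at
  most \<open>r\<^sup>2\<close> into a first absolute moment of at most \<open>r\<close>.\<close>

lemma abs_le_square_div:
  fixes t r :: real
  assumes "0 < r"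
  shows "\<bar>t\<bar> \<le> (t\<^sup>2 / r + r) / 2"
proof -
  have "0 \<le> (\<bar>t\<bar> - r)\<^sup>2" by simp
  then have "2 * \<bar>t\<bar> * r \<le> (t\<^sup>2 / r + r) * r"
    using assms by (simp add: power2_eq_square algebra_simps)
  then show ?thesis using assms by (simp only: mult_le_cancel_right) simp
qed

text \<open>Coordinate \<open>i\<close> of \<open>x\<close> is read at position
  \<open>inv \<sigma> i\<close> of the permuted point, so the constants are permuted by the
  inverse.\<close>

lemma coord_lipschitz_permute:
  assumes g: "coord_lipschitz N g L" and \<sigma>: "\<sigma> permutes {1..N}"
  shows "coord_lipschitz N (\<lambda>x. g (\<lambda>i\<in>{1..N}. x (\<sigma> i))) (\<lambda>i. L (inv \<sigma> i))"
  unfolding coord_lipschitz_def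
proof (intro ballI conjI allI)
  fix i assume i: "i \<in> {1..N}"
  have j: "inv \<sigma> i \<in> {1..N}"
    using permutes_in_image[OF permutes_inv[OF \<sigma>]] i by blast
  then show "0 \<le> L (inv \<sigma> i)" by (rule coord_lipschitzD[OF g])
  fix x s assume x: "x \<in> space (torus N)"
  have "(\<lambda>k\<in>{1..N}. (x(i := s)) (\<sigma> k)) = (\<lambda>k\<in>{1..N}. x (\<sigma> k))(inv \<sigma> i := s)"
  proof
    fix k
    have "\<sigma> k = i \<longleftrightarrow> k = inv \<sigma> i" using permutes_inv_eq[OF \<sigma>, of i k] by auto
    then show "(\<lambda>k\<in>{1..N}. (x(i := s)) (\<sigma> k)) k = ((\<lambda>k\<in>{1..N}. x (\<sigma> k))(inv \<sigma> i := s)) k"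
      using j permutes_inverses(1)[OF \<sigma>] by (simp add: restrict_def)
  qed
  moreover have "(\<lambda>k\<in>{1..N}. x (\<sigma> k)) (inv \<sigma> i) = x i"
    using j permutes_inverses(1)[OF \<sigma>] by simp
  moreover have "(\<lambda>k\<in>{1..N}. x (\<sigma> k)) \<in> space (torus N)" by (simp add: space_PiM)
  ultimately show "\<bar>g (\<lambda>i\<in>{1..N}. x (\<sigma> i)) - g (\<lambda>k\<in>{1..N}. (x(i := s)) (\<sigma> k))\<bar> \<le> L (inv \<sigma> i) * dist (x i) s"
    using coord_lipschitzD(2)[OF g j, of "\<lambda>k\<in>{1..N}. x (\<sigma> k)" s] by simp
qed

text \<open>Composing with a transposition shows that the sum of \<open>L (\<sigma> i)\<close> over
  all \<open>\<sigma>\<close> is the same for every \<open>i\<close>; adding over \<open>i\<close>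
  gives the total of \<open>L\<close> once for each of the \<open>fact N\<close>
  permutations.\<close>

lemma sum_permutations_average:
  fixes L :: "nat \<Rightarrow> real"
  assumes i: "i \<in> {1..N}"
  shows "real N * (\<Sum>\<sigma> | \<sigma> permutes {1..N}. L (inv \<sigma> i)) = fact N * (\<Sum>j\<in>{1..N}. L j)"
proof -
  let ?P = "{\<sigma>. \<sigma> permutes {1..N}}"
  have inv: "(\<Sum>\<sigma>\<in>?P. L (inv \<sigma> i)) = (\<Sum>\<sigma>\<in>?P. L (\<sigma> i))" for i
    by (rule sum_permutations_inverse[symmetric, of "\<lambda>\<sigma>. L (\<sigma> i)"])
  have same: "(\<Sum>\<sigma>\<in>?P. L (\<sigma> i)) = (\<Sum>\<sigma>\<in>?P. L (\<sigma> j))" if "j \<in> {1..N}" for j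
  proof -
    have "Transposition.transpose i j permutes {1..N}" using i that by (rule permutes_swap_id)
    then have "(\<Sum>\<sigma>\<in>?P. L (\<sigma> i)) = (\<Sum>\<sigma>\<in>?P. L ((\<sigma> \<circ> Transposition.transpose i j) i))"
      by (rule sum_permutations_compose_right)
    then show ?thesis by simp
  qed
  have "real N * (\<Sum>\<sigma>\<in>?P. L (inv \<sigma> i)) = (\<Sum>j\<in>{1..N}. \<Sum>\<sigma>\<in>?P. L (\<sigma> j))"
    unfolding inv by (subst sum.cong[OF refl same[symmetric]]) auto
  also have "\<dots> = (\<Sum>\<sigma>\<in>?P. \<Sum>j\<in>{1..N}. L (\<sigma> j))" by (rule sum.swap)
  also have "\<dots> = (\<Sum>\<sigma>\<in>?P. \<Sum>j\<in>{1..N}. L j)"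
  proof (rule sum.cong[OF refl])
    fix \<sigma> assume "\<sigma> \<in> ?P"
    then show "(\<Sum>j\<in>{1..N}. L (\<sigma> j)) = (\<Sum>j\<in>{1..N}. L j)"
      using sum.permute[of \<sigma> "{1..N}" L] by (simp add: o_def)
  qed
  also have "\<dots> = fact N * (\<Sum>j\<in>{1..N}. L j)"
    by (simp add: card_permutations[of _ N])
  finally show ?thesis .
qed

text \<open>Averaging over all permutations of the coordinates replaces every constant by the mean
  of the \<open>L i\<close>, hence by at most \<open>1 / N\<close>. Integrals against exchangeable
  measures do not notice the averaging.\<close>

lemma coord_lipschitz_symmetrize:
  assumes g: "coord_lipschitz N g L" and L: "(\<Sum>i\<in>{1..N}. L i) \<le> 1" and N: "1 \<le> N"
  obtains gs where "coord_lipschitz N gs (\<lambda>_. 1 / N)"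
    and "\<And>x \<sigma>. x \<in> space (torus N) \<Longrightarrow> \<sigma> permutes {1..N} \<Longrightarrow> gs (\<lambda>i\<in>{1..N}. x (\<sigma> i)) = gs x"
    and "\<And>\<mu>. prob_space \<mu> \<Longrightarrow> sets \<mu> = sets (torus N) \<Longrightarrow> exchangeable N \<mu> \<Longrightarrow>
      (\<integral>x. gs x \<partial>\<mu>) = (\<integral>x. g x \<partial>\<mu>)"
proof
  let ?P = "{\<sigma>. \<sigma> permutes {1..N}}"
  define G where "G \<sigma> x = g (\<lambda>i\<in>{1..N}. x (\<sigma> i))" for \<sigma> :: "nat \<Rightarrow> nat" and x
  define gs where "gs x = (\<Sum>\<sigma>\<in>?P. G \<sigma> x) / fact N" for x
  have G: "coord_lipschitz N (G \<sigma>) (\<lambda>i. L (inv \<sigma> i))" if "\<sigma> \<in> ?P" for \<sigma>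
    using coord_lipschitz_permute[OF g] that unfolding G_def by simp
  have card: "card ?P = fact N" by (simp add: card_permutations[of _ N])
  show "coord_lipschitz N gs (\<lambda>_. 1 / N)"
    unfolding coord_lipschitz_def
  proof (intro ballI conjI allI)
    fix i x s assume i: "i \<in> {1..N}" and x: "x \<in> space (torus N)"
    have "\<bar>gs x - gs (x(i := s))\<bar> = \<bar>\<Sum>\<sigma>\<in>?P. G \<sigma> x - G \<sigma> (x(i := s))\<bar> / fact N"
      unfolding gs_def by (simp add: sum_subtractf flip: diff_divide_distrib)
    also have "\<dots> \<le> (\<Sum>\<sigma>\<in>?P. \<bar>G \<sigma> x - G \<sigma> (x(i := s))\<bar>) / fact N"
      by (intro divide_right_mono sum_abs) simp
    also have "\<dots> \<le> (\<Sum>\<sigma>\<in>?P. L (inv \<sigma> i) * dist (x i) s) / fact N"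
      by (intro divide_right_mono sum_mono coord_lipschitzD(2)[OF G i x]) simp_all
    also have "\<dots> = (\<Sum>\<sigma>\<in>?P. L (inv \<sigma> i)) * dist (x i) s / fact N"
      by (simp add: sum_distrib_right)
    also have "(\<Sum>\<sigma>\<in>?P. L (inv \<sigma> i)) = fact N * (\<Sum>j\<in>{1..N}. L j) / N"
      using sum_permutations_average[OF i, of L] N by (simp add: eq_divide_eq mult.commute)
    also have "fact N * (\<Sum>j\<in>{1..N}. L j) / N * dist (x i) s / fact N = (\<Sum>j\<in>{1..N}. L j) / N * dist (x i) s"
      by simp
    also have "\<dots> \<le> 1 / N * dist (x i) s"
      using L by (intro mult_right_mono divide_right_mono) auto
    finally show "\<bar>gs x - gs (x(i := s))\<bar> \<le> 1 / N * dist (x i) s" .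
  qed simp
  show "gs (\<lambda>i\<in>{1..N}. x (\<tau> i)) = gs x" if "x \<in> space (torus N)" and \<tau>: "\<tau> permutes {1..N}" for x \<tau>
  proof -
    have "(\<Sum>\<sigma>\<in>?P. G \<sigma> (\<lambda>i\<in>{1..N}. x (\<tau> i))) = (\<Sum>\<sigma>\<in>?P. G (\<tau> \<circ> \<sigma>) x)"
      unfolding G_def
    proof (intro sum.cong refl arg_cong[of _ _ g])
      fix \<sigma> assume "\<sigma> \<in> ?P"
      then have "\<sigma> i \<in> {1..N}" if "i \<in> {1..N}" for i
        using that permutes_in_image[of \<sigma> "{1..N}" i] by simp
      then show "(\<lambda>i\<in>{1..N}. (\<lambda>i\<in>{1..N}. x (\<tau> i)) (\<sigma> i)) = (\<lambda>i\<in>{1..N}. x ((\<tau> \<circ> \<sigma>) i))"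
        by (simp add: fun_eq_iff restrict_def)
    qed
    also have "\<dots> = (\<Sum>\<sigma>\<in>?P. G \<sigma> x)"
      using setum_permutations_compose_left[OF \<tau>, of "\<lambda>\<sigma>. G \<sigma> x"] by simp
    finally show ?thesis by (simp add: gs_def)
  qed
  fix \<mu> assume \<mu>: "prob_space \<mu>" "sets \<mu> = sets (torus N)" "exchangeable N \<mu>"
  have "bounded (g ` space (torus N))"
    using coord_lipschitz_bounded[OF g] unfolding bounded_iff by (metis imageE real_norm_def)
  then have "(\<integral>x. G \<sigma> x \<partial>\<mu>) = (\<integral>x. g x \<partial>\<mu>)" if "\<sigma> \<in> ?P" for \<sigma>
    using \<mu>(3) that coord_lipschitz_measurable[OF g] unfolding exchangeable_def G_def by simp
  then have "(\<Sum>\<sigma>\<in>?P. \<integral>x. G \<sigma> x \<partial>\<mu>) = fact N * (\<integral>x. g x \<partial>\<mu>)"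
    using card by simp
  moreover have "(\<integral>x. gs x \<partial>\<mu>) = (\<Sum>\<sigma>\<in>?P. \<integral>x. G \<sigma> x \<partial>\<mu>) / fact N"
    unfolding gs_def using coord_lipschitz_integrable[OF G \<mu>(1,2)] by simp
  ultimately show "(\<integral>x. gs x \<partial>\<mu>) = (\<integral>x. g x \<partial>\<mu>)" by simp
qed

section \<open>Concentration of the empirical frequencies on the net\<close>

context circle_partition
begin

text \<open>The law on the net of a configuration drawn from \<open>\<mu>\<close> and then rounded
  at random.\<close>

definition net_law :: "nat \<Rightarrow> (nat \<Rightarrow> circle) measure \<Rightarrow> (nat \<Rightarrow> circle) \<Rightarrow> real"
  where "net_law N \<mu> y = (\<integral>x. weight N y x \<partial>\<mu>)"

lemma weight_integrable:
  assumes \<mu>: "prob_space \<mu>" "sets \<mu> = sets (torus N)" and y: "y \<in> net N"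
  shows "integrable \<mu> (weight N y)"
proof (rule finite_measure.integrable_const_bound[OF prob_space.finite_measure[OF \<mu>(1)]])
  have "weight N y x \<le> 1" for x
    using member_le_sum[OF y, of "\<lambda>y. weight N y x"] weight_nonneg finite_net weight_sum[of N x] by simp
  then show "AE x in \<mu>. norm (weight N y x) \<le> 1" by (simp add: weight_nonneg)
  show "weight N y \<in> borel_measurable \<mu>"
    using weight_measurable[OF y] \<mu>(2) by (simp cong: measurable_cong_sets)
qed

lemma net_law_nonneg: "0 \<le> net_law N \<mu> y"
  unfolding net_law_def by (intro integral_nonneg_AE) (simp add: weight_nonneg)

lemma net_law_integral:
  assumes \<mu>: "prob_space \<mu>" "sets \<mu> = sets (torus N)"
  shows "(\<Sum>y\<in>net N. net_law N \<mu> y * F y) = (\<integral>x. (\<Sum>y\<in>net N. weight N y x * F y) \<partial>\<mu>)"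
    and "integrable \<mu> (\<lambda>x. \<Sum>y\<in>net N. weight N y x * F y)"
  using weight_integrable[OF \<mu>] by (simp_all add: net_law_def)

lemma net_law_sum:
  assumes \<mu>: "prob_space \<mu>" "sets \<mu> = sets (torus N)"
  shows "(\<Sum>y\<in>net N. net_law N \<mu> y) = 1"
  using net_law_integral(1)[OF \<mu>, of "\<lambda>_. 1"] prob_space.prob_space[OF \<mu>(1)] by (simp add: weight_sum)

lemma net_law_approx:
  assumes \<mu>: "prob_space \<mu>" "sets \<mu> = sets (torus N)" and g: "coord_lipschitz N g L"
  shows "\<bar>(\<Sum>y\<in>net N. net_law N \<mu> y * g y) - (\<integral>x. g x \<partial>\<mu>)\<bar> \<le> e * (\<Sum>i\<in>{1..N}. L i)"
proof -
  interpret \<mu>: prob_space \<mu> by fact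
  have sp: "space \<mu> = space (torus N)" using \<mu>(2) by (rule sets_eq_imp_space_eq)
  note int = net_law_integral[OF \<mu>, of g] coord_lipschitz_integrable[OF g \<mu>]
  have "\<bar>(\<Sum>y\<in>net N. net_law N \<mu> y * g y) - (\<integral>x. g x \<partial>\<mu>)\<bar>
      = \<bar>\<integral>x. (\<Sum>y\<in>net N. weight N y x * g y) - g x \<partial>\<mu>\<bar>"
    using int by simp
  also have "\<dots> \<le> (\<integral>x. \<bar>(\<Sum>y\<in>net N. weight N y x * g y) - g x\<bar> \<partial>\<mu>)" by (rule integral_abs_bound)
  also have "\<dots> \<le> (\<integral>x. e * (\<Sum>i\<in>{1..N}. L i) \<partial>\<mu>)"
    using int net_approx[OF g] by (intro integral_mono) (auto simp: sp)
  finally show ?thesis by (simp add: \<mu>.prob_space)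
qed

text \<open>A Chebyshev-type estimate: the second moment of the centred count is at most
  \<open>N + N\<^sup>2 * \<eta>\<close>, hence at most \<open>(N * s)\<^sup>2\<close>, and
  \<open>abs_le_square_div\<close> passes to the first moment.\<close>

lemma net_law_count:
  fixes q s \<eta> :: real
  assumes \<mu>: "prob_space \<mu>" "sets \<mu> = sets (torus N)" and c: "c \<in> C" and q: "0 \<le> q" "q \<le> 1"
    and pair: "\<And>k l. k \<in> {1..N} \<Longrightarrow> l \<in> {1..N} \<Longrightarrow> k \<noteq> l \<Longrightarrow>
      (\<integral>x. (\<phi> c (x k) - q) * (\<phi> c (x l) - q) \<partial>\<mu>) \<le> \<eta>"
    and s: "0 < s" "1 / N + \<eta> \<le> s\<^sup>2" "0 \<le> \<eta>" and N: "1 \<le> N"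
  shows "(\<Sum>y\<in>net N. net_law N \<mu> y * \<bar>real (card {i\<in>{1..N}. y i = c}) - N * q\<bar>) \<le> N * s"
proof -
  interpret \<mu>: prob_space \<mu> by fact
  define t where "t y = (\<Sum>i\<in>{1..N}. of_bool (y i = c) - q)" for y :: "nat \<Rightarrow> circle"
  have t: "t y = real (card {i\<in>{1..N}. y i = c}) - N * q" for y
    by (simp add: t_def sum_subtractf Int_def conj_commute flip: sum.inter_filter)
  have [measurable]: "\<phi> c \<in> borel_measurable borel" using c by (rule \<phi>_measurable)
  have int: "integrable \<mu> (\<lambda>x. (\<phi> c (x k) - q) * (\<phi> c (x l) - q))" if "k \<in> {1..N}" "l \<in> {1..N}" for k l
  proof (rule \<mu>.integrable_const_bound[of _ 1])
    have "\<bar>\<phi> c z - q\<bar> \<le> 1" for z using \<phi>_nonneg[of c z] \<phi>_le_1[OF c, of z] q by simp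
    then show "AE x in \<mu>. norm ((\<phi> c (x k) - q) * (\<phi> c (x l) - q)) \<le> 1"
      by (auto simp: abs_mult intro!: mult_le_one)
    have "(\<lambda>x. (\<phi> c (x k) - q) * (\<phi> c (x l) - q)) \<in> borel_measurable (torus N)" using that by measurable
    then show "(\<lambda>x. (\<phi> c (x k) - q) * (\<phi> c (x l) - q)) \<in> borel_measurable \<mu>"
      using \<mu>(2) by (simp cong: measurable_cong_sets)
  qed
  let ?Q = "\<lambda>x. \<Sum>k\<in>{1..N}. \<Sum>l\<in>{1..N} - {k}. (\<phi> c (x k) - q) * (\<phi> c (x l) - q)"
  have int': "integrable \<mu> (\<lambda>x. real N + ?Q x)"
    using int by (intro Bochner_Integration.integrable_add Bochner_Integration.integrable_sum \<mu>.integrable_const) auto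
  have "(\<Sum>y\<in>net N. net_law N \<mu> y * (t y)\<^sup>2) = (\<integral>x. (\<Sum>y\<in>net N. weight N y x * (t y)\<^sup>2) \<partial>\<mu>)"
    by (rule net_law_integral[OF \<mu>])
  also have "\<dots> \<le> (\<integral>x. real N + ?Q x \<partial>\<mu>)"
    unfolding t_def using weight_second_moment[OF c q] net_law_integral(2)[OF \<mu>] int'
    by (intro integral_mono) auto
  also have "\<dots> = N + (\<Sum>k\<in>{1..N}. \<Sum>l\<in>{1..N} - {k}. \<integral>x. (\<phi> c (x k) - q) * (\<phi> c (x l) - q) \<partial>\<mu>)"
  proof -
    have inner: "integrable \<mu> (\<lambda>x. \<Sum>l\<in>{1..N} - {k}. (\<phi> c (x k) - q) * (\<phi> c (x l) - q))" if "k \<in> {1..N}" for k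
      using int that by (intro Bochner_Integration.integrable_sum) auto
    have "(\<integral>x. real N + ?Q x \<partial>\<mu>) = N + (\<integral>x. ?Q x \<partial>\<mu>)"
    proof (subst Bochner_Integration.integral_add)
      show "integrable \<mu> ?Q" using inner by (rule Bochner_Integration.integrable_sum)
    qed (simp_all add: \<mu>.prob_space)
    also have "(\<integral>x. ?Q x \<partial>\<mu>) = (\<Sum>k\<in>{1..N}. \<integral>x. (\<Sum>l\<in>{1..N} - {k}. (\<phi> c (x k) - q) * (\<phi> c (x l) - q)) \<partial>\<mu>)"
      using inner by (rule Bochner_Integration.integral_sum)
    also have "\<dots> = (\<Sum>k\<in>{1..N}. \<Sum>l\<in>{1..N} - {k}. \<integral>x. (\<phi> c (x k) - q) * (\<phi> c (x l) - q) \<partial>\<mu>)"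
      using int by (intro sum.cong refl Bochner_Integration.integral_sum) auto
    finally show ?thesis .
  qed
  also have "\<dots> \<le> N + (\<Sum>k\<in>{1..N}. \<Sum>l\<in>{1..N} - {k}. \<eta>)"
    using pair by (intro add_left_mono sum_mono) auto
  \<comment> \<open>The omitted diagonal is put back, which only enlarges the sum since
    \<open>0 \<le> \<eta>\<close>, to reach exactly
    \<open>N\<^sup>2 * (1 / N + \<eta>)\<close>.\<close>
  also have "\<dots> \<le> N + (\<Sum>k\<in>{1..N}. \<Sum>l\<in>{1..N}. \<eta>)"
    using s(3) by (intro add_left_mono sum_mono sum_mono2) auto
  also have "\<dots> = (real N)\<^sup>2 * (1 / N + \<eta>)"
    using N by (simp add: power2_eq_square algebra_simps)
  also have "\<dots> \<le> (real N)\<^sup>2 * s\<^sup>2" using s by (intro mult_left_mono) auto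
  finally have second: "(\<Sum>y\<in>net N. net_law N \<mu> y * (t y)\<^sup>2) \<le> (N * s)\<^sup>2" by (simp add: power_mult_distrib)
  have Ns: "0 < N * s" using N s by simp
  have "(\<Sum>y\<in>net N. net_law N \<mu> y * \<bar>t y\<bar>) \<le> (\<Sum>y\<in>net N. net_law N \<mu> y * (((t y)\<^sup>2 / (N * s) + N * s) / 2))"
  proof (intro sum_mono mult_left_mono net_law_nonneg)
    show "\<bar>t y\<bar> \<le> ((t y)\<^sup>2 / (N * s) + N * s) / 2" for y
      using Ns by (rule abs_le_square_div)
  qed
  also have "\<dots> = ((\<Sum>y\<in>net N. net_law N \<mu> y * (t y)\<^sup>2) / (N * s) + (\<Sum>y\<in>net N. net_law N \<mu> y) * (N * s)) / 2"
    by (simp add: sum_divide_distrib sum_distrib_right distrib_left sum.distrib add_divide_distrib)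
  also have "\<dots> \<le> ((N * s)\<^sup>2 / (N * s) + 1 * (N * s)) / 2"
    using second Ns by (intro divide_right_mono add_mono) (auto simp: net_law_sum[OF \<mu>] divide_right_mono)
  also have "\<dots> = N * s" using Ns by (simp add: power2_eq_square)
  finally show ?thesis by (simp add: t)
qed

text \<open>Draw \<open>y\<close> and \<open>z\<close> independently from the two rounded laws. The
  counts of both concentrate around the same numbers \<open>N * q c\<close>, so \<open>g y\<close>
  and \<open>g z\<close> are close on average: each of the \<open>card C\<close> values contributes
  \<open>s\<close> from either side, and the rounding itself costs \<open>e\<close> for either
  measure.\<close>

lemma symmetric_integral_compare:
  fixes s \<eta> :: real
  assumes \<mu>: "prob_space \<mu>" "sets \<mu> = sets (torus N)"
    and \<nu>: "prob_space \<nu>" "sets \<nu> = sets (torus N)"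
    and g: "coord_lipschitz N g (\<lambda>_. 1 / N)"
    and sym: "\<And>x \<sigma>. x \<in> space (torus N) \<Longrightarrow> \<sigma> permutes {1..N} \<Longrightarrow> g (\<lambda>i\<in>{1..N}. x (\<sigma> i)) = g x"
    and q: "\<And>c. c \<in> C \<Longrightarrow> 0 \<le> q c" "\<And>c. c \<in> C \<Longrightarrow> q c \<le> 1"
    and pair\<mu>: "\<And>c k l. c \<in> C \<Longrightarrow> k \<in> {1..N} \<Longrightarrow> l \<in> {1..N} \<Longrightarrow> k \<noteq> l \<Longrightarrow>
      (\<integral>x. (\<phi> c (x k) - q c) * (\<phi> c (x l) - q c) \<partial>\<mu>) \<le> \<eta>"
    and pair\<nu>: "\<And>c k l. c \<in> C \<Longrightarrow> k \<in> {1..N} \<Longrightarrow> l \<in> {1..N} \<Longrightarrow> k \<noteq> l \<Longrightarrow>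
      (\<integral>x. (\<phi> c (x k) - q c) * (\<phi> c (x l) - q c) \<partial>\<nu>) \<le> \<eta>"
    and s: "0 < s" "1 / N + \<eta> \<le> s\<^sup>2" "0 \<le> \<eta>" and N: "1 \<le> N"
  shows "\<bar>(\<integral>x. g x \<partial>\<mu>) - (\<integral>x. g x \<partial>\<nu>)\<bar> \<le> 2 * e + 2 * s * card C"
proof -
  define U where "U = net_law N \<mu>"
  define V where "V = net_law N \<nu>"
  define t where "t c y = \<bar>real (card {i\<in>{1..N}. y i = c}) - N * q c\<bar>" for c :: circle and y :: "nat \<Rightarrow> circle"
  have U: "(\<Sum>y\<in>net N. U y) = 1" "0 \<le> U y" and V: "(\<Sum>y\<in>net N. V y) = 1" "0 \<le> V y" for y
    by (simp_all add: U_def V_def net_law_nonneg net_law_sum \<mu> \<nu>)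
  have tU: "(\<Sum>y\<in>net N. U y * t c y) \<le> N * s" if "c \<in> C" for c
    unfolding U_def t_def using that q pair\<mu> by (intro net_law_count[OF \<mu> _ _ _ _ s N]) auto
  have tV: "(\<Sum>y\<in>net N. V y * t c y) \<le> N * s" if "c \<in> C" for c
    unfolding V_def t_def using that q pair\<nu> by (intro net_law_count[OF \<nu> _ _ _ _ s N]) auto
  have gyz: "\<bar>g y - g z\<bar> \<le> 1 / N * (\<Sum>c\<in>C. t c y + t c z)" if "y \<in> net N" "z \<in> net N" for y z
  proof -
    have "\<bar>g y - g z\<bar> \<le> 1 / N * (\<Sum>c\<in>C. \<bar>real (card {i\<in>{1..N}. y i = c}) - real (card {i\<in>{1..N}. z i = c})\<bar>)"
    proof (rule symmetric_function_counts[OF _ finite_C])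
      show "g (\<lambda>i\<in>{1..N}. y (\<sigma> i)) = g y" if "y \<in> PiE {1..N} (\<lambda>_. C)" "\<sigma> permutes {1..N}" for y \<sigma>
        using that by (intro sym net_space) (auto simp: net_def)
      show "\<bar>g y - g (y(i := c))\<bar> \<le> 1 / N" if "y \<in> PiE {1..N} (\<lambda>_. C)" "i \<in> {1..N}" for y i c
      proof -
        have "y \<in> space (torus N)" using that by (intro net_space) (simp add: net_def)
        then have "\<bar>g y - g (y(i := c))\<bar> \<le> 1 / N * dist (y i) c" using that by (intro coord_lipschitzD[OF g])
        also have "\<dots> \<le> 1 / N * 1" by (intro mult_left_mono dist_circle_le_1) simp
        finally show ?thesis by simp
      qed
    qed (use that in \<open>auto simp: net_def\<close>)
    also have "\<dots> \<le> 1 / N * (\<Sum>c\<in>C. t c y + t c z)"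
      by (intro mult_left_mono sum_mono) (auto simp: t_def)
    finally show ?thesis .
  qed
  have "(\<Sum>y\<in>net N. U y * g y) - (\<Sum>z\<in>net N. V z * g z) = (\<Sum>y\<in>net N. \<Sum>z\<in>net N. U y * V z * (g y - g z))"
  proof -
    have "(\<Sum>y\<in>net N. \<Sum>z\<in>net N. U y * V z * (g y - g z))
        = (\<Sum>y\<in>net N. U y * g y * (\<Sum>z\<in>net N. V z)) - (\<Sum>y\<in>net N. U y * (\<Sum>z\<in>net N. V z * g z))"
      unfolding sum_distrib_left sum_subtractf[symmetric] by (intro sum.cong refl) (simp add: algebra_simps)
    then show ?thesis using U(1) V(1) by (simp flip: sum_distrib_right)
  qed
  also have "\<bar>\<dots>\<bar> \<le> (\<Sum>y\<in>net N. \<Sum>z\<in>net N. U y * V z * (1 / N * (\<Sum>c\<in>C. t c y + t c z)))"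
  proof (intro sum_abs[THEN order_trans] sum_mono)
    fix y z assume "y \<in> net N" "z \<in> net N"
    then have "U y * V z * \<bar>g y - g z\<bar> \<le> U y * V z * (1 / N * (\<Sum>c\<in>C. t c y + t c z))"
      using U(2) V(2) by (intro mult_left_mono gyz) auto
    then show "\<bar>U y * V z * (g y - g z)\<bar> \<le> U y * V z * (1 / N * (\<Sum>c\<in>C. t c y + t c z))"
      using U(2)[of y] V(2)[of z] by (simp add: abs_mult)
  qed
  \<comment> \<open>Each deviation involves only one of the two independent points; the law of the
    other contributes its total mass 1.\<close>
  also have "\<dots> = (\<Sum>c\<in>C. 1 / N * ((\<Sum>y\<in>net N. U y * t c y) * (\<Sum>z\<in>net N. V z) + (\<Sum>y\<in>net N. U y) * (\<Sum>z\<in>net N. V z * t c z)))"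
  proof -
    have "(\<Sum>y\<in>net N. \<Sum>z\<in>net N. U y * V z * (1 / N * (\<Sum>c\<in>C. t c y + t c z)))
        = (\<Sum>y\<in>net N. \<Sum>z\<in>net N. \<Sum>c\<in>C. 1 / N * (U y * t c y * V z + U y * (V z * t c z)))"
      unfolding sum_distrib_left by (intro sum.cong refl) (simp add: algebra_simps)
    also have "\<dots> = (\<Sum>y\<in>net N. \<Sum>c\<in>C. \<Sum>z\<in>net N. 1 / N * (U y * t c y * V z + U y * (V z * t c z)))"
      by (intro sum.cong refl sum.swap)
    also have "\<dots> = (\<Sum>c\<in>C. \<Sum>y\<in>net N. \<Sum>z\<in>net N. 1 / N * (U y * t c y * V z + U y * (V z * t c z)))"
      by (rule sum.swap)
    also have "\<dots> = (\<Sum>c\<in>C. 1 / N * ((\<Sum>y\<in>net N. U y * t c y) * (\<Sum>z\<in>net N. V z) + (\<Sum>y\<in>net N. U y) * (\<Sum>z\<in>net N. V z * t c z)))"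
      by (unfold sum_product, unfold sum.distrib[symmetric], unfold sum_distrib_left, rule refl)
    finally show ?thesis .
  qed
  also have "\<dots> \<le> (\<Sum>c\<in>C. 1 / N * (N * s + N * s))"
    using tU tV by (intro sum_mono mult_left_mono add_mono) (simp_all add: U V)
  also have "\<dots> = 2 * s * card C" using N by simp
  finally have main: "\<bar>(\<Sum>y\<in>net N. U y * g y) - (\<Sum>z\<in>net N. V z * g z)\<bar> \<le> 2 * s * card C" .
  have "\<bar>(\<Sum>y\<in>net N. U y * g y) - (\<integral>x. g x \<partial>\<mu>)\<bar> \<le> e" "\<bar>(\<Sum>y\<in>net N. V y * g y) - (\<integral>x. g x \<partial>\<nu>)\<bar> \<le> e"
    using net_law_approx[OF \<mu> g] net_law_approx[OF \<nu> g] N by (simp_all add: U_def V_def)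
  then show ?thesis using main by linarith
qed

end

section \<open>The Dobrushin--Wasserstein distance\<close>

text \<open>A real bound with an absolute value and with majorants \<open>L\<close>. As test
  functions may be negated, it expresses the same as
  \<open>dobrushin_wasserstein N \<mu> \<nu> \<le> ereal w\<close>.\<close>

definition wass_le :: "nat \<Rightarrow> real \<Rightarrow> (nat \<Rightarrow> circle) measure \<Rightarrow> (nat \<Rightarrow> circle) measure \<Rightarrow> bool"
  where "wass_le N w \<mu> \<nu> \<longleftrightarrow> (\<forall>g L. coord_lipschitz N g L \<longrightarrow> (\<Sum>i\<in>{1..N}. L i) \<le> 1 \<longrightarrow>
    \<bar>(\<integral>x. g x \<partial>\<mu>) - (\<integral>x. g x \<partial>\<nu>)\<bar> \<le> w)"

lemma coord_lipschitz_scale: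
  "coord_lipschitz N g L \<Longrightarrow> coord_lipschitz N (\<lambda>x. a * g x) (\<lambda>i. \<bar>a\<bar> * L i)"
  by (auto simp: coord_lipschitz_def abs_mult mult_left_mono mult.assoc simp flip: right_diff_distrib)

text \<open>\<open>K\<close> may exceed the sum of the constants, since that sum can vanish and the
  rescaling divides by \<open>K\<close>. Hence the summand 1 in scales such as
  \<open>2 * M + 1\<close>.\<close>

lemma wass_le_scale:
  assumes w: "wass_le N w \<mu> \<nu>" and g: "coord_lipschitz N g L" and K: "(\<Sum>i\<in>{1..N}. L i) \<le> K" "0 < K"
  shows "\<bar>(\<integral>x. g x \<partial>\<mu>) - (\<integral>x. g x \<partial>\<nu>)\<bar> \<le> K * w"
proof -
  have "(\<Sum>i\<in>{1..N}. \<bar>1 / K\<bar> * L i) \<le> 1"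
    using K by (simp add: field_simps flip: sum_divide_distrib)
  then have "\<bar>(\<integral>x. 1 / K * g x \<partial>\<mu>) - (\<integral>x. 1 / K * g x \<partial>\<nu>)\<bar> \<le> w"
    using w coord_lipschitz_scale[OF g, of "1 / K"] unfolding wass_le_def by blast
  then show ?thesis
    using K by (simp add: field_simps flip: diff_divide_distrib)
qed

lemma Lip_total_le:
  assumes g: "coord_lipschitz N g L"
  shows "Lip_total N g \<le> ereal (\<Sum>i\<in>{1..N}. L i)"
proof -
  have "Lip_coord N i g \<le> ereal (L i)" if "i \<in> {1..N}" for i
    unfolding Lip_coord_def
  proof (intro SUP_least)
    fix x s assume "x \<in> space (torus N)" "s \<in> {s. s \<noteq> x i}"
    then show "ereal (\<bar>g x - g (x(i := s))\<bar> / dist (x i) s) \<le> ereal (L i)"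
      using coord_lipschitzD(2)[OF g that, of x s] by (simp add: divide_le_eq zero_less_dist_iff)
  qed
  then have "Lip_total N g \<le> (\<Sum>i\<in>{1..N}. ereal (L i))"
    unfolding Lip_total_def by (intro sum_mono)
  then show ?thesis by simp
qed

text \<open>All coordinate constants are nonnegative, so a total of at most 1 makes every one of
  them finite, and they may be read as reals.\<close>

lemma Lip_total_le_1:
  assumes "Lip_total N g \<le> 1"
  obtains L where "coord_lipschitz N g L" "(\<Sum>i\<in>{1..N}. L i) \<le> 1"
proof
  define L where "L i = real_of_ereal (Lip_coord N i g)" for i
  have upper: "ereal (\<bar>g x - g (x(i := s))\<bar> / dist (x i) s) \<le> Lip_coord N i g"
    if "x \<in> space (torus N)" "s \<noteq> x i" for x i s
    unfolding Lip_coord_def using that by (intro SUP_upper2[of x] SUP_upper2[of s]) auto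
  have nonneg: "0 \<le> Lip_coord N i g" for i
  proof -
    define x :: "nat \<Rightarrow> circle" where "x = (\<lambda>i\<in>{1..N}. undefined)"
    \<comment> \<open>Without a second point the supremum would range over the empty set and be
      \<open>-\<infinity>\<close>.\<close>
    obtain s where "s \<noteq> x i" using circle_two_points by metis
    moreover have "x \<in> space (torus N)" by (simp add: x_def space_PiM)
    ultimately have "ereal (\<bar>g x - g (x(i := s))\<bar> / dist (x i) s) \<le> Lip_coord N i g" by (rule upper[rotated])
    moreover have "(0::ereal) \<le> ereal (\<bar>g x - g (x(i := s))\<bar> / dist (x i) s)" by simp
    ultimately show ?thesis by (rule order_trans[rotated])
  qed
  have le1: "Lip_coord N i g \<le> 1" if "i \<in> {1..N}" for i
  proof -
    have "Lip_coord N i g \<le> Lip_total N g"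
      unfolding Lip_total_def using sum_mono2[of "{1..N}" "{i}" "\<lambda>i. Lip_coord N i g"] nonneg that by simp
    then show ?thesis using assms by (rule order_trans)
  qed
  have L: "ereal (L i) = Lip_coord N i g" if "i \<in> {1..N}" for i
    unfolding L_def using le1[OF that] nonneg[of i] by (intro ereal_real') (auto simp: one_ereal_def)
  have "ereal (\<Sum>i\<in>{1..N}. L i) = (\<Sum>i\<in>{1..N}. ereal (L i))" by simp
  also have "\<dots> = Lip_total N g"
    unfolding Lip_total_def by (intro sum.cong refl L)
  finally have "ereal (\<Sum>i\<in>{1..N}. L i) \<le> 1" using assms by simp
  then show "(\<Sum>i\<in>{1..N}. L i) \<le> 1" by (simp only: one_ereal_def ereal_less_eq)
  show "coord_lipschitz N g L"
    unfolding coord_lipschitz_def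
  proof (intro ballI conjI allI)
    fix i assume i: "i \<in> {1..N}"
    show "0 \<le> L i" using nonneg[of i] by (simp add: L_def real_of_ereal_pos)
    fix x s assume x: "x \<in> space (torus N)"
    show "\<bar>g x - g (x(i := s))\<bar> \<le> L i * dist (x i) s"
    proof (cases "s = x i")
      case False
      then have "ereal (\<bar>g x - g (x(i := s))\<bar> / dist (x i) s) \<le> ereal (L i)"
        using upper[OF x False] L[OF i] by simp
      then show ?thesis using False by (simp add: divide_le_eq zero_less_dist_iff split: if_splits)
    qed simp
  qed
qed

text \<open>Witnessed by the zero function, for arbitrary measures; it is applied at every index
  \<open>N\<close>, including those below 2, where nothing is known about the family.\<close>

lemma dobrushin_wasserstein_nonneg: "0 \<le> dobrushin_wasserstein N \<mu> \<nu>"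
proof -
  have "coord_lipschitz N (\<lambda>_. 0) (\<lambda>_. 0)" by (simp add: coord_lipschitz_def)
  then have "Lip_total N (\<lambda>_. 0) \<le> 0"
    using Lip_total_le[of N "\<lambda>_. 0" "\<lambda>_. 0"] by (simp add: zero_ereal_def)
  then have "Lip_total N (\<lambda>_. 0) \<le> 1" by (rule order_trans) simp
  then show ?thesis
    unfolding dobrushin_wasserstein_def by (intro SUP_upper2[of "\<lambda>_. 0"]) auto
qed

lemma dobrushin_wasserstein_le:
  assumes "wass_le N w \<mu> \<nu>"
  shows "dobrushin_wasserstein N \<mu> \<nu> \<le> ereal w"
  unfolding dobrushin_wasserstein_def
proof (rule SUP_least)
  fix g assume "g \<in> {g. Lip_total N g \<le> 1}"
  then obtain L where "coord_lipschitz N g L" "(\<Sum>i\<in>{1..N}. L i) \<le> 1"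
    using Lip_total_le_1 by blast
  then have "\<bar>(\<integral>x. g x \<partial>\<mu>) - (\<integral>x. g x \<partial>\<nu>)\<bar> \<le> w" using assms unfolding wass_le_def by blast
  then show "ereal ((\<integral>x. g x \<partial>\<mu>) - (\<integral>x. g x \<partial>\<nu>)) \<le> ereal w" by simp
qed

lemma wass_leI:
  assumes "dobrushin_wasserstein N \<mu> \<nu> \<le> ereal w"
  shows "wass_le N w \<mu> \<nu>"
  unfolding wass_le_def
proof (intro allI impI)
  fix g L assume g: "coord_lipschitz N g L" "(\<Sum>i\<in>{1..N}. L i) \<le> 1"
  have *: "(\<integral>x. g x \<partial>\<mu>) - (\<integral>x. g x \<partial>\<nu>) \<le> w"
    if g: "coord_lipschitz N g L" "(\<Sum>i\<in>{1..N}. L i) \<le> 1" for g L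
  proof -
    have "Lip_total N g \<le> ereal (\<Sum>i\<in>{1..N}. L i)" by (rule Lip_total_le[OF g(1)])
    also have "\<dots> \<le> 1" using g(2) by (simp add: one_ereal_def)
    finally have "ereal ((\<integral>x. g x \<partial>\<mu>) - (\<integral>x. g x \<partial>\<nu>)) \<le> dobrushin_wasserstein N \<mu> \<nu>"
      unfolding dobrushin_wasserstein_def by (intro SUP_upper) simp
    then have "ereal ((\<integral>x. g x \<partial>\<mu>) - (\<integral>x. g x \<partial>\<nu>)) \<le> ereal w" using assms by (rule order_trans)
    then show ?thesis by simp
  qed
  show "\<bar>(\<integral>x. g x \<partial>\<mu>) - (\<integral>x. g x \<partial>\<nu>)\<bar> \<le> w"
    using *[OF g] *[of "\<lambda>x. - g x" L] coord_lipschitz_scale[OF g(1), of "-1"] g(2) by simp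
qed

section \<open>Product measures and chaos of pairs\<close>

lemma prob_measuresD:
  assumes "\<mu> \<in> prob_measures M"
  shows "prob_space \<mu>" "sets \<mu> = sets M"
  using assms by (auto simp: prob_measures_def)

lemma measure_power_prob_measures:
  assumes "\<nu> \<in> prob_measures (borel :: circle measure)"
  shows "measure_power \<nu> N \<in> prob_measures (torus N)"
  unfolding prob_measures_def measure_power_def
  using prob_measuresD[OF assms] by (auto intro!: prob_space_PiM sets_PiM_cong)

lemma marginal1_prob_measures:
  assumes "\<mu> \<in> prob_measures (torus N)" "1 \<le> N"
  shows "marginal1 \<mu> \<in> prob_measures borel"
proof -
  have "(\<lambda>x. x 1) \<in> measurable (torus N) (borel :: circle measure)"
    using assms(2) by (intro measurable_component_singleton) simp
  then have "(\<lambda>x. x 1) \<in> measurable \<mu> (borel :: circle measure)"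
    using prob_measuresD(2)[OF assms(1)] by (simp cong: measurable_cong_sets)
  then show ?thesis
    unfolding marginal1_def prob_measures_def
    using prob_space.prob_space_distr[OF prob_measuresD(1)[OF assms(1)]] by simp
qed

text \<open>Fubini with coordinate \<open>l\<close> innermost. This is the form of independence by
  which off-diagonal covariances vanish.\<close>

lemma measure_power_integral_coord:
  fixes G :: "(nat \<Rightarrow> circle) \<Rightarrow> real"
  assumes \<nu>: "\<nu> \<in> prob_measures borel" and l: "l \<in> {1..N}"
    and G: "G \<in> borel_measurable (torus N)" and B: "\<And>x. x \<in> space (torus N) \<Longrightarrow> \<bar>G x\<bar> \<le> B"
    and zero: "\<And>x. x \<in> space (torus N) \<Longrightarrow> (\<integral>s. G (x(l := s)) \<partial>\<nu>) = 0"
  shows "(\<integral>x. G x \<partial>measure_power \<nu> N) = 0"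
proof -
  note \<nu>' = prob_measuresD[OF \<nu>]
  have pr: "product_prob_space (\<lambda>_::nat. \<nu>)" by (intro product_prob_spaceI \<nu>')
  have sets: "sets (PiM {1..N} (\<lambda>_. \<nu>)) = sets (torus N)" by (intro sets_PiM_cong) (simp_all add: \<nu>')
  then have sp: "space (PiM {1..N} (\<lambda>_. \<nu>)) = space (torus N)" by (rule sets_eq_imp_space_eq)
  have sp': "space \<nu> = UNIV" using sets_eq_imp_space_eq[OF \<nu>'(2)] by simp
  have "(\<integral>x. G x \<partial>PiM {1..N} (\<lambda>_. \<nu>)) = (\<integral>x. (\<integral>s. G (x(l := s)) \<partial>\<nu>) \<partial>PiM ({1..N} - {l}) (\<lambda>_. \<nu>))"
    using G B l sets
    by (intro product_prob_space.integral_PiM_insert(1)[OF pr, where B = B]) (auto simp: sp cong: measurable_cong_sets)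
  also have "\<dots> = (\<integral>x. 0 \<partial>PiM ({1..N} - {l}) (\<lambda>_. \<nu>))"
  proof (rule Bochner_Integration.integral_cong[OF refl])
    fix x assume "x \<in> space (PiM ({1..N} - {l}) (\<lambda>_. \<nu>))"
    then have "x(l := undefined) \<in> space (torus N)"
      using l sp' by (auto simp: space_PiM PiE_def extensional_def)
    from zero[OF this] show "(\<integral>s. G (x(l := s)) \<partial>\<nu>) = 0" by simp
  qed
  finally show ?thesis by (simp add: measure_power_def)
qed

lemma exchangeable_measure_power:
  assumes "\<nu> \<in> prob_measures borel"
  shows "exchangeable N (measure_power \<nu> N)"
  unfolding exchangeable_def
proof (intro allI impI)
  note \<nu> = prob_measuresD[OF assms]
  fix \<sigma> :: "nat \<Rightarrow> nat" and g :: "(nat \<Rightarrow> circle) \<Rightarrow> real"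
  assume \<sigma>: "\<sigma> permutes {1..N}" and g: "g \<in> borel_measurable (torus N) \<and> bounded (g ` space (torus N))"
  let ?P = "PiM {1..N} (\<lambda>_. \<nu>)"
  have sets: "sets ?P = sets (torus N)" by (intro sets_PiM_cong) (simp_all add: \<nu>)
  have d: "distr ?P ?P (\<lambda>x. \<lambda>i\<in>{1..N}. x (\<sigma> i)) = ?P"
    using permutes_inj_on[OF \<sigma>] permutes_in_image[OF \<sigma>] \<nu>(1)
    by (intro distr_PiM_reindex[where M = "\<lambda>_. \<nu>" and K = "{1..N}" and I = "{1..N}" and f = \<sigma>]) auto
  have meas: "(\<lambda>x. \<lambda>i\<in>{1..N}. x (\<sigma> i)) \<in> measurable ?P ?P"
    using permutes_in_image[OF \<sigma>] by (intro measurable_restrict measurable_component_singleton) auto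
  have "g \<in> borel_measurable ?P" using g sets by (simp cong: measurable_cong_sets)
  then have "(\<integral>x. g x \<partial>distr ?P ?P (\<lambda>x. \<lambda>i\<in>{1..N}. x (\<sigma> i))) = (\<integral>x. g (\<lambda>i\<in>{1..N}. x (\<sigma> i)) \<partial>?P)"
    using meas by (intro integral_distr)
  then show "(\<integral>x. g x \<partial>measure_power \<nu> N) = (\<integral>x. g (\<lambda>i\<in>{1..N}. x (\<sigma> i)) \<partial>measure_power \<nu> N)"
    by (simp add: d measure_power_def)
qed

lemma exchangeable_pair:
  fixes F :: "circle \<Rightarrow> circle \<Rightarrow> real"
  assumes \<mu>: "\<mu> \<in> prob_measures (torus N)" "exchangeable N \<mu>"
    and kl: "k \<in> {1..N}" "l \<in> {1..N}" "k \<noteq> l"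
    and F: "(\<lambda>(a, b). F a b) \<in> borel_measurable (borel \<Otimes>\<^sub>M borel)" and B: "\<And>a b. \<bar>F a b\<bar> \<le> B"
  shows "(\<integral>x. F (x k) (x l) \<partial>\<mu>) = (\<integral>y. F (y 1) (y 2) \<partial>marginal 2 \<mu>)"
proof -
  have N: "2 \<le> N" using kl by auto
  \<comment> \<open>The aim is a permutation with \<open>1 \<mapsto> k\<close> and
    \<open>2 \<mapsto> l\<close>. First 2 is exchanged with the preimage \<open>l'\<close> of
    \<open>l\<close> under the swap of 1 and \<open>k\<close>; as \<open>l' \<noteq> 1\<close>, this
    leaves 1 in place for the second swap.\<close>
  define l' where "l' = Transposition.transpose 1 k l"
  have l': "l' \<in> {1..N}" "l' \<noteq> 1" using kl by (auto simp: l'_def Transposition.transpose_def)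
  define \<sigma> where "\<sigma> = Transposition.transpose 1 k \<circ> Transposition.transpose 2 l'"
  have \<sigma>: "\<sigma> permutes {1..N}"
    unfolding \<sigma>_def using kl l' N by (intro permutes_compose permutes_swap_id) auto
  have \<sigma>12: "\<sigma> 1 = k" "\<sigma> 2 = l"
    using transpose_apply_other[of 1 2 l'] l'(2) by (simp_all add: \<sigma>_def) (simp add: l'_def)
  define g where "g x = F (x 1) (x 2)" for x :: "nat \<Rightarrow> circle"
  have pr: "(\<lambda>x. (x 1, x 2)) \<in> measurable (torus M) (borel \<Otimes>\<^sub>M borel)" if "2 \<le> M" for M
    using that by (intro measurable_Pair measurable_component_singleton) auto
  have g: "g \<in> borel_measurable (torus M)" if "2 \<le> M" for M
    using measurable_compose[OF pr[OF that] F] by (simp add: g_def[abs_def])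
  have "bounded (g ` space (torus N))" using B by (auto simp: bounded_iff g_def)
  then have "(\<integral>x. g x \<partial>\<mu>) = (\<integral>x. g (\<lambda>i\<in>{1..N}. x (\<sigma> i)) \<partial>\<mu>)"
    using \<mu>(2) \<sigma> g[OF N] unfolding exchangeable_def by blast
  also have "\<dots> = (\<integral>x. F (x k) (x l) \<partial>\<mu>)"
    using N by (simp add: g_def \<sigma>12)
  finally have 1: "(\<integral>x. F (x k) (x l) \<partial>\<mu>) = (\<integral>x. g x \<partial>\<mu>)" by simp
  have "(\<lambda>x. restrict x {1..2}) \<in> measurable (torus N) (torus 2)"
    using N by (intro measurable_restrict_subset) auto
  then have "(\<lambda>x. restrict x {1..2}) \<in> measurable \<mu> (torus 2)"
    using prob_measuresD(2)[OF \<mu>(1)] by (simp cong: measurable_cong_sets)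
  then have "(\<integral>y. g y \<partial>marginal 2 \<mu>) = (\<integral>x. g (restrict x {1..2}) \<partial>\<mu>)"
    unfolding marginal_def using g[of 2] by (intro integral_distr) auto
  also have "\<dots> = (\<integral>x. g x \<partial>\<mu>)" by (simp add: g_def)
  finally show ?thesis using 1 by (simp add: g_def)
qed

text \<open>The product of the centred \<open>\<phi> c\<close> at two coordinates is Lipschitz with
  constant \<open>M\<close> in each, the other factor being bounded by 1, so it is a test function
  up to scale. Under the product measure its mean is zero, and exchangeability carries the estimate
  from the pair 1, 2 to every pair.\<close>

lemma (in circle_partition) pair_chaos:
  assumes \<nu>: "\<nu> \<in> prob_measures borel" and \<mu>: "\<mu> \<in> prob_measures (torus N)" "exchangeable N \<mu>"
    and w: "wass_le 2 w (marginal 2 \<mu>) (measure_power \<nu> 2)"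
    and c: "c \<in> C" and kl: "k \<in> {1..N}" "l \<in> {1..N}" "k \<noteq> l"
    and q: "q = (\<integral>x. \<phi> c x \<partial>\<nu>)"
  shows "(\<integral>x. (\<phi> c (x k) - q) * (\<phi> c (x l) - q) \<partial>\<mu>) \<le> (2 * M + 1) * w"
    and "(\<integral>x. (\<phi> c (x k) - q) * (\<phi> c (x l) - q) \<partial>measure_power \<nu> N) = 0"
    and "0 \<le> q" "q \<le> 1"
proof -
  note \<nu>' = prob_measuresD[OF \<nu>]
  interpret \<nu>: prob_space \<nu> by (rule \<nu>')
  have [measurable]: "\<phi> c \<in> borel_measurable borel" using c by (rule \<phi>_measurable)
  have [measurable]: "\<phi> c \<in> borel_measurable \<nu>" using \<nu>'(2) by (simp cong: measurable_cong_sets)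
  have int: "integrable \<nu> (\<phi> c)"
    using \<phi>_nonneg \<phi>_le_1[OF c] by (intro \<nu>.integrable_const_bound[of _ 1]) auto
  show q01: "0 \<le> q" "q \<le> 1"
    unfolding q using \<phi>_nonneg int \<phi>_le_1[OF c] \<nu>.prob_space
      integral_mono[of \<nu> "\<phi> c" "\<lambda>_. 1"] by auto
  have bd: "\<bar>\<phi> c z - q\<bar> \<le> 1" for z
    using \<phi>_nonneg[of c z] \<phi>_le_1[OF c, of z] q01 by simp
  have bd2: "\<bar>(\<phi> c a - q) * (\<phi> c b - q)\<bar> \<le> 1" for a b
    using bd by (simp add: abs_mult mult_le_one)
  have zero: "(\<integral>x. (\<phi> c (x k) - q) * (\<phi> c (x l) - q) \<partial>measure_power \<nu> N) = 0"
    if "k \<in> {1..N}" "l \<in> {1..N}" "k \<noteq> l" for k l N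
  proof (rule measure_power_integral_coord[OF \<nu> that(2), where B = 1])
    show "(\<lambda>x. (\<phi> c (x k) - q) * (\<phi> c (x l) - q)) \<in> borel_measurable (torus N)" using that by measurable
    show "(\<integral>s. (\<phi> c ((x(l := s)) k) - q) * (\<phi> c ((x(l := s)) l) - q) \<partial>\<nu>) = 0" for x
      using that(3) int \<nu>.prob_space by (simp add: q)
  qed (rule bd2)
  then show "(\<integral>x. (\<phi> c (x k) - q) * (\<phi> c (x l) - q) \<partial>measure_power \<nu> N) = 0" using kl .
  have set2: "{1..2::nat} = {1, 2}" by auto
  have "coord_lipschitz 2 (\<lambda>y. (\<phi> c (y 1) - q) * (\<phi> c (y 2) - q)) (\<lambda>_. M)"
    unfolding coord_lipschitz_def
  proof (intro ballI conjI allI M_nonneg)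
    fix i :: nat and x s assume i: "i \<in> {1..2}"
    have *: "\<bar>(\<phi> c a - q) * r - (\<phi> c b - q) * r\<bar> \<le> M * dist a b" if "\<bar>r\<bar> \<le> 1" for a b r
    proof -
      have "\<bar>(\<phi> c a - q) * r - (\<phi> c b - q) * r\<bar> = \<bar>\<phi> c a - \<phi> c b\<bar> * \<bar>r\<bar>"
        by (simp add: abs_mult flip: left_diff_distrib)
      also have "\<dots> \<le> (M * dist a b) * 1"
        using \<phi>_lipschitz[OF c, of a b] that M_nonneg by (intro mult_mono) auto
      finally show ?thesis by simp
    qed
    show "\<bar>(\<phi> c (x 1) - q) * (\<phi> c (x 2) - q) - (\<phi> c ((x(i := s)) 1) - q) * (\<phi> c ((x(i := s)) 2) - q)\<bar>
        \<le> M * dist (x i) s"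
      using i *[OF bd, of "x 1" "x 2" s] *[OF bd, of "x 2" "x 1" s] unfolding set2 by (auto simp: mult.commute)
  qed
  then have "\<bar>(\<integral>y. (\<phi> c (y 1) - q) * (\<phi> c (y 2) - q) \<partial>marginal 2 \<mu>)
      - (\<integral>y. (\<phi> c (y 1) - q) * (\<phi> c (y 2) - q) \<partial>measure_power \<nu> 2)\<bar> \<le> (2 * M + 1) * w"
    using M_nonneg by (intro wass_le_scale[OF w]) (auto simp: set2)
  moreover have "(\<integral>y. (\<phi> c (y 1) - q) * (\<phi> c (y 2) - q) \<partial>measure_power \<nu> 2) = 0"
    by (rule zero) auto
  moreover have "(\<integral>x. (\<phi> c (x k) - q) * (\<phi> c (x l) - q) \<partial>\<mu>)
      = (\<integral>y. (\<phi> c (y 1) - q) * (\<phi> c (y 2) - q) \<partial>marginal 2 \<mu>)"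
    by (rule exchangeable_pair[OF \<mu> kl, of "\<lambda>a b. (\<phi> c a - q) * (\<phi> c b - q)" 1, OF _ bd2]) measurable
  ultimately show "(\<integral>x. (\<phi> c (x k) - q) * (\<phi> c (x l) - q) \<partial>\<mu>) \<le> (2 * M + 1) * w" by simp
qed

text \<open>The net, and with it \<open>card C\<close> and \<open>M\<close>, is fixed by
  \<open>\<epsilon>\<close> before \<open>N\<close> grows. The frequencies \<open>q c\<close> do
  depend on \<open>N\<close>, but every bound is uniform in them.\<close>

lemma pair_chaos_imp_full_chaos:
  assumes \<mu>: "\<And>N. 2 \<le> N \<Longrightarrow> \<mu> N \<in> prob_measures (torus N)" "\<And>N. 2 \<le> N \<Longrightarrow> exchangeable N (\<mu> N)"
    and chaos: "(\<lambda>N. dobrushin_wasserstein 2 (marginal 2 (\<mu> N)) (measure_power (marginal1 (\<mu> N)) 2)) \<longlonglongrightarrow> 0"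
    and \<epsilon>: "0 < \<epsilon>"
  shows "\<forall>\<^sub>F N in sequentially. wass_le N \<epsilon> (\<mu> N) (measure_power (marginal1 (\<mu> N)) N)"
proof -
  obtain C \<phi> M where "circle_partition C \<phi> M (\<epsilon> / 4)"
    using circle_partition_exists[of "\<epsilon> / 4"] \<epsilon> by auto
  then interpret circle_partition C \<phi> M "\<epsilon> / 4" .
  \<comment> \<open>The mesh \<open>\<epsilon> / 4\<close> uses up half of
    \<open>\<epsilon>\<close>; this \<open>s\<close> keeps the fluctuation term
    \<open>2 * s * card C\<close> below the other half, the \<open>+ 1\<close> guarding the
    division.\<close>
  define s where "s = \<epsilon> / (4 * (card C + 1))"
  have s: "0 < s" using \<epsilon> by (simp add: s_def)
  \<comment> \<open>One half of \<open>s\<^sup>2\<close> is left to the pair correlations, the other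
    to the diagonal term \<open>1 / N\<close>.\<close>
  define w where "w = s\<^sup>2 / 2 / (2 * M + 1)"
  have M: "0 < 2 * M + 1" using M_nonneg by simp
  then have w: "0 < w" using s unfolding w_def by (intro divide_pos_pos) auto
  have w_eq: "(2 * M + 1) * w = s\<^sup>2 / 2"
  proof -
    have "K * (x / K) = x" if "0 < K" for K x :: real using that by simp
    from this[OF M] show ?thesis unfolding w_def .
  qed
  have "\<forall>\<^sub>F N in sequentially. dobrushin_wasserstein 2 (marginal 2 (\<mu> N)) (measure_power (marginal1 (\<mu> N)) 2) < ereal w"
    using order_tendstoD(2)[OF chaos, of "ereal w"] w by simp
  moreover have "\<forall>\<^sub>F N in sequentially. 1 / real N < s\<^sup>2 / 2"
    using order_tendstoD(2)[OF lim_1_over_n, of "s\<^sup>2 / 2"] s by simp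
  ultimately show ?thesis
    using eventually_ge_at_top[of 2]
  proof eventually_elim
    case (elim N)
    define \<nu> where "\<nu> = marginal1 (\<mu> N)"
    have N: "2 \<le> N" "1 \<le> N" using elim by auto
    note \<mu>N = \<mu>(1)[OF N(1)] \<mu>(2)[OF N(1)]
    have \<nu>: "\<nu> \<in> prob_measures borel" unfolding \<nu>_def by (rule marginal1_prob_measures[OF \<mu>N(1) N(2)])
    have W: "wass_le 2 w (marginal 2 (\<mu> N)) (measure_power \<nu> 2)"
      using elim by (intro wass_leI) (simp add: \<nu>_def)
    define q where "q c = (\<integral>x. \<phi> c x \<partial>\<nu>)" for c
    note pc = pair_chaos[OF \<nu> \<mu>N W _ _ _ _ refl, folded q_def]
    show "wass_le N \<epsilon> (\<mu> N) (measure_power \<nu> N)"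
      unfolding wass_le_def
    proof (intro allI impI)
      fix g L assume g: "coord_lipschitz N g L" "(\<Sum>i\<in>{1..N}. L i) \<le> 1"
      from coord_lipschitz_symmetrize[OF g N(2)] obtain gs where gs:
        "coord_lipschitz N gs (\<lambda>_. 1 / N)"
        "\<And>x \<sigma>. x \<in> space (torus N) \<Longrightarrow> \<sigma> permutes {1..N} \<Longrightarrow> gs (\<lambda>i\<in>{1..N}. x (\<sigma> i)) = gs x"
        "\<And>\<mu>. prob_space \<mu> \<Longrightarrow> sets \<mu> = sets (torus N) \<Longrightarrow> exchangeable N \<mu> \<Longrightarrow>
          (\<integral>x. gs x \<partial>\<mu>) = (\<integral>x. g x \<partial>\<mu>)" by metis
      note pm = prob_measuresD[OF \<mu>N(1)] prob_measuresD[OF measure_power_prob_measures[OF \<nu>], of N]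
      have "\<bar>(\<integral>x. gs x \<partial>\<mu> N) - (\<integral>x. gs x \<partial>measure_power \<nu> N)\<bar> \<le> 2 * (\<epsilon> / 4) + 2 * s * card C"
      proof (rule symmetric_integral_compare[OF pm gs(1,2), where q = q and \<eta> = "s\<^sup>2 / 2"])
        fix c assume c: "c \<in> C"
        have "(1::nat) \<in> {1..N}" "(2::nat) \<in> {1..N}" "(1::nat) \<noteq> 2" using N by auto
        from pc(3,4)[OF c this] show "0 \<le> q c" "q c \<le> 1" .
        fix k l assume kl: "k \<in> {1..N}" "l \<in> {1..N}" "k \<noteq> l"
        show "(\<integral>x. (\<phi> c (x k) - q c) * (\<phi> c (x l) - q c) \<partial>\<mu> N) \<le> s\<^sup>2 / 2"
          using pc(1)[OF c kl] w_eq by simp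
        show "(\<integral>x. (\<phi> c (x k) - q c) * (\<phi> c (x l) - q c) \<partial>measure_power \<nu> N) \<le> s\<^sup>2 / 2"
          using pc(2)[OF c kl] by simp
      qed (use elim s N in auto)
      also have "\<dots> \<le> 2 * (\<epsilon> / 4) + 2 * s * (card C + 1)"
        using s by (intro add_left_mono mult_left_mono) auto
      also have "2 * s * (card C + 1) = \<epsilon> / 2" by (simp add: s_def field_simps)
      also have "2 * (\<epsilon> / 4) + \<epsilon> / 2 = \<epsilon>" by simp
      finally show "\<bar>(\<integral>x. g x \<partial>\<mu> N) - (\<integral>x. g x \<partial>measure_power \<nu> N)\<bar> \<le> \<epsilon>"
        using gs(3)[OF pm(1,2) \<mu>N(2)] gs(3)[OF pm(3,4) exchangeable_measure_power[OF \<nu>]] by simp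
    qed
  qed
qed

section \<open>Contraction along the dynamics\<close>

lemma sum_of_bool_mult:
  fixes a :: real and N :: nat
  assumes "j \<in> {1..N}"
  shows "(\<Sum>i\<in>{1..N}. of_bool (i = j) * a) = a"
proof -
  have "(\<Sum>i\<in>{1..N}. of_bool (i = j) * a) = (\<Sum>i\<in>{1..N}. if i = j then a else 0)"
    by (intro sum.cong) auto
  then show ?thesis using assms by simp
qed

text \<open>\<open>\<Lambda>\<close> and \<open>H\<close> are strictly positive majorants, so that
  they can serve as scales in divisions.\<close>

locale mean_field = circle_noise +
  fixes f :: "circle \<Rightarrow> real" and h :: "circle \<times> circle \<Rightarrow> real"
    and c lf l1 l2 \<Lambda> H :: real
  assumes f_lip: "\<bar>f u - f u'\<bar> \<le> lf * dist u u'"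
    and h_lip1: "\<bar>h (u, v) - h (u', v)\<bar> \<le> l1 * dist u u'"
    and h_lip2: "\<bar>h (u, v) - h (u, v')\<bar> \<le> l2 * dist v v'"
    and f_measurable [measurable]: "f \<in> borel_measurable borel"
    and h_measurable [measurable]: "h \<in> borel_measurable (borel \<Otimes>\<^sub>M borel)"
    and lip_nonneg: "0 \<le> lf" "0 \<le> l1" "0 \<le> l2"
    and \<Lambda>: "lf + l1 + l2 \<le> \<Lambda>" "0 < \<Lambda>"
    and H: "\<bar>h (u, v)\<bar> \<le> H" "0 < H"
    and c: "0 \<le> c" "c < 1" "\<And>x. x \<in> {0..1} \<Longrightarrow> c < p x"
    and contraction: "(1 - c) * \<Lambda> < 1"
begin

section \<open>The particle drift, its mean-field limit and the two operators\<close>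

definition drift :: "nat \<Rightarrow> nat \<Rightarrow> (nat \<Rightarrow> circle) \<Rightarrow> real"
  where "drift N j u = f (u j) + (1 / real N) * (\<Sum>k\<in>{1..N}. h (u j, u k))"

definition mean :: "circle measure \<Rightarrow> circle \<Rightarrow> real"
  where "mean \<nu> u = (\<integral>v. h (u, v) \<partial>\<nu>)"

definition limit_drift :: "circle measure \<Rightarrow> nat \<Rightarrow> (nat \<Rightarrow> circle) \<Rightarrow> real"
  where "limit_drift \<nu> j u = f (u j) + mean \<nu> (u j)"

lemma h_pair_measurable [measurable]:
  "j \<in> {1..N} \<Longrightarrow> k \<in> {1..N} \<Longrightarrow> (\<lambda>u. h (u j, u k)) \<in> borel_measurable (torus N)"
  by measurable

lemma drift_measurable [measurable]: "j \<in> {1..N} \<Longrightarrow> drift N j \<in> borel_measurable (torus N)"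
  unfolding drift_def[abs_def] by measurable

lemma h_integrable:
  assumes "\<nu> \<in> prob_measures borel"
  shows "integrable \<nu> (\<lambda>v. h (u, v))"
proof (rule finite_measure.integrable_const_bound[where B = H])
  show "finite_measure \<nu>" using prob_measuresD(1)[OF assms] by (rule prob_space.finite_measure)
  have "(\<lambda>v. h (u, v)) \<in> borel_measurable borel" by measurable
  then show "(\<lambda>v. h (u, v)) \<in> borel_measurable \<nu>"
    using prob_measuresD(2)[OF assms] by (simp cong: measurable_cong_sets)
qed (simp add: H)

lemma mean_bound:
  assumes "\<nu> \<in> prob_measures borel"
  shows "\<bar>mean \<nu> u\<bar> \<le> H"
proof -
  interpret prob_space \<nu> by (rule prob_measuresD[OF assms])
  have "\<bar>mean \<nu> u\<bar> \<le> (\<integral>v. \<bar>h (u, v)\<bar> \<partial>\<nu>)" unfolding mean_def by (rule integral_abs_bound)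
  also have "\<dots> \<le> (\<integral>v. H \<partial>\<nu>)" using h_integrable[OF assms] H by (intro integral_mono) auto
  finally show ?thesis by (simp add: prob_space)
qed

lemma mean_measurable:
  assumes "\<nu> \<in> prob_measures borel"
  shows "mean \<nu> \<in> borel_measurable borel"
proof -
  note [measurable_cong] = prob_measuresD(2)[OF assms]
  interpret prob_space \<nu> by (rule prob_measuresD[OF assms])
  show ?thesis unfolding mean_def[abs_def] by measurable
qed

lemma limit_drift_measurable:
  assumes "\<nu> \<in> prob_measures borel" and j: "j \<in> {1..N}"
  shows "limit_drift \<nu> j \<in> borel_measurable (torus N)"
proof -
  note [measurable] = mean_measurable[OF assms(1)]
  have [measurable]: "(\<lambda>u. u j) \<in> measurable (torus N) borel" using j by (rule measurable_component_singleton)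
  show ?thesis unfolding limit_drift_def[abs_def] by measurable
qed

lemma particle_transfer_eq: "particle_transfer p f h N \<mu> = transfer N (drift N) \<mu>"
  unfolding particle_transfer_def transfer_def drift_def by (simp only: diff_diff_eq)

lemma particle_transfer_prob_measures:
  assumes "\<mu> \<in> prob_measures (torus N)"
  shows "particle_transfer p f h N \<mu> \<in> prob_measures (torus N)"
  using prob_space_transfer[OF prob_measuresD[OF assms] drift_measurable]
  by (simp add: particle_transfer_eq prob_measures_def)

lemma limit_kernel_measurable:
  assumes \<nu>: "\<nu> \<in> prob_measures borel"
  shows "(\<lambda>(x, u). ennreal (p (circle_rep x - (f u + mean \<nu> u)))) \<in> borel_measurable (circle_lebesgue \<Otimes>\<^sub>M \<nu>)"
proof -
  note [measurable_cong] = prob_measuresD(2)[OF \<nu>]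
  note [measurable] = mean_measurable[OF \<nu>]
  show ?thesis by measurable
qed

lemma self_consistent_transfer_eq:
  "self_consistent_transfer p f h \<nu> =
    density circle_lebesgue (\<lambda>x. \<integral>\<^sup>+u. ennreal (p (circle_rep x - (f u + mean \<nu> u))) \<partial>\<nu>)"
  unfolding self_consistent_transfer_def mean_def by (simp only: diff_diff_eq)

lemma self_consistent_transfer_prob_measures:
  assumes \<nu>: "\<nu> \<in> prob_measures borel"
  shows "self_consistent_transfer p f h \<nu> \<in> prob_measures borel"
proof -
  interpret \<nu>: prob_space \<nu> by (rule prob_measuresD[OF \<nu>])
  interpret L: prob_space circle_lebesgue by (rule prob_space_circle_lebesgue)
  interpret pair_sigma_finite circle_lebesgue \<nu> ..
  let ?k = "\<lambda>x u. ennreal (p (circle_rep x - (f u + mean \<nu> u)))"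
  note k = limit_kernel_measurable[OF \<nu>]
  have "(\<lambda>x. \<integral>\<^sup>+u. ?k x u \<partial>\<nu>) \<in> borel_measurable circle_lebesgue"
    using \<nu>.borel_measurable_nn_integral[OF k] by simp
  then have "emeasure (self_consistent_transfer p f h \<nu>) UNIV = (\<integral>\<^sup>+x. (\<integral>\<^sup>+u. ?k x u \<partial>\<nu>) \<partial>circle_lebesgue)"
    unfolding self_consistent_transfer_eq using emeasure_density[of _ circle_lebesgue UNIV] by simp
  also have "\<dots> = (\<integral>\<^sup>+u. (\<integral>\<^sup>+x. ?k x u \<partial>circle_lebesgue) \<partial>\<nu>)"
    by (rule Fubini'[OF k, symmetric])
  also have "\<dots> = 1" by (simp add: nn_integral_p \<nu>.emeasure_space_1)
  finally have "prob_space (self_consistent_transfer p f h \<nu>)"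
    by (intro prob_spaceI) (simp add: self_consistent_transfer_eq)
  then show ?thesis by (simp add: prob_measures_def self_consistent_transfer_eq)
qed

text \<open>The limit drift of coordinate \<open>j\<close> reads only that coordinate, so under a
  product law the integral of the product of the kernels factorizes. Thus on a product measure the
  two dynamics differ in the drift alone.\<close>

lemma measure_power_self_consistent:
  assumes \<nu>: "\<nu> \<in> prob_measures borel"
  shows "measure_power (self_consistent_transfer p f h \<nu>) N = transfer N (limit_drift \<nu>) (measure_power \<nu> N)"
proof -
  interpret \<nu>: prob_space \<nu> by (rule prob_measuresD[OF \<nu>])
  interpret L: prob_space circle_lebesgue by (rule prob_space_circle_lebesgue)
  interpret P: product_sigma_finite "\<lambda>_::nat. \<nu>"
    by (simp add: product_sigma_finite_def \<nu>.sigma_finite_measure_axioms)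
  let ?k = "\<lambda>x u. ennreal (p (circle_rep x - (f u + mean \<nu> u)))"
  let ?d = "\<lambda>x. \<integral>\<^sup>+u. ?k x u \<partial>\<nu>"
  have d: "?d \<in> borel_measurable circle_lebesgue"
    using \<nu>.borel_measurable_nn_integral[OF limit_kernel_measurable[OF \<nu>]] by simp
  have "measure_power (self_consistent_transfer p f h \<nu>) N = density (torus_lebesgue N) (\<lambda>x. \<Prod>j\<in>{1..N}. ?d (x j))"
    unfolding measure_power_def self_consistent_transfer_eq
    using d prob_measuresD(1)[OF self_consistent_transfer_prob_measures[OF \<nu>]]
    by (intro PiM_density prob_space_imp_sigma_finite L.prob_space_axioms) (simp_all add: self_consistent_transfer_eq)
  also have "(\<lambda>x. \<Prod>j\<in>{1..N}. ?d (x j))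
      = (\<lambda>x. \<integral>\<^sup>+u. ennreal (\<Prod>j\<in>{1..N}. p (circle_rep (x j) - limit_drift \<nu> j u)) \<partial>measure_power \<nu> N)"
  proof
    fix x :: "nat \<Rightarrow> circle"
    note [measurable] = mean_measurable[OF \<nu>]
    have "?k y \<in> borel_measurable borel" for y by measurable
    then have "?k y \<in> borel_measurable \<nu>" for y
      using prob_measuresD(2)[OF \<nu>] by (simp cong: measurable_cong_sets)
    then have "(\<integral>\<^sup>+u. (\<Prod>j\<in>{1..N}. ?k (x j) (u j)) \<partial>PiM {1..N} (\<lambda>_. \<nu>)) = (\<Prod>j\<in>{1..N}. ?d (x j))"
      by (intro P.product_nn_integral_prod) auto
    then show "(\<Prod>j\<in>{1..N}. ?d (x j))
      = (\<integral>\<^sup>+u. ennreal (\<Prod>j\<in>{1..N}. p (circle_rep (x j) - limit_drift \<nu> j u)) \<partial>measure_power \<nu> N)"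
      by (simp add: measure_power_def limit_drift_def prod_ennreal p_nonneg)
  qed
  finally show ?thesis by (simp add: transfer_def)
qed

text \<open>Coordinate \<open>i\<close> enters drift \<open>j\<close> through \<open>f\<close> and
  the first slot of \<open>h\<close> only if \<open>i = j\<close>, and through the second slot in
  the single summand \<open>k = i\<close>, which carries the weight \<open>1 / N\<close>.\<close>

lemma drift_update:
  assumes "i \<in> {1..N}"
  shows "\<bar>drift N j x - drift N j (x(i := s))\<bar> \<le> (of_bool (i = j) * (lf + l1) + l2 / N) * dist (x i) s"
proof -
  let ?y = "x(i := s)" and ?d = "dist (x i) s"
  have N: "0 < N" using assms by auto
  have hk: "\<bar>h (x j, x k) - h (?y j, ?y k)\<bar> \<le> (of_bool (i = j) * l1 + of_bool (k = i) * l2) * ?d" for k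
  proof -
    have "\<bar>h (x j, x k) - h (?y j, x k)\<bar> \<le> of_bool (i = j) * l1 * ?d"
      using h_lip1[of "x j" "x k" "?y j"] by auto
    moreover have "\<bar>h (?y j, x k) - h (?y j, ?y k)\<bar> \<le> of_bool (k = i) * l2 * ?d"
      using h_lip2[of "?y j" "x k" "?y k"] by auto
    ultimately show ?thesis by (simp add: distrib_right)
  qed
  have "\<bar>drift N j x - drift N j ?y\<bar>
      = \<bar>(f (x j) - f (?y j)) + 1 / N * (\<Sum>k\<in>{1..N}. h (x j, x k) - h (?y j, ?y k))\<bar>"
    by (simp add: drift_def sum_subtractf right_diff_distrib)
  also have "\<dots> \<le> \<bar>f (x j) - f (?y j)\<bar> + 1 / N * (\<Sum>k\<in>{1..N}. \<bar>h (x j, x k) - h (?y j, ?y k)\<bar>)"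
    by (intro abs_triangle_ineq[THEN order_trans] add_left_mono) (simp add: abs_mult divide_right_mono sum_abs)
  also have "\<dots> \<le> of_bool (i = j) * lf * ?d
      + 1 / N * (\<Sum>k\<in>{1..N}. (of_bool (i = j) * l1 + of_bool (k = i) * l2) * ?d)"
    using f_lip[of "x j" "?y j"] by (intro add_mono mult_left_mono sum_mono hk) auto
  also have "(\<Sum>k\<in>{1..N}. (of_bool (i = j) * l1 + of_bool (k = i) * l2) * ?d) = (N * (of_bool (i = j) * l1) + l2) * ?d"
  proof -
    have "(\<Sum>k\<in>{1..N}. of_bool (k = i) * l2) = l2"
      using assms by (rule sum_of_bool_mult)
    then show ?thesis by (simp add: sum.distrib flip: sum_distrib_right)
  qed
  also have "of_bool (i = j) * lf * ?d + 1 / N * ((N * (of_bool (i = j) * l1) + l2) * ?d)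
      = (of_bool (i = j) * (lf + l1) + l2 / N) * ?d"
    using N by (simp add: field_simps)
  finally show ?thesis .
qed

text \<open>A law of large numbers in mean: given \<open>u j\<close>, the deviations
  \<open>Z k\<close> with \<open>k \<noteq> j\<close> are independent and centred. Only the diagonal
  of the second moment survives, so the sum is of order \<open>sqrt N\<close>.\<close>

lemma drift_deviation:
  assumes \<nu>: "\<nu> \<in> prob_measures borel" and j: "j \<in> {1..N}"
  shows "(\<integral>u. \<bar>drift N j u - limit_drift \<nu> j u\<bar> \<partial>measure_power \<nu> N) \<le> 2 * H / sqrt N"
    and "integrable (measure_power \<nu> N) (\<lambda>u. \<bar>drift N j u - limit_drift \<nu> j u\<bar>)"
proof -
  let ?P = "measure_power \<nu> N"
  note pm = prob_measuresD[OF measure_power_prob_measures[OF \<nu>], of N]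
  interpret \<nu>: prob_space \<nu> by (rule prob_measuresD[OF \<nu>])
  interpret P: prob_space ?P by (rule pm)
  have N: "0 < real N" using j by auto
  define Z where "Z k u = h (u j, u k) - mean \<nu> (u j)" for k u
  have Z_meas: "Z k \<in> borel_measurable (torus N)" if "k \<in> {1..N}" for k
  proof -
    note [measurable] = mean_measurable[OF \<nu>]
    have [measurable]: "(\<lambda>u. u j) \<in> measurable (torus N) borel" using j by (rule measurable_component_singleton)
    have [measurable]: "(\<lambda>u. h (u j, u k)) \<in> borel_measurable (torus N)" using j that by (rule h_pair_measurable)
    show ?thesis unfolding Z_def[abs_def] by measurable
  qed
  have Z_bd: "\<bar>Z k u\<bar> \<le> 2 * H" for k u
    using H(1)[of "u j" "u k"] mean_bound[OF \<nu>, of "u j"] by (simp add: Z_def)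
  have ZZ_bd: "\<bar>Z k u * Z l u\<bar> \<le> (2 * H)\<^sup>2" for k l u
    unfolding abs_mult power2_eq_square using H(2) by (intro mult_mono Z_bd) auto
  have ZZ_int: "integrable ?P (\<lambda>u. Z k u * Z l u)" if "k \<in> {1..N}" "l \<in> {1..N}" for k l
  proof (rule P.integrable_const_bound[of _ "(2 * H)\<^sup>2"])
    have "(\<lambda>u. Z k u * Z l u) \<in> borel_measurable (torus N)" using Z_meas that by (intro borel_measurable_times)
    then show "(\<lambda>u. Z k u * Z l u) \<in> borel_measurable ?P" using pm(2) by (simp cong: measurable_cong_sets)
  qed (use ZZ_bd in auto)
  have indep: "(\<integral>u. Z k u * Z l u \<partial>?P) = 0" if "k \<in> {1..N}" "l \<in> {1..N}" "k \<noteq> l" "l \<noteq> j" for k l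
  proof (rule measure_power_integral_coord[OF \<nu> that(2), where B = "(2 * H)\<^sup>2"])
    show "(\<lambda>u. Z k u * Z l u) \<in> borel_measurable (torus N)" using Z_meas that by (intro borel_measurable_times)
    show "(\<integral>s. Z k (x(l := s)) * Z l (x(l := s)) \<partial>\<nu>) = 0" for x
      using that h_integrable[OF \<nu>] \<nu>.prob_space by (simp add: Z_def mean_def)
  qed (rule ZZ_bd)
  \<comment> \<open>The self-interaction \<open>Z j\<close> need not be centred given
    \<open>u j\<close>. As \<open>k \<noteq> l\<close>, at least one index differs from
    \<open>j\<close>, and that coordinate is integrated out.\<close>
  have cross: "(\<integral>u. Z k u * Z l u \<partial>?P) = 0" if "k \<in> {1..N}" "l \<in> {1..N}" "k \<noteq> l" for k l
  proof (cases "l = j")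
    case True
    then have "(\<integral>u. Z l u * Z k u \<partial>?P) = 0" using that by (intro indep) auto
    then show ?thesis by (simp add: mult.commute)
  qed (use that indep in blast)
  define S where "S u = (\<Sum>k\<in>{1..N}. Z k u)" for u
  have dev: "drift N j u - limit_drift \<nu> j u = S u / N" for u
    using N by (simp add: drift_def limit_drift_def S_def Z_def sum_subtractf field_simps)
  have S_meas: "S \<in> borel_measurable ?P"
    unfolding S_def[abs_def] using Z_meas pm(2) by (intro borel_measurable_sum) (simp cong: measurable_cong_sets)
  have S_bd: "\<bar>S u\<bar> \<le> N * (2 * H)" for u
    unfolding S_def using sum_mono[of "{1..N}" "\<lambda>k. \<bar>Z k u\<bar>" "\<lambda>_. 2 * H"] Z_bd
    by (intro sum_abs[THEN order_trans]) simp
  have S_int: "integrable ?P S"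
    using S_meas S_bd by (intro P.integrable_const_bound[of _ "N * (2 * H)"]) auto
  then show "integrable ?P (\<lambda>u. \<bar>drift N j u - limit_drift \<nu> j u\<bar>)" unfolding dev by simp
  have S2: "(S u)\<^sup>2 = (\<Sum>k\<in>{1..N}. \<Sum>l\<in>{1..N}. Z k u * Z l u)" for u
    unfolding S_def power2_eq_square by (rule sum_product)
  have S2_int: "integrable ?P (\<lambda>u. (S u)\<^sup>2)"
    unfolding S2 using ZZ_int by (intro Bochner_Integration.integrable_sum) auto
  have "(\<integral>u. (S u)\<^sup>2 \<partial>?P) = (\<Sum>k\<in>{1..N}. \<Sum>l\<in>{1..N}. \<integral>u. Z k u * Z l u \<partial>?P)"
    unfolding S2 using ZZ_int
    by (subst Bochner_Integration.integral_sum, intro Bochner_Integration.integrable_sum, blast)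
      (intro sum.cong refl Bochner_Integration.integral_sum, blast)
  also have "\<dots> = (\<Sum>k\<in>{1..N}. \<Sum>l\<in>{1..N}. if l = k then \<integral>u. Z k u * Z k u \<partial>?P else 0)"
    using cross by (intro sum.cong refl) auto
  also have "\<dots> = (\<Sum>k\<in>{1..N}. \<integral>u. Z k u * Z k u \<partial>?P)" by simp
  also have "\<dots> \<le> (\<Sum>k\<in>{1..N}. \<integral>u. (2 * H)\<^sup>2 \<partial>?P)"
    using ZZ_int ZZ_bd by (intro sum_mono integral_mono) (auto simp: abs_le_iff)
  also have "\<dots> = N * (2 * H)\<^sup>2" by (simp add: P.prob_space)
  finally have var: "(\<integral>u. (S u)\<^sup>2 \<partial>?P) \<le> N * (2 * H)\<^sup>2" .
  \<comment> \<open>The square root of the bound on the second moment, which is the best parameter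
    in \<open>abs_le_square_div\<close>.\<close>
  define r where "r = 2 * H * sqrt N"
  have r: "0 < r" using N H by (simp add: r_def)
  have r2: "r\<^sup>2 = N * (2 * H)\<^sup>2" using N by (simp add: r_def power_mult_distrib)
  have "(\<integral>u. \<bar>S u\<bar> \<partial>?P) \<le> (\<integral>u. ((S u)\<^sup>2 / r + r) / 2 \<partial>?P)"
    using S_int S2_int abs_le_square_div[OF r] by (intro integral_mono) auto
  also have "\<dots> = ((\<integral>u. (S u)\<^sup>2 \<partial>?P) / r + r) / 2"
    using S2_int by (simp add: P.prob_space)
  also have "\<dots> \<le> (r\<^sup>2 / r + r) / 2"
    using var r unfolding r2 by (intro divide_right_mono add_right_mono) auto
  also have "\<dots> = r" using r by (simp add: power2_eq_square)
  finally have "(\<integral>u. \<bar>S u\<bar> \<partial>?P) \<le> r" .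
  then have "(\<integral>u. \<bar>S u\<bar> \<partial>?P) / N \<le> r / N" using N by (intro divide_right_mono) auto
  also have "r / N = 2 * H / sqrt N"
    using N by (simp add: r_def divide_eq_eq) (simp add: field_simps)
  finally show "(\<integral>u. \<bar>drift N j u - limit_drift \<nu> j u\<bar> \<partial>?P) \<le> 2 * H / sqrt N"
    unfolding dev by (simp add: abs_divide)
qed

text \<open>Two comparisons: the particle operator at \<open>\<mu>\<close> and at the product
  measure, by the assumed distance, and then, at the product measure, the particle drift and the
  limit drift, by \<open>drift_deviation\<close>. With \<open>G\<close> averaged over the noise,
  both concern functions of the previous state.\<close>

lemma one_step:
  assumes \<nu>: "\<nu> \<in> prob_measures borel" and \<mu>: "\<mu> \<in> prob_measures (torus N)" and N: "1 \<le> N"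
    and w: "wass_le N w \<mu> (measure_power \<nu> N)"
    and G: "shift_bound N G C" and K: "(\<Sum>j\<in>{1..N}. C j) \<le> K" "0 < K"
  shows "\<bar>(\<integral>x. G x \<partial>particle_transfer p f h N \<mu>) -
      (\<integral>x. G x \<partial>measure_power (self_consistent_transfer p f h \<nu>) N)\<bar>
    \<le> K * (\<Lambda> * w + 2 * H / sqrt N)"
proof -
  let ?P = "measure_power \<nu> N"
  note pm = prob_measuresD[OF measure_power_prob_measures[OF \<nu>], of N]
  interpret P: prob_space ?P by (rule pm)
  obtain B where B: "\<And>x. x \<in> space (torus N) \<Longrightarrow> \<bar>G x\<bar> \<le> B" and G_meas: "G \<in> borel_measurable (torus N)"
    using G unfolding shift_bound_def by blast
  have C0: "0 \<le> C j" if "j \<in> {1..N}" for j using G that unfolding shift_bound_def by blast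
  define \<Psi> where "\<Psi> F u = (\<integral>x. G x \<partial>noise_prod N (\<lambda>j. F j u))" for F :: "nat \<Rightarrow> (nat \<Rightarrow> circle) \<Rightarrow> real" and u
  have I1: "(\<integral>x. G x \<partial>particle_transfer p f h N \<mu>) = (\<integral>u. \<Psi> (drift N) u \<partial>\<mu>)"
    unfolding particle_transfer_eq \<Psi>_def
    by (rule integral_transfer(1)[OF prob_measuresD[OF \<mu>] drift_measurable G_meas B])
  have I2: "(\<integral>x. G x \<partial>measure_power (self_consistent_transfer p f h \<nu>) N) = (\<integral>u. \<Psi> (limit_drift \<nu>) u \<partial>?P)"
    unfolding measure_power_self_consistent[OF \<nu>] \<Psi>_def
    by (rule integral_transfer(1)[OF pm limit_drift_measurable[OF \<nu>] G_meas B])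
  define L where "L i = (\<Sum>j\<in>{1..N}. C j * (of_bool (i = j) * (lf + l1) + l2 / N))" for i
  have lip: "coord_lipschitz N (\<Psi> (drift N)) L"
    unfolding coord_lipschitz_def
  proof (intro ballI conjI allI)
    fix i assume i: "i \<in> {1..N}"
    show "0 \<le> L i" unfolding L_def using C0 lip_nonneg by (intro sum_nonneg mult_nonneg_nonneg) auto
    fix x s
    have "\<bar>\<Psi> (drift N) x - \<Psi> (drift N) (x(i := s))\<bar> \<le> (\<Sum>j\<in>{1..N}. C j * \<bar>drift N j x - drift N j (x(i := s))\<bar>)"
      unfolding \<Psi>_def by (rule noise_prod_lipschitz[OF G])
    also have "\<dots> \<le> (\<Sum>j\<in>{1..N}. C j * ((of_bool (i = j) * (lf + l1) + l2 / N) * dist (x i) s))"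
      by (intro sum_mono mult_left_mono drift_update i C0)
    also have "\<dots> = L i * dist (x i) s" by (simp add: L_def sum_distrib_right mult.assoc)
    finally show "\<bar>\<Psi> (drift N) x - \<Psi> (drift N) (x(i := s))\<bar> \<le> L i * dist (x i) s" .
  qed
  \<comment> \<open>Summing over \<open>i\<close> first leaves, for each \<open>j\<close>, the total
    sensitivity \<open>lf + l1 + l2\<close> of one drift, whatever \<open>N\<close> is.\<close>
  have "(\<Sum>i\<in>{1..N}. L i) = (\<Sum>j\<in>{1..N}. \<Sum>i\<in>{1..N}. C j * (of_bool (i = j) * (lf + l1) + l2 / N))"
    unfolding L_def by (rule sum.swap)
  also have "\<dots> = (\<Sum>j\<in>{1..N}. C j * (lf + l1 + l2))"
  proof (rule sum.cong[OF refl])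
    fix j assume "j \<in> {1..N}"
    then have "(\<Sum>i\<in>{1..N}. of_bool (i = j) * (lf + l1)) = lf + l1" by (rule sum_of_bool_mult)
    then show "(\<Sum>i\<in>{1..N}. C j * (of_bool (i = j) * (lf + l1) + l2 / N)) = C j * (lf + l1 + l2)"
      using N by (simp add: sum.distrib flip: sum_distrib_left)
  qed
  also have "\<dots> = (\<Sum>j\<in>{1..N}. C j) * (lf + l1 + l2)" by (simp add: sum_distrib_right)
  also have "\<dots> \<le> K * \<Lambda>" using K \<Lambda> lip_nonneg by (intro mult_mono) auto
  finally have sumL: "(\<Sum>i\<in>{1..N}. L i) \<le> K * \<Lambda>" .
  have first: "\<bar>(\<integral>u. \<Psi> (drift N) u \<partial>\<mu>) - (\<integral>u. \<Psi> (drift N) u \<partial>?P)\<bar> \<le> K * \<Lambda> * w"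
    using K \<Lambda> by (intro wass_le_scale[OF w lip sumL]) simp
  have int1: "integrable ?P (\<Psi> (drift N))" by (rule coord_lipschitz_integrable[OF lip pm])
  have int2: "integrable ?P (\<Psi> (limit_drift \<nu>))"
  proof (rule P.integrable_const_bound[of _ B])
    show "\<Psi> (limit_drift \<nu>) \<in> borel_measurable ?P"
      unfolding \<Psi>_def[abs_def] by (rule integral_transfer(2)[OF pm limit_drift_measurable[OF \<nu>] G_meas B])
    have "\<bar>\<Psi> F u\<bar> \<le> B" for F u
    proof -
      interpret Q: prob_space "noise_prod N (\<lambda>j. F j u)" by (rule prob_space_noise_prod)
      have "integrable (noise_prod N (\<lambda>j. F j u)) G"
        using G_meas B by (intro Q.integrable_const_bound[of _ B]) auto
      then have "\<bar>\<Psi> F u\<bar> \<le> (\<integral>x. B \<partial>noise_prod N (\<lambda>j. F j u))"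
        unfolding \<Psi>_def using B by (intro integral_abs_bound[THEN order_trans] integral_mono) auto
      then show ?thesis using Q.prob_space by simp
    qed
    then show "AE u in ?P. norm (\<Psi> (limit_drift \<nu>) u) \<le> B" by simp
  qed
  have "\<bar>(\<integral>u. \<Psi> (drift N) u \<partial>?P) - (\<integral>u. \<Psi> (limit_drift \<nu>) u \<partial>?P)\<bar>
      = \<bar>\<integral>u. \<Psi> (drift N) u - \<Psi> (limit_drift \<nu>) u \<partial>?P\<bar>"
    using int1 int2 by simp
  also have "\<dots> \<le> (\<integral>u. \<bar>\<Psi> (drift N) u - \<Psi> (limit_drift \<nu>) u\<bar> \<partial>?P)" by (rule integral_abs_bound)
  also have "\<dots> \<le> (\<integral>u. (\<Sum>j\<in>{1..N}. C j * \<bar>drift N j u - limit_drift \<nu> j u\<bar>) \<partial>?P)"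
    using int1 int2 drift_deviation(2)[OF \<nu>] noise_prod_lipschitz[OF G] unfolding \<Psi>_def
    by (intro integral_mono Bochner_Integration.integrable_sum integrable_mult_right) auto
  also have "\<dots> = (\<Sum>j\<in>{1..N}. C j * (\<integral>u. \<bar>drift N j u - limit_drift \<nu> j u\<bar> \<partial>?P))"
    using drift_deviation(2)[OF \<nu>] by (subst Bochner_Integration.integral_sum) auto
  also have "\<dots> \<le> (\<Sum>j\<in>{1..N}. C j * (2 * H / sqrt N))"
    by (intro sum_mono mult_left_mono drift_deviation(1)[OF \<nu>] C0)
  also have "\<dots> = (\<Sum>j\<in>{1..N}. C j) * (2 * H / sqrt N)" by (rule sum_distrib_right[symmetric])
  also have "\<dots> \<le> K * (2 * H / sqrt N)" using K H by (intro mult_right_mono) auto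
  finally show ?thesis using first unfolding I1 I2 by (simp add: algebra_simps)
qed

text \<open>Freezing all coordinates but one leaves a Lipschitz function on the circle, to which
  \<open>noise_contraction\<close> applies.\<close>

lemma shift_bound_lipschitz:
  assumes g: "coord_lipschitz N g L"
  shows "shift_bound N g (\<lambda>i. (1 - c) * L i)"
  unfolding shift_bound_def
proof (intro conjI ballI allI)
  show "g \<in> borel_measurable (torus N)" by (rule coord_lipschitz_measurable[OF g])
  show "\<exists>B. \<forall>x\<in>space (torus N). \<bar>g x\<bar> \<le> B" using coord_lipschitz_bounded[OF g] by metis
  fix j assume j: "j \<in> {1..N}"
  show "0 \<le> (1 - c) * L j" using coord_lipschitzD(1)[OF g j] c by simp
  fix x a b assume x: "x \<in> space (torus N)"
  show "\<bar>(\<integral>s. g (x(j := s)) \<partial>noise a) - (\<integral>s. g (x(j := s)) \<partial>noise b)\<bar> \<le> (1 - c) * L j * \<bar>a - b\<bar>"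
  proof (rule noise_contraction)
    fix s t
    have "x(j := s) \<in> space (torus N)" using x j by (auto simp: space_PiM PiE_def extensional_def)
    from coord_lipschitzD(2)[OF g j this, of t]
    show "\<bar>g (x(j := s)) - g (x(j := t))\<bar> \<le> L j * dist s t" by simp
  qed (use c in auto)
qed

lemma wass_step:
  assumes \<nu>: "\<nu> \<in> prob_measures borel" and \<mu>: "\<mu> \<in> prob_measures (torus N)" and N: "1 \<le> N"
    and w: "wass_le N w \<mu> (measure_power \<nu> N)"
  shows "wass_le N ((1 - c) * (\<Lambda> * w + 2 * H / sqrt N))
    (particle_transfer p f h N \<mu>) (measure_power (self_consistent_transfer p f h \<nu>) N)"
  unfolding wass_le_def
proof (intro allI impI)
  fix g L assume g: "coord_lipschitz N g L" "(\<Sum>i\<in>{1..N}. L i) \<le> 1"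
  have "(\<Sum>j\<in>{1..N}. (1 - c) * L j) \<le> 1 - c"
    using g(2) c mult_left_mono[of "\<Sum>i\<in>{1..N}. L i" 1 "1 - c"] by (simp add: sum_distrib_left)
  then show "\<bar>(\<integral>x. g x \<partial>particle_transfer p f h N \<mu>)
      - (\<integral>x. g x \<partial>measure_power (self_consistent_transfer p f h \<nu>) N)\<bar> \<le> (1 - c) * (\<Lambda> * w + 2 * H / sqrt N)"
    using c by (intro one_step[OF \<nu> \<mu> N w shift_bound_lipschitz[OF g(1)]]) auto
qed

lemma wass_le_mono: "wass_le N w \<mu> \<nu> \<Longrightarrow> w \<le> w' \<Longrightarrow> wass_le N w' \<mu> \<nu>"
  unfolding wass_le_def by (meson order_trans)

lemma iterates_prob_measures:
  assumes "\<nu> \<in> prob_measures borel" "\<mu> \<in> prob_measures (torus N)"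
  shows "(self_consistent_transfer p f h ^^ n) \<nu> \<in> prob_measures borel"
    and "(particle_transfer p f h N ^^ n) \<mu> \<in> prob_measures (torus N)"
  using assms by (induction n) (auto intro: self_consistent_transfer_prob_measures particle_transfer_prob_measures)

text \<open>The fixed point of the affine map that \<open>wass_step\<close> applies to the distance,
  that is, the geometric series of the errors committed at each step.\<close>

definition error :: "nat \<Rightarrow> real"
  where "error N = (1 - c) * (2 * H / sqrt N) / (1 - (1 - c) * \<Lambda>)"

text \<open>The bound \<open>\<epsilon> + error N\<close> is invariant under the affine contraction of \<open>wass_step\<close>.\<close>

lemma wass_iterate:
  assumes \<nu>: "\<nu> \<in> prob_measures borel" and \<mu>: "\<mu> \<in> prob_measures (torus N)" and N: "1 \<le> N"
    and w: "wass_le N \<epsilon> \<mu> (measure_power \<nu> N)" and \<epsilon>: "0 \<le> \<epsilon>"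
  shows "wass_le N (\<epsilon> + error N) ((particle_transfer p f h N ^^ n) \<mu>)
    (measure_power ((self_consistent_transfer p f h ^^ n) \<nu>) N)"
proof (induction n)
  case 0
  have "0 \<le> error N" using c contraction H by (simp add: error_def)
  then show ?case using wass_le_mono[OF w] by simp
next
  case (Suc n)
  have "(1 - c) * (\<Lambda> * (\<epsilon> + error N) + 2 * H / sqrt N) = (1 - c) * \<Lambda> * \<epsilon> + error N"
  proof -
    have "(1 - c) * (2 * H / sqrt N) = error N * (1 - (1 - c) * \<Lambda>)"
      using contraction by (simp add: error_def)
    then show ?thesis by (simp add: algebra_simps)
  qed
  also have "\<dots> \<le> 1 * \<epsilon> + error N"
    using contraction \<epsilon> by (intro add_right_mono mult_right_mono) auto
  finally have "(1 - c) * (\<Lambda> * (\<epsilon> + error N) + 2 * H / sqrt N) \<le> \<epsilon> + error N" by simp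
  from wass_le_mono[OF wass_step[OF iterates_prob_measures[OF \<nu> \<mu>] N Suc.IH] this]
  show ?case by simp
qed

section \<open>Marginals and total variation\<close>

lemma marginal_measure_power:
  assumes \<nu>: "\<nu> \<in> prob_measures borel" and k: "k \<le> N"
  shows "marginal k (measure_power \<nu> N) = measure_power \<nu> k"
proof -
  interpret product_prob_space "\<lambda>_::nat. \<nu>" "{}"
    by (intro product_prob_spaceI prob_measuresD[OF \<nu>])
  have "measure_power \<nu> k = distr (PiM {1..N} (\<lambda>_. \<nu>)) (PiM {1..k} (\<lambda>_. \<nu>)) (\<lambda>x. restrict x {1..k})"
    unfolding measure_power_def using k by (intro distr_restrict) auto
  also have "\<dots> = marginal k (measure_power \<nu> N)"
    unfolding marginal_def measure_power_def using prob_measuresD(2)[OF \<nu>]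
    by (intro distr_cong refl sets_PiM_cong) simp_all
  finally show ?thesis ..
qed

lemma integral_marginal:
  fixes \<phi> :: "(nat \<Rightarrow> circle) \<Rightarrow> real"
  assumes \<mu>: "\<mu> \<in> prob_measures (torus N)" and k: "k \<le> N" and \<phi>: "\<phi> \<in> borel_measurable (torus k)"
  shows "(\<integral>y. \<phi> y \<partial>marginal k \<mu>) = (\<integral>x. \<phi> (restrict x {1..k}) \<partial>\<mu>)"
proof -
  have "(\<lambda>x. restrict x {1..k}) \<in> measurable (torus N) (torus k)"
    using k by (intro measurable_restrict_subset) auto
  then have "(\<lambda>x. restrict x {1..k}) \<in> measurable \<mu> (torus k)"
    using prob_measuresD(2)[OF \<mu>] by (simp cong: measurable_cong_sets)
  then show ?thesis unfolding marginal_def using \<phi> by (intro integral_distr)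
qed

lemma marginal_prob_measures:
  assumes \<mu>: "\<mu> \<in> prob_measures (torus N)" and k: "k \<le> N"
  shows "marginal k \<mu> \<in> prob_measures (torus k)"
proof -
  have "(\<lambda>x. restrict x {1..k}) \<in> measurable (torus N) (torus k)"
    using k by (intro measurable_restrict_subset) auto
  then have "(\<lambda>x. restrict x {1..k}) \<in> measurable \<mu> (torus k)"
    using prob_measuresD(2)[OF \<mu>] by (simp cong: measurable_cong_sets)
  then show ?thesis
    unfolding prob_measures_def marginal_def
    using prob_space.prob_space_distr[OF prob_measuresD(1)[OF \<mu>]] by simp
qed

text \<open>Coordinates beyond \<open>k\<close> are invisible to the test function and receive the
  constant 0, so the constants sum to \<open>k * V\<close>, whatever \<open>N\<close> is.\<close>

lemma shift_bound_marginal: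
  assumes V: "0 \<le> V" "\<And>\<phi> a b. \<phi> \<in> borel_measurable borel \<Longrightarrow> (\<And>x. \<bar>\<phi> x\<bar> \<le> 1) \<Longrightarrow>
      \<bar>(\<integral>x. \<phi> x \<partial>noise a) - (\<integral>x. \<phi> x \<partial>noise b)\<bar> \<le> V * \<bar>a - b\<bar>"
    and k: "k \<le> N" and \<phi>: "\<phi> \<in> borel_measurable (torus k)" and bd: "\<And>y. \<bar>\<phi> y\<bar> \<le> 1"
  shows "shift_bound N (\<lambda>x. \<phi> (restrict x {1..k})) (\<lambda>j. of_bool (j \<le> k) * V)"
  unfolding shift_bound_def
proof (intro conjI ballI allI)
  have "(\<lambda>x. restrict x {1..k}) \<in> measurable (torus N) (torus k)"
    using k by (intro measurable_restrict_subset) auto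
  then show meas: "(\<lambda>x. \<phi> (restrict x {1..k})) \<in> borel_measurable (torus N)"
    using \<phi> by (rule measurable_compose)
  show "\<exists>B. \<forall>x\<in>space (torus N). \<bar>\<phi> (restrict x {1..k})\<bar> \<le> B" using bd by blast
  fix j assume j: "j \<in> {1..N}"
  show "0 \<le> of_bool (j \<le> k) * V" using V by simp
  fix x a b assume x: "x \<in> space (torus N)"
  show "\<bar>(\<integral>s. \<phi> (restrict (x(j := s)) {1..k}) \<partial>noise a) - (\<integral>s. \<phi> (restrict (x(j := s)) {1..k}) \<partial>noise b)\<bar>
      \<le> of_bool (j \<le> k) * V * \<bar>a - b\<bar>"
  proof (cases "j \<le> k")
    case True
    have "(\<lambda>s. x(j := s)) \<in> measurable borel (torus N)"
      using x j by (intro measurable_fun_upd[where J = "{1..N}"]) auto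
    from measurable_compose[OF this meas]
    have "\<bar>(\<integral>s. \<phi> (restrict (x(j := s)) {1..k}) \<partial>noise a) - (\<integral>s. \<phi> (restrict (x(j := s)) {1..k}) \<partial>noise b)\<bar> \<le> V * \<bar>a - b\<bar>"
      using bd by (intro V(2))
    then show ?thesis using True by simp
  next
    case False
    then have "restrict (x(j := s)) {1..k} = restrict x {1..k}" for s by (auto simp: restrict_def)
    then show ?thesis using prob_space.prob_space[OF prob_space_noise] False by simp
  qed
qed

text \<open>For a given partition the test function is the sign of \<open>\<mu> - \<nu>\<close> on
  each cell. Disjointness of the cells keeps it within \<open>[-1, 1]\<close>, and it recovers the
  sum exactly.\<close>

lemma tv_norm_diff_le:
  assumes \<mu>: "prob_space \<mu>" and \<nu>: "prob_space \<nu>" and sets: "sets \<nu> = sets \<mu>"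
    and le: "\<And>\<phi>. \<phi> \<in> borel_measurable \<mu> \<Longrightarrow> (\<And>x. \<bar>\<phi> x\<bar> \<le> 1) \<Longrightarrow> (\<integral>x. \<phi> x \<partial>\<mu>) - (\<integral>x. \<phi> x \<partial>\<nu>) \<le> D"
  shows "tv_norm_diff \<mu> \<nu> \<le> ereal D"
  unfolding tv_norm_diff_def
proof (rule SUP_least)
  fix P assume "P \<in> {P. finite P \<and> P \<subseteq> sets \<mu> \<and> disjoint P \<and> \<Union>P = space \<mu>}"
  then have P: "finite P" "P \<subseteq> sets \<mu>" "disjoint P" by auto
  interpret \<mu>: prob_space \<mu> by fact
  interpret \<nu>: prob_space \<nu> by fact
  define a where "a A = measure \<mu> A - measure \<nu> A" for A
  define \<phi> :: "'a \<Rightarrow> real" where "\<phi> x = (\<Sum>A\<in>P. sgn (a A) * indicator A x)" for x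
  have \<phi>_meas: "\<phi> \<in> borel_measurable \<mu>" unfolding \<phi>_def[abs_def] using P(2)
    by (intro borel_measurable_sum borel_measurable_times borel_measurable_const borel_measurable_indicator) auto
  have \<phi>_bd: "\<bar>\<phi> x\<bar> \<le> 1" for x
  proof (cases "\<exists>A\<in>P. x \<in> A")
    case True
    then obtain A where A: "A \<in> P" "x \<in> A" by blast
    have "\<phi> x = (\<Sum>B\<in>P. if B = A then sgn (a A) else 0)"
      unfolding \<phi>_def using A P(3) by (intro sum.cong refl) (auto simp: indicator_def disjoint_def)
    then show ?thesis using A P(1) by (simp add: sgn_if)
  next
    case False
    then have "\<phi> x = 0" unfolding \<phi>_def by (intro sum.neutral) (auto simp: indicator_def)
    then show ?thesis by simp
  qed
  have int: "(\<integral>x. \<phi> x \<partial>M) = (\<Sum>A\<in>P. sgn (a A) * measure M A)"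
    if "prob_space M" "sets M = sets \<mu>" for M :: "'a measure"
  proof -
    interpret M: prob_space M by fact
    have A: "A \<in> sets M" if "A \<in> P" for A using that P(2) \<open>sets M = sets \<mu>\<close> by auto
    have "(\<integral>x. \<phi> x \<partial>M) = (\<Sum>A\<in>P. \<integral>x. sgn (a A) * indicator A x \<partial>M)"
      unfolding \<phi>_def using A
      by (intro Bochner_Integration.integral_sum integrable_mult_right integrable_real_indicator)
        (simp_all add: M.emeasure_eq_measure)
    also have "\<dots> = (\<Sum>A\<in>P. sgn (a A) * measure M A)"
      using A sets.sets_into_space[of _ M] by (intro sum.cong refl) (simp add: Int_absorb2)
    finally show ?thesis .
  qed
  have "(\<Sum>A\<in>P. \<bar>measure \<mu> A - measure \<nu> A\<bar>) = (\<integral>x. \<phi> x \<partial>\<mu>) - (\<integral>x. \<phi> x \<partial>\<nu>)"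
    unfolding int[OF \<mu> refl] int[OF \<nu> sets] sum_subtractf[symmetric]
    by (intro sum.cong refl) (simp add: a_def sgn_if algebra_simps abs_if)
  then show "ereal (\<Sum>A\<in>P. \<bar>measure \<mu> A - measure \<nu> A\<bar>) \<le> ereal D"
    using le[OF \<phi>_meas \<phi>_bd] by simp
qed

text \<open>Averaged over the noise of the last step, a bounded function of \<open>k\<close>
  coordinates has become Lipschitz in the previous state. This regularity comes from
  \<open>p\<close>, so \<open>V\<close> stands in place of \<open>1 - c\<close>; the
  \<open>+ 1\<close> keeps the scale positive.\<close>

lemma tv_step:
  assumes V: "0 \<le> V" "\<And>\<phi> a b. \<phi> \<in> borel_measurable borel \<Longrightarrow> (\<And>x. \<bar>\<phi> x\<bar> \<le> 1) \<Longrightarrow>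
      \<bar>(\<integral>x. \<phi> x \<partial>noise a) - (\<integral>x. \<phi> x \<partial>noise b)\<bar> \<le> V * \<bar>a - b\<bar>"
    and \<nu>: "\<nu> \<in> prob_measures borel" and \<mu>: "\<mu> \<in> prob_measures (torus N)" and N: "1 \<le> N" and k: "k \<le> N"
    and w: "wass_le N w \<mu> (measure_power \<nu> N)"
  shows "tv_norm_diff (marginal k (particle_transfer p f h N \<mu>)) (measure_power (self_consistent_transfer p f h \<nu>) k)
    \<le> ereal ((k * V + 1) * (\<Lambda> * w + 2 * H / sqrt N))"
proof (rule tv_norm_diff_le)
  note P\<mu> = particle_transfer_prob_measures[OF \<mu>] and P\<nu> = self_consistent_transfer_prob_measures[OF \<nu>]
  note m = prob_measuresD[OF marginal_prob_measures[OF P\<mu> k]]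
    prob_measuresD[OF measure_power_prob_measures[OF P\<nu>, of k]]
  show "prob_space (marginal k (particle_transfer p f h N \<mu>))"
    "prob_space (measure_power (self_consistent_transfer p f h \<nu>) k)"
    "sets (measure_power (self_consistent_transfer p f h \<nu>) k) = sets (marginal k (particle_transfer p f h N \<mu>))"
    by (simp_all add: m)
  fix \<phi> :: "(nat \<Rightarrow> circle) \<Rightarrow> real"
  assume \<phi>: "\<phi> \<in> borel_measurable (marginal k (particle_transfer p f h N \<mu>))" "\<And>x. \<bar>\<phi> x\<bar> \<le> 1"
  then have \<phi>_meas: "\<phi> \<in> borel_measurable (torus k)" using m(2) by (simp cong: measurable_cong_sets)
  have sb: "shift_bound N (\<lambda>x. \<phi> (restrict x {1..k})) (\<lambda>j. of_bool (j \<le> k) * V)"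
    by (rule shift_bound_marginal[OF V k \<phi>_meas \<phi>(2)])
  have "(\<Sum>j\<in>{1..N}. of_bool (j \<le> k) * V) = (\<Sum>j\<in>{1..k}. V)"
    using k by (intro sum.mono_neutral_cong_right) auto
  also have "\<dots> = k * V" by simp
  finally have eq: "(\<Sum>j\<in>{1..N}. of_bool (j \<le> k) * V) = k * V" .
  have "(\<Sum>j\<in>{1..N}. of_bool (j \<le> k) * V) \<le> k * V + 1" unfolding eq by simp
  moreover have "0 < k * V + 1" using V(1) by (simp add: add_nonneg_pos)
  ultimately have "\<bar>(\<integral>x. \<phi> (restrict x {1..k}) \<partial>particle_transfer p f h N \<mu>)
      - (\<integral>x. \<phi> (restrict x {1..k}) \<partial>measure_power (self_consistent_transfer p f h \<nu>) N)\<bar>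
      \<le> (k * V + 1) * (\<Lambda> * w + 2 * H / sqrt N)"
    by (rule one_step[OF \<nu> \<mu> N w sb])
  moreover have "(\<integral>y. \<phi> y \<partial>marginal k (particle_transfer p f h N \<mu>))
      = (\<integral>x. \<phi> (restrict x {1..k}) \<partial>particle_transfer p f h N \<mu>)"
    by (rule integral_marginal[OF P\<mu> k \<phi>_meas])
  moreover have "(\<integral>y. \<phi> y \<partial>measure_power (self_consistent_transfer p f h \<nu>) k)
      = (\<integral>x. \<phi> (restrict x {1..k}) \<partial>measure_power (self_consistent_transfer p f h \<nu>) N)"
    using integral_marginal[OF measure_power_prob_measures[OF P\<nu>] k \<phi>_meas] marginal_measure_power[OF P\<nu> k] by simp
  ultimately show "(\<integral>y. \<phi> y \<partial>marginal k (particle_transfer p f h N \<mu>))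
      - (\<integral>y. \<phi> y \<partial>measure_power (self_consistent_transfer p f h \<nu>) k) \<le> (k * V + 1) * (\<Lambda> * w + 2 * H / sqrt N)"
    by linarith
qed

end

section \<open>Propagation of chaos\<close>

lemma SUP_ereal_real:
  fixes q :: "'a \<Rightarrow> real"
  assumes "S \<noteq> {}" and q: "\<And>x. x \<in> S \<Longrightarrow> 0 \<le> q x" "\<And>x. x \<in> S \<Longrightarrow> q x \<le> L"
  obtains l where "0 \<le> l" "(SUP x\<in>S. ereal (q x)) = ereal l" "\<And>x. x \<in> S \<Longrightarrow> q x \<le> l"
proof -
  define s where "s = (SUP x\<in>S. ereal (q x))"
  have upper: "ereal (q x) \<le> s" if "x \<in> S" for x
    unfolding s_def using that by (rule SUP_upper)
  obtain x where "x \<in> S" using assms(1) by blast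
  then have "0 \<le> s" using upper[of x] q(1)[of x] by (metis ereal_less_eq(5) order_trans)
  moreover have "s \<le> ereal L" unfolding s_def by (rule SUP_least) (simp add: q)
  ultimately obtain l where l: "s = ereal l" by (cases s) auto
  show thesis
    using \<open>0 \<le> s\<close> upper unfolding l by (intro that[of l]) (auto simp: s_def[symmetric] l)
qed

text \<open>An equality with \<open>Lip f\<close>, not just a majorant, is provided, since smallness
  is assumed of the extended-real constant itself.\<close>

lemma Lip_real:
  assumes "L-lipschitz_on UNIV f"
  obtains l where "0 \<le> l" "Lip f = ereal l" "\<And>u u'. \<bar>f u - f u'\<bar> \<le> l * dist u u'"
proof -
  let ?S = "{(u, u'). u \<noteq> u'} :: (circle \<times> circle) set"
  let ?q = "\<lambda>(u, u'). \<bar>f u - f u'\<bar> / dist u u'"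
  have "?S \<noteq> {}" using circle_two_points by auto
  moreover have "0 \<le> ?q x" for x by (simp add: split_beta)
  moreover have "?q x \<le> L" if "x \<in> ?S" for x
    using that lipschitz_onD[OF assms, of "fst x" "snd x"] by (auto simp: divide_le_eq dist_real_def)
  ultimately obtain l where l: "0 \<le> l" "(SUP x\<in>?S. ereal (?q x)) = ereal l" "\<And>x. x \<in> ?S \<Longrightarrow> ?q x \<le> l"
    using SUP_ereal_real[of ?S ?q L] by blast
  show thesis
  proof (rule that[OF l(1)])
    show "Lip f = ereal l" using l(2) by (simp add: Lip_def split_beta')
    show "\<bar>f u - f u'\<bar> \<le> l * dist u u'" for u u'
      using l(3)[of "(u, u')"] by (cases "u = u'") (auto simp: divide_le_eq split: if_splits)
  qed
qed

lemma Lip_fst_real: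
  assumes "L-lipschitz_on UNIV h"
  obtains l where "0 \<le> l" "Lip_fst h = ereal l" "\<And>u u' v. \<bar>h (u, v) - h (u', v)\<bar> \<le> l * dist u u'"
proof -
  let ?S = "{(u, u', v). u \<noteq> u'} :: (circle \<times> circle \<times> circle) set"
  let ?q = "\<lambda>(u, u', v). \<bar>h (u, v) - h (u', v)\<bar> / dist u u'"
  have "?S \<noteq> {}" using circle_two_points by auto
  moreover have "0 \<le> ?q x" for x by (simp add: split_beta)
  moreover have "?q x \<le> L" if "x \<in> ?S" for x
    using that lipschitz_onD[OF assms, of "(fst x, snd (snd x))" "(fst (snd x), snd (snd x))"]
    by (auto simp: divide_le_eq dist_real_def dist_Pair_Pair)
  ultimately obtain l where l: "0 \<le> l" "(SUP x\<in>?S. ereal (?q x)) = ereal l" "\<And>x. x \<in> ?S \<Longrightarrow> ?q x \<le> l"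
    using SUP_ereal_real[of ?S ?q L] by blast
  show thesis
  proof (rule that[OF l(1)])
    show "Lip_fst h = ereal l" using l(2) by (simp add: Lip_fst_def split_beta')
    show "\<bar>h (u, v) - h (u', v)\<bar> \<le> l * dist u u'" for u u' v
      using l(3)[of "(u, u', v)"] by (cases "u = u'") (auto simp: divide_le_eq split: if_splits)
  qed
qed

lemma Lip_snd_real:
  assumes "L-lipschitz_on UNIV h"
  obtains l where "0 \<le> l" "Lip_snd h = ereal l" "\<And>u v v'. \<bar>h (u, v) - h (u, v')\<bar> \<le> l * dist v v'"
proof -
  let ?S = "{(u, v, v'). v \<noteq> v'} :: (circle \<times> circle \<times> circle) set"
  let ?q = "\<lambda>(u, v, v'). \<bar>h (u, v) - h (u, v')\<bar> / dist v v'"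
  have "?S \<noteq> {}" using circle_two_points by auto
  moreover have "0 \<le> ?q x" for x by (simp add: split_beta)
  moreover have "?q x \<le> L" if "x \<in> ?S" for x
    using that lipschitz_onD[OF assms, of "(fst x, fst (snd x))" "(fst x, snd (snd x))"]
    by (auto simp: divide_le_eq dist_real_def dist_Pair_Pair)
  ultimately obtain l where l: "0 \<le> l" "(SUP x\<in>?S. ereal (?q x)) = ereal l" "\<And>x. x \<in> ?S \<Longrightarrow> ?q x \<le> l"
    using SUP_ereal_real[of ?S ?q L] by blast
  show thesis
  proof (rule that[OF l(1)])
    show "Lip_snd h = ereal l" using l(2) by (simp add: Lip_snd_def split_beta')
    show "\<bar>h (u, v) - h (u, v')\<bar> \<le> l * dist v v'" for u v v'
      using l(3)[of "(u, v, v')"] by (cases "v = v'") (auto simp: divide_le_eq split: if_splits)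
  qed
qed

text \<open>Integrating the strict bound over the circle, which has mass 1.\<close>

lemma (in circle_noise) lower_bound_less_1:
  assumes "\<And>x. x \<in> {0..1} \<Longrightarrow> c < p x"
  shows "c < 1"
proof -
  interpret prob_space circle_lebesgue by (rule prob_space_circle_lebesgue)
  have "c < p (circle_rep x)" for x using assms circle_rep_bounds[of x] by simp
  then have "(\<integral>x. c \<partial>circle_lebesgue) < (\<integral>x. p (circle_rep x) \<partial>circle_lebesgue)"
    using integrable_p[of 0] emeasure_space_1 by (intro integral_less_AE_space) auto
  then show ?thesis using integral_p[of 0] prob_space by simp
qed

lemma tv_norm_diff_nonneg: "0 \<le> tv_norm_diff \<mu> \<nu>"
  unfolding tv_norm_diff_def by (intro SUP_upper2[of "{space \<mu>}"]) auto

lemma ereal_tendsto_0I: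
  fixes X :: "nat \<Rightarrow> ereal"
  assumes "\<And>N. 0 \<le> X N" and le: "\<And>\<epsilon>. 0 < \<epsilon> \<Longrightarrow> \<forall>\<^sub>F N in sequentially. X N \<le> ereal \<epsilon>"
  shows "X \<longlonglongrightarrow> 0"
proof (rule order_tendstoI)
  fix a :: ereal assume "a < 0"
  then show "\<forall>\<^sub>F N in sequentially. a < X N"
    using assms(1) by (intro always_eventually allI) (rule less_le_trans)
next
  fix a :: ereal assume "0 < a"
  then obtain \<epsilon> where \<epsilon>: "0 < ereal \<epsilon>" "ereal \<epsilon> < a" using ereal_dense2 by blast
  then have "\<forall>\<^sub>F N in sequentially. X N \<le> ereal \<epsilon>" by (intro le) simp
  then show "\<forall>\<^sub>F N in sequentially. X N < a"
    by eventually_elim (rule le_less_trans[OF _ \<epsilon>(2)])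
qed

lemma divide_sqrt_tendsto_0: "(\<lambda>N. a / sqrt (real N)) \<longlonglongrightarrow> 0"
  by (intro tendsto_divide_0[OF tendsto_const] filterlim_at_top_imp_at_infinity
      filterlim_compose[OF sqrt_at_top filterlim_real_sequentially])

lemma (in mean_field) error_tendsto_0: "error \<longlonglongrightarrow> 0"
  unfolding error_def[abs_def]
  using tendsto_divide_zero[OF tendsto_mult_right_zero[OF divide_sqrt_tendsto_0, of "1 - c" "2 * H"]] .

theorem corollary1p6:
  fixes f :: "circle \<Rightarrow> real"
    and h :: "circle \<times> circle \<Rightarrow> real"
    and p :: "real \<Rightarrow> real"
    and c :: real
    and \<mu> :: "nat \<Rightarrow> (nat \<Rightarrow> circle) measure"
  assumes f_lipschitz: "\<exists>L. L-lipschitz_on UNIV f"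
    and h_lipschitz: "\<exists>L. L-lipschitz_on UNIV h"
    and p_measurable: "p \<in> borel_measurable borel"
    and p_nonneg: "\<And>x. 0 \<le> p x"
    and p_periodic: "\<And>x. p (x + 1) = p x"
    and p_density: "(\<integral>\<^sup>+x\<in>{0..1}. ennreal (p x) \<partial>lborel) = 1"
    and c_pos: "c > 0"
    and p_lower: "\<And>x. x \<in> {0..1} \<Longrightarrow> p x > c"
    and kappa: "ereal (1 - c) * (Lip f + Lip_fst h + Lip_snd h) < ereal (sqrt 3 / 2)"
    and mu_prob: "\<And>N. N \<ge> 2 \<Longrightarrow> \<mu> N \<in> prob_measures (torus N)"
    and mu_exchangeable: "\<And>N. N \<ge> 2 \<Longrightarrow> exchangeable N (\<mu> N)"
    and mu_chaotic: "\<And>k. k \<ge> 1 \<Longrightarrow>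
      (\<lambda>N. dobrushin_wasserstein k (marginal k (\<mu> N)) (measure_power (marginal1 (\<mu> N)) k))
        \<longlonglongrightarrow> 0"
  shows
    "((\<lambda>N. SUP n::nat.
        dobrushin_wasserstein N
          ((particle_transfer p f h N ^^ n) (\<mu> N))
          (measure_power ((self_consistent_transfer p f h ^^ n) (marginal1 (\<mu> N))) N))
        \<longlonglongrightarrow> 0)
     \<and> (bounded_variation_on 0 1 p \<longrightarrow>
        (\<forall>k\<ge>1. (\<lambda>N. SUP n\<in>{1::nat..}.
          tv_norm_diff
            (marginal k ((particle_transfer p f h N ^^ n) (\<mu> N)))
            (measure_power ((self_consistent_transfer p f h ^^ n) (marginal1 (\<mu> N))) k))
        \<longlonglongrightarrow> 0))"
proof -
  interpret circle_noise p
    using p_measurable p_nonneg p_periodic p_density by unfold_locales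
  obtain Lf Lh where L: "Lf-lipschitz_on UNIV f" "Lh-lipschitz_on UNIV h"
    using f_lipschitz h_lipschitz by blast
  obtain lf where lf: "0 \<le> lf" "Lip f = ereal lf" "\<And>u u'. \<bar>f u - f u'\<bar> \<le> lf * dist u u'"
    using Lip_real[OF L(1)] by blast
  obtain l1 where l1: "0 \<le> l1" "Lip_fst h = ereal l1" "\<And>u u' v. \<bar>h (u, v) - h (u', v)\<bar> \<le> l1 * dist u u'"
    using Lip_fst_real[OF L(2)] by blast
  obtain l2 where l2: "0 \<le> l2" "Lip_snd h = ereal l2" "\<And>u v v'. \<bar>h (u, v) - h (u, v')\<bar> \<le> l2 * dist v v'"
    using Lip_snd_real[OF L(2)] by blast
  have c1: "c < 1" using p_lower by (rule lower_bound_less_1)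
  \<comment> \<open>The maximum keeps \<open>\<Lambda>\<close> positive when \<open>f\<close> and \<open>h\<close> are constant.\<close>
  define \<Lambda> where "\<Lambda> = max (lf + l1 + l2) (1 / 2)"
  have "sqrt 3 < sqrt 4" by (rule real_sqrt_less_mono) simp
  then have "sqrt 3 / 2 < 1" by simp
  moreover have "(1 - c) * (lf + l1 + l2) < sqrt 3 / 2" using kappa by (simp add: lf l1 l2)
  ultimately have contraction: "(1 - c) * \<Lambda> < 1" using c_pos c1 by (auto simp: \<Lambda>_def max_def)
  obtain u0 v0 :: circle where True by blast
  \<comment> \<open>The circle has diameter at most 1, so moving the arguments to the base point
    changes \<open>h\<close> by at most \<open>l1 + l2\<close>; the last summand makes
    \<open>H\<close> positive.\<close>
  define H where "H = \<bar>h (u0, v0)\<bar> + l1 + l2 + 1"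
  have H: "\<bar>h (u, v)\<bar> \<le> H" for u v
    using l1(3)[of u v u0] mult_left_mono[OF dist_circle_le_1[of u u0] l1(1)]
      l2(3)[of u0 v v0] mult_left_mono[OF dist_circle_le_1[of v v0] l2(1)]
    by (simp add: H_def)
  have f_meas: "f \<in> borel_measurable borel"
    using lipschitz_on_continuous_on[OF L(1)] by (rule borel_measurable_continuous_onI)
  have h_meas: "h \<in> borel_measurable (borel \<Otimes>\<^sub>M borel)"
    unfolding borel_prod using lipschitz_on_continuous_on[OF L(2)] by (rule borel_measurable_continuous_onI)
  interpret mean_field p f h c lf l1 l2 \<Lambda> H
    using lf l1 l2 f_meas h_meas H c_pos c1 p_lower contraction
    by unfold_locales (auto simp: \<Lambda>_def H_def)
  let ?\<nu> = "\<lambda>N. marginal1 (\<mu> N)"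
  have \<nu>: "?\<nu> N \<in> prob_measures borel" if "2 \<le> N" for N
    using mu_prob[OF that] that by (intro marginal1_prob_measures) auto
  have initial: "\<forall>\<^sub>F N in sequentially. wass_le N \<epsilon> (\<mu> N) (measure_power (?\<nu> N) N)" if "0 < \<epsilon>" for \<epsilon>
    using mu_prob mu_exchangeable mu_chaotic[of 2] that by (intro pair_chaos_imp_full_chaos) auto
  have uniform: "\<forall>\<^sub>F N in sequentially. \<forall>n. wass_le N \<epsilon> ((particle_transfer p f h N ^^ n) (\<mu> N))
      (measure_power ((self_consistent_transfer p f h ^^ n) (?\<nu> N)) N)" if "0 < \<epsilon>" for \<epsilon>
  proof -
    \<comment> \<open>Half of \<open>\<epsilon>\<close> goes to the fluctuation error, half to the
      initial distance; neither depends on the time, so one threshold for \<open>N\<close> serves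
      every \<open>n\<close>.\<close>
    have "\<forall>\<^sub>F N in sequentially. error N < \<epsilon> / 2"
      using order_tendstoD(2)[OF error_tendsto_0, of "\<epsilon> / 2"] that by simp
    then show ?thesis
      using initial[OF half_gt_zero[OF that]] eventually_ge_at_top[of 2]
    proof eventually_elim
      case (elim N)
      then have "wass_le N (\<epsilon> / 2 + error N) ((particle_transfer p f h N ^^ n) (\<mu> N))
          (measure_power ((self_consistent_transfer p f h ^^ n) (?\<nu> N)) N)" for n
        using that by (intro wass_iterate \<nu> mu_prob) auto
      moreover have "\<epsilon> / 2 + error N \<le> \<epsilon>" using elim(1) by simp
      ultimately show ?case by (blast intro: wass_le_mono)
    qed
  qed
  have part1: "(\<lambda>N. SUP n::nat. dobrushin_wasserstein N ((particle_transfer p f h N ^^ n) (\<mu> N))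
      (measure_power ((self_consistent_transfer p f h ^^ n) (?\<nu> N)) N)) \<longlonglongrightarrow> 0"
  proof (rule ereal_tendsto_0I)
    show "0 \<le> (SUP n::nat. dobrushin_wasserstein N ((particle_transfer p f h N ^^ n) (\<mu> N))
      (measure_power ((self_consistent_transfer p f h ^^ n) (?\<nu> N)) N))" for N
      by (rule SUP_upper2[of 0]) (simp_all add: dobrushin_wasserstein_nonneg)
    fix \<epsilon> :: real assume "0 < \<epsilon>"
    from uniform[OF this] show "\<forall>\<^sub>F N in sequentially.
      (SUP n::nat. dobrushin_wasserstein N ((particle_transfer p f h N ^^ n) (\<mu> N))
      (measure_power ((self_consistent_transfer p f h ^^ n) (?\<nu> N)) N)) \<le> ereal \<epsilon>"
      by eventually_elim (blast intro: SUP_least dobrushin_wasserstein_le)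
  qed
  have part2: "(\<lambda>N. SUP n\<in>{1::nat..}. tv_norm_diff (marginal k ((particle_transfer p f h N ^^ n) (\<mu> N)))
      (measure_power ((self_consistent_transfer p f h ^^ n) (?\<nu> N)) k)) \<longlonglongrightarrow> 0"
    if bv: "bounded_variation_on 0 1 p" for k
  proof (rule ereal_tendsto_0I)
    show "0 \<le> (SUP n\<in>{1::nat..}. tv_norm_diff (marginal k ((particle_transfer p f h N ^^ n) (\<mu> N)))
      (measure_power ((self_consistent_transfer p f h ^^ n) (?\<nu> N)) k))" for N
      by (rule SUP_upper2[of 1]) (simp_all add: tv_norm_diff_nonneg)
    obtain V where V: "0 \<le> V" "\<And>\<phi> a b. \<phi> \<in> borel_measurable borel \<Longrightarrow> (\<And>x. \<bar>\<phi> x\<bar> \<le> 1) \<Longrightarrow>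
      \<bar>(\<integral>x. \<phi> x \<partial>noise a) - (\<integral>x. \<phi> x \<partial>noise b)\<bar> \<le> V * \<bar>a - b\<bar>"
      using noise_tv_bound[OF bv] by blast
    fix \<epsilon> :: real assume \<epsilon>: "0 < \<epsilon>"
    define K where "K = k * V + 1"
    have K: "0 < K" using V(1) by (simp add: K_def add_nonneg_pos)
    \<comment> \<open>Chosen so that the term with \<open>\<delta>\<close> in \<open>tv_step\<close>
      takes half of \<open>\<epsilon>\<close>; the fluctuation term takes the other half.\<close>
    define \<delta> where "\<delta> = \<epsilon> / (2 * K * \<Lambda>)"
    have \<delta>: "0 < \<delta>" "K * (\<Lambda> * \<delta>) = \<epsilon> / 2" using K \<epsilon> \<Lambda>(2) by (simp_all add: \<delta>_def)
    have "\<forall>\<^sub>F N in sequentially. 2 * H / sqrt (real N) < \<epsilon> / (2 * K)"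
      using order_tendstoD(2)[OF divide_sqrt_tendsto_0, of "\<epsilon> / (2 * K)"] \<epsilon> K by simp
    then show "\<forall>\<^sub>F N in sequentially. (SUP n\<in>{1::nat..}.
        tv_norm_diff (marginal k ((particle_transfer p f h N ^^ n) (\<mu> N)))
        (measure_power ((self_consistent_transfer p f h ^^ n) (?\<nu> N)) k)) \<le> ereal \<epsilon>"
      using uniform[OF \<delta>(1)] eventually_ge_at_top[of 2] eventually_ge_at_top[of k]
    proof eventually_elim
      case (elim N)
      have small: "K * (\<Lambda> * \<delta> + 2 * H / sqrt N) \<le> \<epsilon>"
      proof -
        have "K * (2 * H / sqrt N) \<le> K * (\<epsilon> / (2 * K))"
          using elim(1) K by (intro mult_left_mono) auto
        also have "\<dots> = \<epsilon> / 2" using K by simp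
        finally show ?thesis using \<delta>(2) by (simp add: distrib_left)
      qed
      show ?case
      proof (rule SUP_least)
        fix n :: nat assume "n \<in> {1..}"
        \<comment> \<open>Since \<open>n \<ge> 1\<close> there is a last step whose noise does the
          smoothing; the first \<open>m\<close> steps only have to preserve the Wasserstein
          bound.\<close>
        then obtain m where m: "n = Suc m" by (cases n) auto
        have "tv_norm_diff (marginal k ((particle_transfer p f h N ^^ n) (\<mu> N)))
            (measure_power ((self_consistent_transfer p f h ^^ n) (?\<nu> N)) k)
          \<le> ereal (K * (\<Lambda> * \<delta> + 2 * H / sqrt N))"
          unfolding m funpow.simps comp_apply K_def
          using elim by (intro tv_step[OF V iterates_prob_measures[OF \<nu> mu_prob]]) auto
        also have "\<dots> \<le> ereal \<epsilon>" using small by simp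
        finally show "tv_norm_diff (marginal k ((particle_transfer p f h N ^^ n) (\<mu> N)))
            (measure_power ((self_consistent_transfer p f h ^^ n) (?\<nu> N)) k) \<le> ereal \<epsilon>" .
      qed
    qed
  qed
  from part1 part2 show ?thesis by blast
qed

end
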